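(* Let $\Gamma\in\mathbb{R}$. Let $\Omega\subset\mathbb{R}^2$ be a bounded domain such that $|\Omega|=\pi$ and $\Sigma:=\partial\Omega$ is of class $C^{1,1}$. Assume that there exists a solution $u\in C^2(\mathbb{R}^2\setminus\overline\Omega)\cap C^1(\mathbb{R}^2\setminus\Omega)$ of the overdetermined problem $$-\Delta u=0\ \text{ in }\mathbb{R}^2\setminus\overline\Omega,\qquad u=1\ \text{ on }\Sigma,\qquad \partial_\nu u=\Gamma\,\mathcal H+\Gamma-1\ \text{ on }\Sigma,\qquad u(x)+\log|x|=O(1)\ \text{ as }|x|\to\infty.$$ Then $\Omega$ is a unit disk. Consequently, there is $x_0\in\mathbb{R}^2$ such that $u(x)=1-\log|x-x_0|$ and $\partial\Omega=\partial B_1(x_0)$.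
   Context: $|\Omega|$ denotes Lebesgue measure. $\nu$ is the outer unit normal to $\Omega$ on $\Sigma$ (so it points into $\mathbb{R}^2\setminus\overline\Omega$), and $\partial_\nu u$ is the derivative of $u$ in direction $\nu$ taken from the exterior. $\mathcal H$ is the curvature of $\Sigma$ with the sign convention $\mathcal H_{\partial B_1}=-1$ for the unit disk $\Omega=B_1$; that is, $\mathcal H=-\operatorname{div}_\Sigma\nu$. For a $C^{1,1}$ curve $\mathcal H$ is defined almost everywhere, and the Neumann condition is understood almost everywhere on $\Sigma$. A domain is a nonempty connected open set; $\mathbb{R}^2\setminus\overline\Omega$ is not assumed connected. *)

theory Defs
  imports "HOL-Analysis.Analysis" "HOL-Library.Landau_Symbols"
begin

definition is_domain :: "'a::topological_space set \<Rightarrow> bool" where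
  "is_domain U \<longleftrightarrow> U \<noteq> {} \<and> open U \<and> connected U"

definition partial_deriv :: "'a::euclidean_space \<Rightarrow> ('a \<Rightarrow> real) \<Rightarrow> 'a \<Rightarrow> real" where
  "partial_deriv b u x = frechet_derivative u (at x) b"

definition C1_on :: "'a::euclidean_space set \<Rightarrow> ('a \<Rightarrow> real) \<Rightarrow> bool" where
  "C1_on U u \<longleftrightarrow> (\<forall>x\<in>U. u differentiable (at x)) \<and>
     (\<forall>b\<in>Basis. continuous_on U (partial_deriv b u))"

definition C2_on :: "'a::euclidean_space set \<Rightarrow> ('a \<Rightarrow> real) \<Rightarrow> bool" where
  "C2_on U u \<longleftrightarrow> C1_on U u \<and> (\<forall>b\<in>Basis. C1_on U (partial_deriv b u))"

text \<open>\<open>C\<^sup>1\<close> up to the boundary of a closed set: the first derivatives, which exist in the interior,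
  extend continuously to the whole set.\<close>

definition C1_up_to_boundary :: "'a::euclidean_space set \<Rightarrow> ('a \<Rightarrow> real) \<Rightarrow> bool" where
  "C1_up_to_boundary K u \<longleftrightarrow> continuous_on K u \<and> C1_on (interior K) u \<and>
     (\<forall>b\<in>Basis. \<exists>g. continuous_on K g \<and> (\<forall>x\<in>interior K. g x = partial_deriv b u x))"

definition laplacian :: "('a::euclidean_space \<Rightarrow> real) \<Rightarrow> 'a \<Rightarrow> real" where
  "laplacian u x = (\<Sum>b\<in>Basis. partial_deriv b (partial_deriv b u) x)"

text \<open>Near each boundary point, in suitable orthonormal coordinates \<open>(e, n)\<close> centred at that
  point, the open set is the strict subgraph of a \<open>C\<^sup>1\<^sup>,\<^sup>1\<close> function.\<close>

definition C11_boundary :: "(real^2) set \<Rightarrow> bool" where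
  "C11_boundary \<Omega> \<longleftrightarrow> (\<forall>p\<in>frontier \<Omega>. \<exists>e n r \<phi> \<phi>' L.
     norm e = 1 \<and> norm n = 1 \<and> e \<bullet> n = 0 \<and> r > 0 \<and>
     (\<forall>s\<in>{-r<..<r}. (\<phi> has_real_derivative \<phi>' s) (at s)) \<and>
     L-lipschitz_on {-r<..<r} \<phi>' \<and>
     \<Omega> \<inter> ball p r = {x \<in> ball p r. (x - p) \<bullet> n < \<phi> ((x - p) \<bullet> e)})"

text \<open>The limit says that \<open>n\<close> is orthogonal to the boundary at \<open>x\<close>; the second condition selects the
  orientation. Where the boundary is of class \<open>C\<^sup>1\<close> there is exactly one such unit vector.\<close>

definition outer_normal :: "'a::euclidean_space set \<Rightarrow> 'a \<Rightarrow> 'a" where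
  "outer_normal \<Omega> x = (THE n. norm n = 1 \<and>
     ((\<lambda>y. n \<bullet> (y - x) / norm (y - x)) \<longlongrightarrow> 0) (at x within frontier \<Omega>) \<and>
     (\<forall>\<^sub>F t in at_right 0. x + t *\<^sub>R n \<notin> closure \<Omega>))"

text \<open>The tangential divergence of a field \<open>X\<close> along a plane curve \<open>S\<close> with unit normal \<open>N\<close> is
  \<open>\<tau> \<bullet> D\<^bsub>\<tau>\<^esub> X\<close> for either unit tangent \<open>\<tau>\<close>. A derivative \<open>D\<close> within \<open>S\<close> is not unique, but its
  value on tangent vectors is. At points where \<open>X\<close> is not differentiable along \<open>S\<close> the value is
  unspecified.\<close>

definition tangential_div ::
  "(real^2) set \<Rightarrow> (real^2 \<Rightarrow> real^2) \<Rightarrow> (real^2 \<Rightarrow> real^2) \<Rightarrow> real^2 \<Rightarrow> real" where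
  "tangential_div S N X x = (THE d. \<exists>D \<tau>. (X has_derivative D) (at x within S) \<and>
     norm \<tau> = 1 \<and> \<tau> \<bullet> N x = 0 \<and> d = \<tau> \<bullet> D \<tau>)"

text \<open>Sign convention: the curvature of the boundary of the unit disk is \<open>-1\<close>.\<close>

definition curvature :: "(real^2) set \<Rightarrow> real^2 \<Rightarrow> real" where
  "curvature \<Omega> x = - tangential_div (frontier \<Omega>) (outer_normal \<Omega>) (outer_normal \<Omega>) x"

definition has_exterior_normal_derivative ::
  "('a::euclidean_space \<Rightarrow> real) \<Rightarrow> 'a set \<Rightarrow> 'a \<Rightarrow> real \<Rightarrow> bool" where
  "has_exterior_normal_derivative u \<Omega> x d \<longleftrightarrow>
     ((\<lambda>t. u (x + t *\<^sub>R outer_normal \<Omega> x)) has_real_derivative d) (at_right 0)"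

text \<open>One-dimensional Hausdorff (outer) measure, which is arc length on \<open>C\<^sup>1\<close> curves.\<close>

definition hausdorff1 :: "'a::metric_space set \<Rightarrow> ennreal" where
  "hausdorff1 A = (SUP \<delta>\<in>{0<..}. INF C\<in>{C :: nat \<Rightarrow> 'a set. A \<subseteq> (\<Union>i. C i) \<and>
     (\<forall>i. bounded (C i) \<and> diameter (C i) \<le> \<delta>)}. \<Sum>i. ennreal (diameter (C i)))"

definition ae_on_curve :: "'a::metric_space set \<Rightarrow> ('a \<Rightarrow> bool) \<Rightarrow> bool" where
  "ae_on_curve S P \<longleftrightarrow> hausdorff1 {x\<in>S. \<not> P x} = 0"

end

theory Submission
  imports Defs "HOL-Complex_Analysis.Complex_Analysis"
begin

text \<open>The outer part of the exterior is mapped conformally onto a punctured disc. There the Dirichlet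
  problem solves itself, and the Neumann condition becomes an ordinary differential equation on the
  unit circle.

  Let \<open>A\<close> be the closure of \<open>\<Omega>\<close> with its holes filled in. Its complement is the image of
  the punctured unit disc under a conformal map \<open>F w = a + cap / w + B w\<close> with \<open>B\<close> holomorphic, and
  the maximum principle gives \<open>u (F w) = 1 + ln \<bar>w\<bar>\<close> (\<open>exterior_green_function\<close>). Hence the data are
  encoded in the function \<open>\<kappa> w = - w\<^sup>2 F' w\<close>, holomorphic and without zeros, with \<open>\<kappa> 0 = cap\<close>. On the
  circle \<open>1 / \<bar>\<kappa>\<bar>\<close> is the length of the gradient of \<open>u\<close>. The gradient is continuous up to the
  boundary and does not vanish there by the Hopf lemma (\<open>hopf\<close>), so \<open>\<kappa>\<close> extends to the closed disc,
  continuously and without zeros, and \<open>t \<mapsto> F (cis t)\<close> is a \<open>C\<^sup>1\<close> curve in the boundary of \<open>\<Omega>\<close>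
  (\<open>boundary_curve\<close>). Its outer normal is \<open>cis (- t)\<close> times the phase \<open>P = \<kappa> / \<bar>\<kappa>\<bar>\<close>, and differentiating
  the normal turns the Neumann condition into \<open>\<Gamma> P' = \<i> (\<Gamma> - 1) (1 - \<bar>\<kappa>\<bar>) P\<close> almost everywhere
  (\<open>boundary_phase\<close>).

  If \<open>\<Gamma> = 1\<close>, then \<open>P\<close> is constant. A rotation makes \<open>\<kappa>\<close> real on the circle, so \<open>\<kappa>\<close> is constant.
  If \<open>\<Gamma> \<noteq> 1\<close>, then \<open>P\<close> has winding number zero because \<open>\<kappa>\<close> has no zeros in the disc; thus the
  mean of \<open>\<bar>\<kappa>\<bar>\<close> over the circle is \<open>1\<close> (\<open>phase_equation\<close>). Since \<open>cap\<close> is the mean of \<open>\<kappa>\<close>, this gives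
  \<open>\<bar>cap\<bar> \<le> 1\<close>, whereas \<open>\<pi> = \<bar>\<Omega>\<bar> \<le> \<bar>A\<bar> \<le> \<pi> \<bar>cap\<bar>\<^sup>2\<close> (\<open>cap_area\<close>) gives \<open>\<bar>cap\<bar> \<ge> 1\<close>. Equality in the
  triangle inequality for the mean again forces \<open>\<kappa>\<close> to be constant (\<open>mean_modulus_rigidity\<close>). In all
  cases \<open>A\<close> is a disc.

  There are no holes: for \<open>\<Gamma> \<noteq> 1\<close> the area inequality leaves no room for them. For \<open>\<Gamma> = 1\<close> the
  solution is constant on a hole, so the Neumann condition says that the boundary of the hole has
  curvature zero almost everywhere; it would contain a straight segment around the hole's point
  farthest from the origin (\<open>no_holes\<close>). So the closure of \<open>\<Omega>\<close> is a disc, its radius is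
  determined by the area, and \<open>u\<close> is read off from \<open>u \<circ> F\<close>.

  The curvature exists only almost everywhere. Two facts about one real variable bridge this gap:
  Lipschitz functions are differentiable almost everywhere (\<open>lipschitz_ae_differentiable\<close>), and a
  Lipschitz curve whose derivative vanishes almost everywhere is constant
  (\<open>lip_at_ae_zero_derivative_imp_const\<close>).\<close>

(* the symbol $ is reserved for the components of a vector *)
no_notation fps_nth (infixl "$" 75)

section \<open>Almost everywhere differentiability of Lipschitz functions\<close>

text \<open>Taking \<open>U\<close> with measure close to the outer measure \<open>m\<close> of \<open>E\<close> gives \<open>m \<le> c m\<close>, hence \<open>m = 0\<close>.
  Working with the outer measure is what sets defined by Dini derivatives call for.\<close>
lemma outer_measure_contraction_imp_negligible:
  fixes E :: "'a::euclidean_space set"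
  assumes bE: "bounded E" and c: "0 \<le> c" "c < 1"
   and contr: "\<And>U. open U \<Longrightarrow> bounded U \<Longrightarrow> E \<subseteq> U \<Longrightarrow>
     \<exists>W \<in> lmeasurable. E \<subseteq> W \<and> measure lebesgue W \<le> c * measure lebesgue U"
  shows "negligible E"
proof -
  define M where "M = {measure lebesgue T |T. T \<in> lmeasurable \<and> E \<subseteq> T}"
  define m where "m = Inf M"
  obtain B where B: "E \<subseteq> ball 0 B"
    using bE bounded_subset_ballD by blast
  have ne: "M \<noteq> {}"
    using B lmeasurable_ball M_def by blast
  have bdd: "bdd_below M"
    unfolding M_def by (rule bdd_belowI[of _ 0]) auto
  have m0: "0 \<le> m"
    unfolding m_def by (rule cInf_greatest[OF ne]) (auto simp: M_def)
  have "m \<le> c * (m + e)" if e: "e > 0" for e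
  proof -
    obtain x where "x \<in> M" "x < m + e/2"
      using cInf_lessD[OF ne, of "m + e/2"] e unfolding m_def by auto
    then obtain T where T: "T \<in> lmeasurable" "E \<subseteq> T" "measure lebesgue T < m + e/2"
      unfolding M_def by auto
    obtain U where U0: "open U" "T \<subseteq> U" "U - T \<in> lmeasurable" "emeasure lebesgue (U - T) < ennreal (e/2)"
      using sets_lebesgue_outer_open[OF fmeasurableD[OF T(1)], of "e/2"] e by auto
    have UT: "U = T \<union> (U - T)" using U0 by auto
    have Ul: "U \<in> lmeasurable" using T U0 UT by (metis fmeasurable.Un)
    have "measure lebesgue (U - T) < e/2"
      using U0 e by (simp add: emeasure_eq_measure2 ennreal_less_iff)
    then have "measure lebesgue U < measure lebesgue T + e/2"
      using measure_Un_le[of T lebesgue "U - T"] T U0 UT by (smt (verit, best) fmeasurableD)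
    note U = U0(1,2) Ul this
    let ?U = "U \<inter> ball 0 B"
    have "\<exists>W \<in> lmeasurable. E \<subseteq> W \<and> measure lebesgue W \<le> c * measure lebesgue ?U"
      using U T B by (intro contr) auto
    then obtain W where W: "W \<in> lmeasurable" "E \<subseteq> W" "measure lebesgue W \<le> c * measure lebesgue ?U"
      by blast
    have "measure lebesgue ?U \<le> measure lebesgue U"
      using U by (intro measure_mono_fmeasurable) auto
    then have "c * measure lebesgue ?U \<le> c * (m + e)"
      using U T c by (intro mult_left_mono) auto
    moreover have "m \<le> measure lebesgue W"
      unfolding m_def using W bdd by (intro cInf_lower) (auto simp: M_def)
    ultimately show ?thesis using W by linarith
  qed
  then have "\<And>e. e > 0 \<Longrightarrow> m \<le> c * m + e"
    by (smt (verit, best) c distrib_left mult_left_le_one_le)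
  then have "m \<le> c * m"
    by (rule field_le_epsilon)
  then have "m * (1 - c) \<le> 0" by (simp add: algebra_simps)
  then have "m = 0" using c m0 by (smt (verit, best) mult_pos_pos)
  show ?thesis
    unfolding negligible_outer
  proof (intro allI impI)
    fix e :: real assume "e > 0"
    then obtain x where "x \<in> M" "x < e"
      using cInf_lessD[OF ne, of e] \<open>m = 0\<close> unfolding m_def by auto
    then show "\<exists>T. E \<subseteq> T \<and> T \<in> lmeasurable \<and> measure lebesgue T < e"
      unfolding M_def by auto
  qed
qed

text \<open>The Vitali covering theorem for balls in the form needed for difference quotients: \<open>P a b\<close> will be a
  condition on the slope of a function between \<open>a\<close> and \<open>b\<close>.\<close>
lemma Vitali_interval_selection:
  fixes E :: "real set"
  assumes U: "open U" "E \<subseteq> U"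
    and fine: "\<And>x d. x \<in> E \<Longrightarrow> d > 0 \<Longrightarrow> \<exists>y. y \<noteq> x \<and> \<bar>y - x\<bar> < d \<and> P (min x y) (max x y)"
  obtains C where "countable C" "\<And>p. p \<in> C \<Longrightarrow> fst p < snd p \<and> P (fst p) (snd p) \<and> {fst p..snd p} \<subseteq> U"
    "disjoint_family_on (\<lambda>p. {fst p..snd p}) C" "negligible (E - (\<Union>p\<in>C. {fst p..snd p}))"
proof -
  define K where "K = {p::real\<times>real. fst p < snd p \<and> P (fst p) (snd p) \<and> {fst p..snd p} \<subseteq> U}"
  let ?a = "\<lambda>p::real\<times>real. (fst p + snd p)/2"
  let ?r = "\<lambda>p::real\<times>real. (snd p - fst p)/2"
  have cb: "cball (?a p) (?r p) = {fst p..snd p}" for p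
    by (auto simp: cball_eq_atLeastAtMost field_simps)
  have r: "\<And>i. i \<in> K \<Longrightarrow> 0 < ?r i" by (auto simp: K_def)
  have S: "\<exists>i. i \<in> K \<and> x \<in> cball (?a i) (?r i) \<and> ?r i < d" if x: "x \<in> E" and d: "0 < d" for x d
  proof -
    obtain e where e: "e > 0" "ball x e \<subseteq> U"
      using x U open_contains_ball by blast
    obtain y where y: "y \<noteq> x" "\<bar>y - x\<bar> < min d e" "P (min x y) (max x y)"
      using fine[OF x, of "min d e"] d e by auto
    have "{min x y..max x y} \<subseteq> ball x e"
      using y by (auto simp: dist_real_def)
    then have "(min x y, max x y) \<in> K"
      using y e by (auto simp: K_def)
    moreover have "x \<in> {min x y..max x y}" by auto
    moreover have "?r (min x y, max x y) < d" using y by auto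
    ultimately show ?thesis unfolding cb by (intro exI[of _ "(min x y, max x y)"]) auto
  qed
  obtain C where C: "countable C" "C \<subseteq> K"
     "pairwise (\<lambda>i j. disjnt (cball (?a i) (?r i)) (cball (?a j) (?r j))) C"
     "negligible(E - (\<Union>i \<in> C. cball (?a i) (?r i)))"
    by (rule Vitali_covering_theorem_cballs[of K ?r E ?a]) (use r S in blast)+
  show ?thesis
  proof (rule that)
    show "disjoint_family_on (\<lambda>p. {fst p..snd p}) C"
      using C(3) unfolding cb disjoint_family_on_def pairwise_def disjnt_def by auto
  qed (use C in \<open>auto simp: cb K_def\<close>)
qed

text \<open>Lebesgue's argument. Cover \<open>E\<close> by disjoint intervals in \<open>U\<close> on which \<open>f\<close> has slope below \<open>r\<close>, then
  what is left of \<open>E\<close> in their interiors by disjoint intervals on which \<open>f\<close> has slope above \<open>R\<close>. Comparing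
  the increments of \<open>f\<close>, measured by the Stieltjes measure \<open>\<nu>\<close>, the second family has total length at
  most \<open>r / R\<close> times the measure of \<open>U\<close>, so the contraction lemma applies.\<close>
lemma mono_lipschitz_separated_Dini_negligible:
  fixes f :: "real \<Rightarrow> real"
  assumes mono: "mono f" and cont: "continuous_on UNIV f"
    and r: "0 \<le> r" "r < R" and bE: "bounded E"
    and lo: "\<And>x d. x \<in> E \<Longrightarrow> d > 0 \<Longrightarrow> \<exists>y. y \<noteq> x \<and> \<bar>y - x\<bar> < d \<and> (f y - f x) / (y - x) < r"
    and hi: "\<And>x d. x \<in> E \<Longrightarrow> d > 0 \<Longrightarrow> \<exists>y. y \<noteq> x \<and> \<bar>y - x\<bar> < d \<and> (f y - f x) / (y - x) > R"
  shows "negligible E"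
proof (rule outer_measure_contraction_imp_negligible[OF bE, of "r/R"])
  show "0 \<le> r/R" "r/R < 1" using r by auto
  fix U :: "real set" assume U: "open U" "bounded U" "E \<subseteq> U"
  define \<nu> where "\<nu> = interval_measure f"
  have Icc: "emeasure \<nu> {a..b} = ennreal (f b - f a)" if "a \<le> b" for a b
    unfolding \<nu>_def using that mono cont
    by (intro emeasure_interval_measure_Icc) (auto simp: mono_def)
  have sets: "sets \<nu> = sets borel" unfolding \<nu>_def by simp
  have quot: "(f (max x y) - f (min x y)) / (max x y - min x y) = (f y - f x) / (y - x)" for x y
    by (cases "x \<le> y") (auto simp: max_def min_def divide_simps algebra_simps)
  have fine1: "\<exists>y. y \<noteq> x \<and> \<bar>y - x\<bar> < d \<and> (f (max x y) - f (min x y)) / (max x y - min x y) < r"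
    if "x \<in> E" "d > 0" for x d using lo[OF that] unfolding quot .
  obtain C where C: "countable C"
    "\<And>p. p \<in> C \<Longrightarrow> fst p < snd p \<and> (f (snd p) - f (fst p)) / (snd p - fst p) < r \<and> {fst p..snd p} \<subseteq> U"
    "disjoint_family_on (\<lambda>p. {fst p..snd p}) C" "negligible (E - (\<Union>p\<in>C. {fst p..snd p}))"
    by (rule Vitali_interval_selection[OF U(1,3), where P = "\<lambda>a b. (f b - f a) / (b - a) < r"])
       (use fine1 in auto)
  define W where "W = (\<Union>p\<in>C. {fst p..snd p})"
  define U2 where "U2 = (\<Union>p\<in>C. {fst p<..<snd p})"
  have fine2: "\<exists>y. y \<noteq> x \<and> \<bar>y - x\<bar> < d \<and> (f (max x y) - f (min x y)) / (max x y - min x y) > R"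
    if "x \<in> E \<inter> U2" "d > 0" for x d using hi[of x d] that unfolding quot by auto
  have oU2: "open U2" unfolding U2_def by auto
  obtain C2 where C2: "countable C2"
    "\<And>p. p \<in> C2 \<Longrightarrow> fst p < snd p \<and> (f (snd p) - f (fst p)) / (snd p - fst p) > R \<and> {fst p..snd p} \<subseteq> U2"
    "disjoint_family_on (\<lambda>p. {fst p..snd p}) C2" "negligible (E \<inter> U2 - (\<Union>p\<in>C2. {fst p..snd p}))"
    by (rule Vitali_interval_selection[OF oU2, where E = "E \<inter> U2" and P = "\<lambda>a b. (f b - f a) / (b - a) > R"])
       (use fine2 in auto)
  define W2 where "W2 = (\<Union>p\<in>C2. {fst p..snd p})"
  have mW: "W \<in> sets borel" "W2 \<in> sets borel"
    unfolding W_def W2_def using C C2 by (auto intro!: sets.countable_UN')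
  have "W2 \<subseteq> U2" unfolding W2_def using C2(2) by blast
  moreover have "U2 \<subseteq> W" unfolding U2_def W_def by (intro UN_mono) auto
  moreover have "W \<subseteq> U" unfolding W_def using C(2) by blast
  ultimately have sub: "W2 \<subseteq> U2" "U2 \<subseteq> W" "W \<subseteq> U" .
  have "emeasure \<nu> W = (\<integral>\<^sup>+p. emeasure \<nu> {fst p..snd p} \<partial>count_space C)"
    unfolding W_def using C by (intro emeasure_UN_countable) (auto simp: sets)
  also have "\<dots> \<le> (\<integral>\<^sup>+p. ennreal r * emeasure lborel {fst p..snd p} \<partial>count_space C)"
  proof (rule nn_integral_mono)
    fix p assume "p \<in> space (count_space C)"
    then have p: "fst p < snd p" "(f (snd p) - f (fst p)) / (snd p - fst p) < r" using C(2) by auto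
    then have "f (snd p) - f (fst p) \<le> r * (snd p - fst p)" by (simp add: divide_simps)
    then show "emeasure \<nu> {fst p..snd p} \<le> ennreal r * emeasure lborel {fst p..snd p}"
      using p r by (auto simp: Icc ennreal_mult[symmetric])
  qed
  also have "\<dots> = ennreal r * emeasure lborel W"
    unfolding W_def using C by (subst emeasure_UN_countable) (auto simp: nn_integral_cmult)
  also have "\<dots> \<le> ennreal r * emeasure lborel U"
    using sub U by (intro mult_left_mono emeasure_mono) auto
  finally have 1: "emeasure \<nu> W \<le> ennreal r * emeasure lborel U" .
  have "ennreal R * emeasure lborel W2 = (\<integral>\<^sup>+p. ennreal R * emeasure lborel {fst p..snd p} \<partial>count_space C2)"
    unfolding W2_def using C2 by (subst emeasure_UN_countable) (auto simp: nn_integral_cmult)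
  also have "\<dots> \<le> (\<integral>\<^sup>+p. emeasure \<nu> {fst p..snd p} \<partial>count_space C2)"
  proof (rule nn_integral_mono)
    fix p assume "p \<in> space (count_space C2)"
    then have p: "fst p < snd p" "(f (snd p) - f (fst p)) / (snd p - fst p) > R" using C2(2) by auto
    then have "f (snd p) - f (fst p) \<ge> R * (snd p - fst p)" by (simp add: divide_simps)
    then show "emeasure \<nu> {fst p..snd p} \<ge> ennreal R * emeasure lborel {fst p..snd p}"
      using p r by (simp add: Icc ennreal_mult[symmetric] ennreal_leI)
  qed
  also have "\<dots> = emeasure \<nu> W2"
    unfolding W2_def using C2 by (intro emeasure_UN_countable[symmetric]) (auto simp: sets)
  also have "\<dots> \<le> emeasure \<nu> W"
    using sub mW by (intro emeasure_mono) (auto simp: sets)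
  finally have 2: "ennreal R * emeasure lborel W2 \<le> ennreal r * emeasure lborel U"
    using 1 by order
  have lm: "U \<in> lmeasurable" "W2 \<in> lmeasurable"
  proof -
    show "U \<in> lmeasurable" using U by (simp add: lmeasurable_open)
    then show "W2 \<in> lmeasurable"
      by (rule fmeasurableI2) (use sub mW in auto)
  qed
  have em: "emeasure lborel U = ennreal (measure lebesgue U)" "emeasure lborel W2 = ennreal (measure lebesgue W2)"
  proof -
    have "emeasure lborel S = ennreal (measure lebesgue S)" if "S \<in> lmeasurable" "S \<in> sets borel" for S :: "real set"
    proof -
      have "emeasure lborel S = emeasure lebesgue S" using that by simp
      also have "\<dots> = ennreal (measure lebesgue S)" using that by (rule_tac emeasure_eq_measure2)
      finally show ?thesis .
    qed
    then show "emeasure lborel U = ennreal (measure lebesgue U)" "emeasure lborel W2 = ennreal (measure lebesgue W2)"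
      using lm U mW by auto
  qed
  have 3: "measure lebesgue W2 \<le> r / R * measure lebesgue U"
    using 2 r unfolding em by (simp add: ennreal_mult[symmetric] divide_simps mult.commute)
  have cntN: "negligible (fst ` C \<union> snd ` C)"
    using C(1) by (simp add: negligible_iff_null_sets null_sets_completionI countable_imp_null_set_lborel)
  define N where "N = (E - W) \<union> (fst ` C \<union> snd ` C) \<union> (E \<inter> U2 - W2)"
  have N: "negligible N" unfolding N_def W_def W2_def
    using C(4) C2(4) cntN by (blast intro: negligible_Un)
  have "E \<subseteq> W2 \<union> N"
  proof
    fix x assume x: "x \<in> E"
    show "x \<in> W2 \<union> N"
    proof (cases "x \<in> U2 \<or> x \<notin> W")
      case True then show ?thesis using x unfolding N_def by auto
    next
      case False
      then obtain p where p: "p \<in> C" "x \<in> {fst p..snd p}" "x \<notin> {fst p<..<snd p}"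
        unfolding W_def U2_def by auto
      then have "x = fst p \<or> x = snd p" by auto
      then show ?thesis using p unfolding N_def by auto
    qed
  qed
  moreover have "W2 \<union> N \<in> lmeasurable" "measure lebesgue (W2 \<union> N) = measure lebesgue W2"
    using N lm by (auto simp: measure_Un_null_set negligible_iff_null_sets negligible_imp_measurable fmeasurable.Un)
  ultimately show "\<exists>W\<in>lmeasurable. E \<subseteq> W \<and> measure lebesgue W \<le> r / R * measure lebesgue U"
    using 3 by metis
qed

text \<open>Where the derivative does not exist, the lower and upper limits of the difference quotients are
  separated by two rationals, and there are countably many such pairs.\<close>
lemma mono_lipschitz_ae_differentiable:
  fixes f :: "real \<Rightarrow> real"
  assumes mono: "mono f" and lip: "L-lipschitz_on UNIV f"
  shows "negligible {x. \<not> f differentiable (at x)}"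
proof -
  have L0: "0 \<le> L" using lip by (rule lipschitz_on_nonneg)
  have cont: "continuous_on UNIV f" using lip by (rule lipschitz_on_continuous_on)
  define q where "q x y = (f y - f x) / (y - x)" for x y
  have q0: "0 \<le> q x y" for x y
    using mono unfolding q_def mono_def
    by (cases "x \<le> y") (auto simp: divide_nonneg_nonneg divide_nonpos_nonpos)
  have qL: "q x y \<le> L" for x y
  proof -
    have "\<bar>f y - f x\<bar> \<le> L * \<bar>y - x\<bar>"
      using lipschitz_onD[OF lip, of y x] by (auto simp: dist_real_def)
    then have "\<bar>q x y\<bar> \<le> L" unfolding q_def using L0
      by (cases "y = x") (auto simp: abs_divide divide_simps)
    then show ?thesis by linarith
  qed
  define E where "E n rR = {x \<in> ball 0 (real n). fst rR \<ge> 0 \<and> fst rR < snd rR \<and>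
     (\<forall>d>0. \<exists>y. y \<noteq> x \<and> \<bar>y - x\<bar> < d \<and> q x y < fst rR) \<and>
     (\<forall>d>0. \<exists>y. y \<noteq> x \<and> \<bar>y - x\<bar> < d \<and> q x y > snd rR)}" for n :: nat and rR :: "real \<times> real"
  have E: "negligible (E n rR)" for n rR
  proof (cases "fst rR \<ge> 0 \<and> fst rR < snd rR")
    case True
    show ?thesis
      by (rule mono_lipschitz_separated_Dini_negligible[OF mono cont, of "fst rR" "snd rR"])
         (use True in \<open>auto simp: E_def q_def intro!: bounded_subset[OF bounded_ball[of 0 "real n"]]\<close>)
  next
    case False
    then have "E n rR = {}" by (auto simp: E_def)
    then show ?thesis by simp
  qed
  have "negligible (\<Union>p\<in>UNIV \<times> (\<rat> \<times> \<rat>). E (fst p) (snd p))"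
    by (rule negligible_countable_Union) (auto simp: E intro!: countable_SIGMA countable_rat)
  moreover have "{x. \<not> f differentiable (at x)} \<subseteq> (\<Union>p\<in>UNIV \<times> (\<rat> \<times> \<rat>). E (fst p) (snd p))"
  proof
    fix x assume "x \<in> {x. \<not> f differentiable (at x)}"
    then have nd: "\<not> f differentiable (at x)" by simp
    let ?l = "Liminf (at x) (\<lambda>y. ereal (q x y))" and ?s = "Limsup (at x) (\<lambda>y. ereal (q x y))"
    have "?l \<le> ?s" by (rule Liminf_le_Limsup) simp
    have "?l \<ge> 0" by (rule Liminf_bounded) (simp add: q0)
    have "?s \<le> L" by (rule Limsup_bounded) (simp add: qL)
    have "?l \<noteq> ?s"
    proof
      assume eq: "?l = ?s"
      obtain D where D: "?s = ereal D"
        using \<open>?s \<le> L\<close> \<open>?l \<ge> 0\<close> eq by (cases ?s) auto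
      have "((\<lambda>y. ereal (q x y)) \<longlongrightarrow> ereal D) (at x)"
        using eq D tendsto_iff_Liminf_eq_Limsup[of "at x" "\<lambda>y. ereal (q x y)" "ereal D"] by simp
      then have "((\<lambda>y. q x y) \<longlongrightarrow> D) (at x)" by simp
      then have "(f has_real_derivative D) (at x)"
        unfolding has_field_derivative_iff q_def .
      then show False using nd by (auto simp: real_differentiable_def)
    qed
    then have "?l < ?s" using \<open>?l \<le> ?s\<close> by simp
    then obtain a where a: "?l < ereal a" "ereal a < ?s" using ereal_dense2 by blast
    then obtain b where b: "ereal a < ereal b" "ereal b < ?s" using ereal_dense2 by blast
    obtain r where r: "r \<in> \<rat>" "a < r" "r < b" using Rats_dense_in_real b by auto
    then obtain R where R: "R \<in> \<rat>" "r < R" "R < b" using Rats_dense_in_real by blast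
    have lr: "?l < ereal r" using a r by (meson ereal_less(2) less_ereal.simps(1) order_less_trans)
    have Rs: "ereal R < ?s" using b R by (meson less_ereal.simps(1) order_less_trans)
    have r0: "r \<ge> 0" using lr \<open>?l \<ge> 0\<close> by (metis ereal_less_eq(5) less_imp_le order.trans)
    have lo: "\<exists>y. y \<noteq> x \<and> \<bar>y - x\<bar> < d \<and> q x y < r" if "d > 0" for d
    proof (rule ccontr)
      assume "\<nexists>y. y \<noteq> x \<and> \<bar>y - x\<bar> < d \<and> q x y < r"
      then have "\<forall>\<^sub>F y in at x. ereal r \<le> ereal (q x y)"
        unfolding eventually_at using \<open>d > 0\<close> by (intro exI[of _ d]) (auto simp: dist_real_def not_less)
      then have "ereal r \<le> ?l" by (rule Liminf_bounded)
      then show False using lr by simp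
    qed
    have hi: "\<exists>y. y \<noteq> x \<and> \<bar>y - x\<bar> < d \<and> q x y > R" if "d > 0" for d
    proof (rule ccontr)
      assume "\<nexists>y. y \<noteq> x \<and> \<bar>y - x\<bar> < d \<and> q x y > R"
      then have "\<forall>\<^sub>F y in at x. ereal (q x y) \<le> ereal R"
        unfolding eventually_at using \<open>d > 0\<close> by (intro exI[of _ d]) (auto simp: dist_real_def not_less)
      then have "?s \<le> ereal R" by (rule Limsup_bounded)
      then show False using Rs by simp
    qed
    obtain n :: nat where "\<bar>x\<bar> < real n" using reals_Archimedean2 by blast
    then have "x \<in> E n (r, R)"
      unfolding E_def using lo hi r0 R by (auto simp: dist_real_def)
    then show "x \<in> (\<Union>p\<in>UNIV \<times> (\<rat> \<times> \<rat>). E (fst p) (snd p))"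
      using r R by (intro UN_I[of "(n,(r,R))"]) auto
  qed
  ultimately show ?thesis by (rule negligible_subset)
qed

text \<open>Adding \<open>L x\<close> makes an \<open>L\<close>-Lipschitz function monotone. Clamping the argument to a compact
  subinterval makes the function globally defined.\<close>
lemma lipschitz_ae_differentiable:
  fixes f :: "real \<Rightarrow> real"
  assumes lip: "L-lipschitz_on {a<..<b} f"
  shows "negligible {x \<in> {a<..<b}. \<not> f differentiable (at x)}"
proof -
  have L0: "0 \<le> L" using lip by (rule lipschitz_on_nonneg)
  have *: "negligible {x \<in> {c<..<d}. \<not> f differentiable (at x)}" if cd: "a < c" "c < d" "d < b" for c d
  proof -
    define k where "k x = max c (min d x)" for x
    have k: "k x \<in> {a<..<b}" for x using cd by (auto simp: k_def)
    have k1: "\<bar>k x - k y\<bar> \<le> \<bar>x - y\<bar>" for x y by (auto simp: k_def max_def min_def)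
    have fk: "L-lipschitz_on UNIV (f \<circ> k)"
    proof (rule lipschitz_onI[OF _ L0])
      fix x y
      have "dist (f (k x)) (f (k y)) \<le> L * dist (k x) (k y)"
        using lipschitz_onD[OF lip] k by blast
      also have "\<dots> \<le> L * dist x y" using k1[of x y] L0 by (auto simp: dist_real_def intro: mult_left_mono)
      finally show "dist ((f \<circ> k) x) ((f \<circ> k) y) \<le> L * dist x y" by simp
    qed
    define g where "g x = (f \<circ> k) x + L * x" for x
    have "mono g"
    proof (rule monoI)
      fix x y :: real assume "x \<le> y"
      then show "g x \<le> g y"
        using lipschitz_onD[OF fk, of x y] by (auto simp: g_def dist_real_def algebra_simps abs_if split: if_splits)
    qed
    moreover have "(L + L)-lipschitz_on UNIV g"
      unfolding g_def using L0
      by (intro lipschitz_on_add[OF fk] lipschitz_onI) (simp_all add: dist_real_def abs_mult flip: right_diff_distrib)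
    ultimately have "negligible {x. \<not> g differentiable (at x)}"
      by (rule mono_lipschitz_ae_differentiable)
    moreover have "f differentiable (at x)" if x: "x \<in> {c<..<d}" "g differentiable (at x)" for x
    proof -
      have "(\<lambda>x. g x - L * x) differentiable (at x)"
        by (intro derivative_intros x(2))
      then obtain D where D: "((\<lambda>x. g x - L * x) has_derivative D) (at x)"
        unfolding differentiable_def by blast
      have "(f has_derivative D) (at x)"
        by (rule has_derivative_transform_within_open[OF D, of "{c<..<d}"]) (use x(1) in \<open>auto simp: g_def k_def\<close>)
      then show ?thesis by (auto simp: differentiable_def)
    qed
    ultimately show ?thesis by (auto elim!: negligible_subset)
  qed
  show ?thesis
  proof (subst locally_negligible_alt, intro ballI)
    fix x assume x: "x \<in> {x \<in> {a<..<b}. \<not> f differentiable (at x)}"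
    then obtain c d where cd: "a < c" "c < x" "x < d" "d < b" using dense[of a x] dense[of x b] by auto
    let ?S = "{x \<in> {a<..<b}. \<not> f differentiable (at x)}"
    have "openin (top_of_set ?S) (?S \<inter> {c<..<d})" by auto
    moreover have "negligible (?S \<inter> {c<..<d})"
      by (rule negligible_subset[OF *[of c d]]) (use cd in auto)
    ultimately show "\<exists>U. openin (top_of_set ?S) U \<and> x \<in> U \<and> negligible U"
      using x cd by (intro exI[of _ "?S \<inter> {c<..<d}"]) auto
  qed
qed

text \<open>The one-dimensional case of Sard's theorem, transported from \<open>real^1\<close>.\<close>
lemma negligible_image_zero_derivative:
  fixes f :: "real \<Rightarrow> real"
  assumes der: "\<And>x. x \<in> S \<Longrightarrow> (f has_real_derivative 0) (at x)"
  shows "negligible (f ` S)"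
proof -
  let ?v = "\<lambda>t. vec t :: real^1"
  define F where "F x = f (x $ 1) *\<^sub>R ?v 1" for x :: "real^1"
  have "negligible (F ` (?v ` S))"
  proof (rule baby_Sard[where f' = "\<lambda>_ _. 0"])
    fix x assume "x \<in> ?v ` S"
    then have "(f has_derivative (\<lambda>h. 0)) (at (x $ 1))"
      using der by (auto simp: has_field_derivative_def lambda_zero)
    then have "((\<lambda>x::real^1. f (x $ 1)) has_derivative (\<lambda>h. 0)) (at x)"
      using has_derivative_compose[of "\<lambda>x::real^1. x $ 1" "\<lambda>h::real^1. h $ 1" x UNIV f "\<lambda>h. 0"]
      by (auto intro: bounded_linear_imp_has_derivative bounded_linear_vec_nth)
    then have "(F has_derivative (\<lambda>h. 0 *\<^sub>R ?v 1)) (at x)"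
      unfolding F_def by (rule has_derivative_scaleR_left)
    then show "(F has_derivative (\<lambda>_. 0)) (at x within ?v ` S)"
      by (auto intro: has_derivative_at_withinI)
    have "matrix (\<lambda>_::real^1. 0::real^1) = 0" by (simp add: matrix_def vec_eq_iff)
    then show "rank (matrix (\<lambda>_::real^1. 0::real^1)) < CARD(1)" by simp
  qed auto
  then have "negligible ((\<lambda>x. x $ 1) ` (F ` (?v ` S)))"
  proof (rule negligible_locally_Lipschitz_image[rotated])
    fix x assume "x \<in> F ` ?v ` S"
    show "\<exists>T B. open T \<and> x \<in> T \<and> (\<forall>y\<in>F ` ?v ` S \<inter> T. norm (y $ 1 - x $ 1) \<le> B * norm (y - x))"
      by (intro exI[of _ UNIV] exI[of _ 1]) (simp add: norm_real flip: vector_minus_component)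
  qed auto
  moreover have "(\<lambda>x. x $ 1) ` (F ` (?v ` S)) = f ` S"
    by (auto simp: F_def image_image)
  ultimately show ?thesis by simp
qed

text \<open>A set of diameter \<open>d\<close> has its image in an interval of length \<open>2 d\<close>. Exceptional sets of zero length
  on the boundary thus become null sets of chart parameters.\<close>
lemma hausdorff1_null_projection_negligible:
  fixes X :: "'a::metric_space set" and f :: "'a \<Rightarrow> real"
  assumes X: "hausdorff1 X = 0" and f: "\<And>x y. \<bar>f x - f y\<bar> \<le> dist x y"
  shows "negligible (f ` X)"
  unfolding negligible_outer_le
proof (intro allI impI)
  fix e :: real assume e: "e > 0"
  let ?Cs = "{C :: nat \<Rightarrow> 'a set. X \<subseteq> (\<Union>i. C i) \<and> (\<forall>i. bounded (C i) \<and> diameter (C i) \<le> 1)}"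
  have "(INF C\<in>?Cs. \<Sum>i. ennreal (diameter (C i))) \<le> hausdorff1 X"
    unfolding hausdorff1_def by (rule SUP_upper2[of 1]) auto
  then have "(INF C\<in>?Cs. \<Sum>i. ennreal (diameter (C i))) < ennreal (e/2)"
    using X e by (simp add: ennreal_zero_less_divide)
  then obtain C where C: "C \<in> ?Cs" "(\<Sum>i. ennreal (diameter (C i))) < ennreal (e/2)"
    unfolding INF_less_iff by blast
  define c where "c i = (SOME x. x \<in> C i)" for i
  define T where "T = (\<Union>i. cball (f (c i)) (diameter (C i)))"
  have d0: "diameter (C i) \<ge> 0" for i using C by (auto intro: diameter_ge_0)
  have sub: "f ` X \<subseteq> T"
  proof
    fix y assume "y \<in> f ` X"
    then obtain x i where x: "y = f x" "x \<in> C i" using C by auto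
    then have "c i \<in> C i" unfolding c_def by (metis someI)
    then have "dist (c i) x \<le> diameter (C i)"
      using C x by (auto intro: diameter_bounded_bound)
    then have "y \<in> cball (f (c i)) (diameter (C i))"
      using f[of "c i" x] x by (auto simp: dist_real_def)
    then show "y \<in> T" unfolding T_def by blast
  qed
  have bor: "T \<in> sets borel" unfolding T_def by auto
  have "emeasure lborel T \<le> (\<Sum>i. emeasure lborel (cball (f (c i)) (diameter (C i))))"
    unfolding T_def by (rule emeasure_subadditive_countably) auto
  also have "\<dots> = (\<Sum>i. 2 * ennreal (diameter (C i)))"
    using d0 by (intro suminf_cong) (simp add: cball_eq_atLeastAtMost ennreal_mult[symmetric] flip: ennreal_numeral)
  also have "\<dots> = 2 * (\<Sum>i. ennreal (diameter (C i)))" by simp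
  also have "\<dots> \<le> 2 * ennreal (e/2)" using C(2) by (intro mult_left_mono) auto
  also have "\<dots> = ennreal e" using e by (simp add: ennreal_mult[symmetric] flip: ennreal_numeral)
  finally have le: "emeasure lborel T \<le> ennreal e" .
  have "T \<in> lmeasurable"
    using le bor by (intro fmeasurableI) (auto simp: top_unique less_top[symmetric])
  moreover have "measure lebesgue T \<le> e"
    using le bor e by (simp add: measure_def enn2real_leI)
  ultimately show "\<exists>T. f ` X \<subseteq> T \<and> T \<in> lmeasurable \<and> measure lebesgue T \<le> e"
    using sub by blast
qed

section \<open>Pointwise Lipschitz curves\<close>

text \<open>A Lipschitz condition at a single point. It composes without any bookkeeping of domains and
  constants, and imposed at every point of an interval it still makes null sets have null images.\<close>
definition lip_at :: "(real \<Rightarrow> 'b::metric_space) \<Rightarrow> real \<Rightarrow> bool" where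
  "lip_at f x \<longleftrightarrow> (\<exists>B. \<forall>\<^sub>F y in nhds x. dist (f y) (f x) \<le> B * dist y x)"

lemma lip_atD:
  assumes "lip_at f x"
  obtains B where "B \<ge> 0" "\<forall>\<^sub>F y in nhds x. dist (f y) (f x) \<le> B * dist y x"
proof -
  obtain B where B: "\<forall>\<^sub>F y in nhds x. dist (f y) (f x) \<le> B * dist y x" using assms lip_at_def by blast
  have "\<forall>\<^sub>F y in nhds x. dist (f y) (f x) \<le> \<bar>B\<bar> * dist y x"
    using B by eventually_elim (meson abs_ge_self mult_right_mono order_trans zero_le_dist)
  then show ?thesis using that[of "\<bar>B\<bar>"] by simp
qed

lemma lip_at_continuous:
  assumes "lip_at f x" shows "isCont f x"
proof -
  obtain B where B: "\<forall>\<^sub>F y in nhds x. dist (f y) (f x) \<le> B * dist y x" using assms lip_at_def by blast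
  have "isCont (\<lambda>y. B * dist y x) x" by (intro continuous_intros)
  then have lim: "((\<lambda>y. B * dist y x) \<longlongrightarrow> 0) (at x)" by (simp add: isCont_def)
  have up: "\<forall>\<^sub>F y in at x. dist (f y) (f x) \<le> B * dist y x"
    using B by (auto simp: eventually_at_filter elim: eventually_mono)
  have lo: "\<forall>\<^sub>F y in at x. 0 \<le> dist (f y) (f x)" by simp
  have "((\<lambda>y. dist (f y) (f x)) \<longlongrightarrow> 0) (at x)"
    by (rule tendsto_sandwich[OF lo up tendsto_const lim])
  then show ?thesis unfolding isCont_def by (subst tendsto_dist_iff)
qed

lemma lip_at_differentiable:
  fixes f :: "real \<Rightarrow> 'b::real_normed_vector"
  assumes "(f has_vector_derivative D) (at x)"
  shows "lip_at f x"
proof -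
  have "(f has_derivative (\<lambda>h. h *\<^sub>R D)) (at x)" using assms by (simp add: has_vector_derivative_def)
  then obtain d where d: "d > 0" "\<And>y. norm (y - x) < d \<Longrightarrow> norm (f y - f x - (y - x) *\<^sub>R D) \<le> 1 * norm (y - x)"
    unfolding has_derivative_at_alt by (metis zero_less_one)
  have "\<forall>\<^sub>F y in nhds x. dist (f y) (f x) \<le> (1 + norm D) * dist y x"
    unfolding eventually_nhds_metric
  proof (intro exI conjI allI impI)
    fix y assume "dist y x < d"
    then have "norm (f y - f x - (y - x) *\<^sub>R D) \<le> 1 * norm (y - x)" by (intro d) (simp add: dist_norm)
    moreover have "norm (f y - f x) \<le> norm (f y - f x - (y - x) *\<^sub>R D) + norm ((y - x) *\<^sub>R D)"
      using norm_triangle_ineq[of "f y - f x - (y - x) *\<^sub>R D" "(y - x) *\<^sub>R D"] by simp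
    moreover have "norm ((y - x) *\<^sub>R D) = norm D * norm (y - x)" by (simp add: mult.commute)
    ultimately show "dist (f y) (f x) \<le> (1 + norm D) * dist y x" unfolding dist_norm distrib_right by linarith
  qed (rule d)
  then show ?thesis unfolding lip_at_def by blast
qed

lemma lip_at_compose:
  fixes f :: "real \<Rightarrow> real"
  assumes g: "lip_at g (f x)" and f: "lip_at f x"
  shows "lip_at (\<lambda>x. g (f x)) x"
proof -
  obtain B where B: "B \<ge> 0" "\<forall>\<^sub>F y in nhds (f x). dist (g y) (g (f x)) \<le> B * dist y (f x)" using g by (rule lip_atD)
  obtain C where C: "\<forall>\<^sub>F y in nhds x. dist (f y) (f x) \<le> C * dist y x" using f lip_at_def by blast
  have "(f \<longlongrightarrow> f x) (nhds x)" using lip_at_continuous[OF f] by (simp add: isCont_def tendsto_at_iff_tendsto_nhds)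
  then have "\<forall>\<^sub>F y in nhds x. dist (g (f y)) (g (f x)) \<le> B * dist (f y) (f x)"
    by (rule eventually_compose_filterlim[OF B(2)])
  then have "\<forall>\<^sub>F y in nhds x. dist (g (f y)) (g (f x)) \<le> (B * C) * dist y x"
    using C by eventually_elim (metis B(1) mult.assoc mult_left_mono order_trans)
  then show ?thesis unfolding lip_at_def by blast
qed

lemma lip_at_1_lipschitz:
  assumes f: "lip_at f x" and g: "\<And>y z. dist (g y) (g z) \<le> dist y z"
  shows "lip_at (\<lambda>x. g (f x)) x"
proof -
  obtain B where B: "\<forall>\<^sub>F y in nhds x. dist (f y) (f x) \<le> B * dist y x" using f lip_at_def by blast
  then have "\<forall>\<^sub>F y in nhds x. dist (g (f y)) (g (f x)) \<le> B * dist y x"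
    by eventually_elim (rule order_trans[OF g])
  then show ?thesis unfolding lip_at_def by blast
qed

lemma lip_at_cong:
  assumes "lip_at f x" "\<forall>\<^sub>F y in nhds x. f y = g y"
  shows "lip_at g x"
proof -
  obtain B where B: "\<forall>\<^sub>F y in nhds x. dist (f y) (f x) \<le> B * dist y x" using assms lip_at_def by blast
  have fg: "f x = g x" using assms(2) by (rule eventually_nhds_x_imp_x)
  have "\<forall>\<^sub>F y in nhds x. dist (g y) (g x) \<le> B * dist y x"
    using B assms(2) by eventually_elim (simp add: fg)
  then show ?thesis unfolding lip_at_def by blast
qed

lemma lip_at_mult:
  fixes f g :: "real \<Rightarrow> 'b::real_normed_algebra"
  assumes f: "lip_at f x" and g: "lip_at g x"
  shows "lip_at (\<lambda>x. f x * g x) x"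
proof -
  obtain B where B: "B \<ge> 0" "\<forall>\<^sub>F y in nhds x. dist (f y) (f x) \<le> B * dist y x" using f by (rule lip_atD)
  obtain C where C: "C \<ge> 0" "\<forall>\<^sub>F y in nhds x. dist (g y) (g x) \<le> C * dist y x" using g by (rule lip_atD)
  have "(g \<longlongrightarrow> g x) (nhds x)" using lip_at_continuous[OF g] by (simp add: isCont_def tendsto_at_iff_tendsto_nhds)
  then have "\<forall>\<^sub>F y in nhds x. dist (g y) (g x) < 1" by (rule tendstoD) simp
  then have "\<forall>\<^sub>F y in nhds x. dist (f y * g y) (f x * g x) \<le> (B * (norm (g x) + 1) + norm (f x) * C) * dist y x"
    using B(2) C(2)
  proof eventually_elim
    case (elim y)
    have ng: "norm (g y) \<le> norm (g x) + 1" using elim(1) norm_triangle_ineq2[of "g y" "g x"] by (simp add: dist_norm)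
    have "f y * g y - f x * g x = (f y - f x) * g y + f x * (g y - g x)" by (simp add: algebra_simps)
    then have "norm (f y * g y - f x * g x) \<le> norm (f y - f x) * norm (g y) + norm (f x) * norm (g y - g x)"
      by (metis norm_triangle_le add_mono norm_mult_ineq)
    also have "\<dots> \<le> (B * dist y x) * (norm (g x) + 1) + norm (f x) * (C * dist y x)"
      using elim ng B(1) by (intro add_mono mult_mono) (auto simp: dist_norm)
    finally show ?case by (simp add: dist_norm algebra_simps)
  qed
  then show ?thesis unfolding lip_at_def by blast
qed

text \<open>The image of the interval is null: the null set \<open>N\<close> has a null image by the Lipschitz condition, and
  the rest does by Sard's theorem. A connected null set of reals is a point.\<close>
lemma lip_at_ae_zero_derivative_imp_const_real:
  fixes f :: "real \<Rightarrow> real"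
  assumes ab: "a \<le> b" and lip: "\<And>x. x \<in> {a..b} \<Longrightarrow> lip_at f x" and N: "negligible N"
    and der: "\<And>x. x \<in> {a..b} - N \<Longrightarrow> (f has_real_derivative 0) (at x)"
  shows "f a = f b"
proof (rule ccontr)
  assume ne: "f a \<noteq> f b"
  have "negligible (f ` ({a..b} - N))" by (rule negligible_image_zero_derivative) (rule der)
  moreover have "negligible (f ` ({a..b} \<inter> N))"
  proof (rule negligible_locally_Lipschitz_image)
    show "negligible ({a..b} \<inter> N)" using N by (simp add: negligible_Int)
    fix x assume "x \<in> {a..b} \<inter> N"
    then obtain B T where "open T" "x \<in> T" "\<And>y. y \<in> T \<Longrightarrow> dist (f y) (f x) \<le> B * dist y x"
      using lip[of x] unfolding lip_at_def eventually_nhds by blast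
    then show "\<exists>T B. open T \<and> x \<in> T \<and> (\<forall>y\<in>{a..b} \<inter> N \<inter> T. norm (f y - f x) \<le> B * norm (y - x))"
      by (intro exI[of _ T] exI[of _ B]) (simp add: dist_norm)
  qed auto
  ultimately have "negligible (f ` ({a..b} - N) \<union> f ` ({a..b} \<inter> N))" by (rule negligible_Un)
  then have neg: "negligible (f ` {a..b})" by (rule negligible_subset) auto
  have "continuous_on {a..b} f"
    by (intro continuous_at_imp_continuous_on ballI lip_at_continuous lip)
  then have "connected (f ` {a..b})" by (intro connected_continuous_image) auto
  then have "{min (f a) (f b)..max (f a) (f b)} \<subseteq> f ` {a..b}"
    using ab by (intro connected_contains_Icc) (auto simp: min_def max_def)
  then have "negligible (cbox (min (f a) (f b)) (max (f a) (f b)))" using neg negligible_subset by simp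
  then show False using ne by (subst (asm) negligible_interval) (auto simp: min_def max_def split: if_splits)
qed

lemma lip_at_ae_zero_derivative_imp_const:
  fixes f :: "real \<Rightarrow> 'b::euclidean_space"
  assumes ab: "a \<le> b" and lip: "\<And>x. x \<in> {a..b} \<Longrightarrow> lip_at f x" and N: "negligible N"
    and der: "\<And>x. x \<in> {a..b} - N \<Longrightarrow> (f has_vector_derivative 0) (at x)"
  shows "f a = f b"
proof (rule euclidean_eqI)
  fix i :: 'b assume i: "i \<in> Basis"
  show "f a \<bullet> i = f b \<bullet> i"
  proof (rule lip_at_ae_zero_derivative_imp_const_real[OF ab _ N])
    fix x assume "x \<in> {a..b}"
    show "lip_at (\<lambda>x. f x \<bullet> i) x"
    proof (rule lip_at_1_lipschitz[OF lip])
      show "dist (y \<bullet> i) (z \<bullet> i) \<le> dist y z" for y z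
        using Basis_le_norm[OF i, of "y - z"] by (simp add: dist_norm inner_diff_left)
    qed fact
  next
    fix x assume x: "x \<in> {a..b} - N"
    have "((\<lambda>x. f x \<bullet> i) has_derivative (\<lambda>h. (h *\<^sub>R 0) \<bullet> i)) (at x)"
      using der[OF x] unfolding has_vector_derivative_def by (intro derivative_intros)
    then show "((\<lambda>x. f x \<bullet> i) has_real_derivative 0) (at x)"
      by (simp add: has_field_derivative_def lambda_zero)
  qed
qed

section \<open>Charts of a \<open>C\<^sup>1\<^sup>,\<^sup>1\<close> boundary\<close>

text \<open>In coordinates the two vectors satisfy \<open>n = d (- e$2, e$1)\<close>, where the determinant \<open>d\<close> has square
  \<open>1\<close>.\<close>
lemma plane_orthonormal_expansion:
  fixes v e n :: "real^2"
  assumes e: "norm e = 1" and n: "norm n = 1" and en: "e \<bullet> n = 0"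
  shows "v = (v \<bullet> e) *\<^sub>R e + (v \<bullet> n) *\<^sub>R n"
proof -
  have 1: "e$1 * e$1 + e$2 * e$2 = 1" using e by (simp add: norm_eq_1 inner_vec_def sum_2)
  have 2: "n$1 * n$1 + n$2 * n$2 = 1" using n by (simp add: norm_eq_1 inner_vec_def sum_2)
  have 3: "e$1 * n$1 + e$2 * n$2 = 0" using en by (simp add: inner_vec_def sum_2)
  define d where "d = e$1 * n$2 - e$2 * n$1"
  have "- d * e$2 = n$1 * (e$1 * e$1 + e$2 * e$2) - e$1 * (e$1 * n$1 + e$2 * n$2)"
    by (simp add: d_def algebra_simps)
  then have n1: "n$1 = - d * e$2" unfolding 1 3 by (simp only: mult_1_right mult_zero_right diff_0_right)
  have "d * e$1 = n$2 * (e$1 * e$1 + e$2 * e$2) - e$2 * (e$1 * n$1 + e$2 * n$2)"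
    by (simp add: d_def algebra_simps)
  then have n2: "n$2 = d * e$1" unfolding 1 3 by (simp only: mult_1_right mult_zero_right diff_0_right)
  have "d * d = (e$1 * e$1 + e$2 * e$2) * (n$1 * n$1 + n$2 * n$2)
                 - (e$1 * n$1 + e$2 * n$2) * (e$1 * n$1 + e$2 * n$2)"
    unfolding d_def by algebra
  then have dd: "d * d = 1" unfolding 1 2 3 by (simp only: mult_1_right mult_zero_right diff_0_right)
  have "(v$1 * e$1 + v$2 * e$2) * e$1 + (v$1 * n$1 + v$2 * n$2) * n$1
      = v$1 * (e$1 * e$1 + (d * d) * (e$2 * e$2)) + v$2 * e$1 * e$2 * (1 - d * d)"
    unfolding n1 n2 by (simp add: algebra_simps)
  then have "v$1 = (v$1 * e$1 + v$2 * e$2) * e$1 + (v$1 * n$1 + v$2 * n$2) * n$1"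
    unfolding dd by (simp only: 1 mult_1_left mult_1_right mult_zero_right diff_self add_0_right)
  moreover have "(v$1 * e$1 + v$2 * e$2) * e$2 + (v$1 * n$1 + v$2 * n$2) * n$2
      = v$2 * (e$2 * e$2 + (d * d) * (e$1 * e$1)) + v$1 * e$1 * e$2 * (1 - d * d)"
    unfolding n1 n2 by (simp add: algebra_simps)
  then have "v$2 = (v$1 * e$1 + v$2 * e$2) * e$2 + (v$1 * n$1 + v$2 * n$2) * n$2"
    unfolding dd by (simp only: 1 mult_1_left mult_1_right mult_zero_right diff_self add_0_right add.commute[of "e$2 * e$2"])
  ultimately show ?thesis
    by (simp add: vec_eq_iff forall_2 inner_vec_def sum_2)
qed

lemma plane_perp_parallel:
  fixes w T N :: "real^2"
  assumes "norm N = 1" "T \<bullet> N = 0" "w \<bullet> N = 0" "T \<noteq> 0"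
  shows "w = ((w \<bullet> T) / (T \<bullet> T)) *\<^sub>R T"
proof -
  have "w = (w \<bullet> (T /\<^sub>R norm T)) *\<^sub>R (T /\<^sub>R norm T) + (w \<bullet> N) *\<^sub>R N"
    by (rule plane_orthonormal_expansion) (use assms in auto)
  then have "w = (w \<bullet> (T /\<^sub>R norm T)) *\<^sub>R (T /\<^sub>R norm T)" using assms by simp
  also have "\<dots> = ((w \<bullet> T) / (T \<bullet> T)) *\<^sub>R T"
    using assms by (simp add: dot_square_norm power2_eq_square divide_inverse)
  finally show ?thesis .
qed

lemma has_vector_derivative_iff_quotient:
  fixes f :: "real \<Rightarrow> 'a::real_normed_vector"
  shows "(f has_vector_derivative D) (at s) \<longleftrightarrow> ((\<lambda>t. (f t - f s) /\<^sub>R (t - s)) \<longlongrightarrow> D) (at s)"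
proof -
  have "(f has_vector_derivative D) (at s) \<longleftrightarrow>
      ((\<lambda>t. norm ((f t - f s - (t - s) *\<^sub>R D) /\<^sub>R norm (t - s))) \<longlongrightarrow> 0) (at s)"
    unfolding has_vector_derivative_def has_derivative_at_within tendsto_norm_zero_iff
    by (simp add: bounded_linear_scaleR_left)
  also have "\<dots> \<longleftrightarrow> ((\<lambda>t. norm ((f t - f s) /\<^sub>R (t - s) - D)) \<longlongrightarrow> 0) (at s)"
  proof (rule filterlim_cong[OF refl refl])
    show "\<forall>\<^sub>F t in at s. norm ((f t - f s - (t - s) *\<^sub>R D) /\<^sub>R norm (t - s)) = norm ((f t - f s) /\<^sub>R (t - s) - D)"
      unfolding eventually_at_filter
    proof (intro always_eventually allI impI)
      fix t assume "t \<noteq> s"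
      then have "(f t - f s) /\<^sub>R (t - s) - D = (f t - f s - (t - s) *\<^sub>R D) /\<^sub>R (t - s)"
        by (simp add: scaleR_diff_right)
      then show "norm ((f t - f s - (t - s) *\<^sub>R D) /\<^sub>R norm (t - s)) = norm ((f t - f s) /\<^sub>R (t - s) - D)"
        by simp
    qed
  qed
  also have "\<dots> \<longleftrightarrow> ((\<lambda>t. (f t - f s) /\<^sub>R (t - s)) \<longlongrightarrow> D) (at s)"
    by (simp add: tendsto_norm_zero_iff LIM_zero_iff)
  finally show ?thesis .
qed

text \<open>One chart of the boundary, with the coordinates \<open>(e, n)\<close> centred at \<open>p\<close>. Points of the domain are
  those of negative \<open>height\<close>.\<close>
locale boundary_chart =
  fixes \<Omega> :: "(real^2) set" and p e n :: "real^2" and r L :: real and \<phi> \<phi>' :: "real \<Rightarrow> real"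
  assumes open_dom: "open \<Omega>" and centre: "p \<in> frontier \<Omega>"
   and e: "norm e = 1" and n: "norm n = 1" and en: "e \<bullet> n = 0" and r: "r > 0"
   and der: "\<And>s. s \<in> {-r<..<r} \<Longrightarrow> (\<phi> has_real_derivative \<phi>' s) (at s)"
   and lip: "L-lipschitz_on {-r<..<r} \<phi>'"
   and sub: "\<Omega> \<inter> ball p r = {x \<in> ball p r. (x - p) \<bullet> n < \<phi> ((x - p) \<bullet> e)}"
begin

definition pt :: "real \<Rightarrow> real \<Rightarrow> real^2" where "pt s h = p + s *\<^sub>R e + h *\<^sub>R n"
definition height :: "real^2 \<Rightarrow> real" where "height x = (x - p) \<bullet> n - \<phi> ((x - p) \<bullet> e)"
definition graph :: "real \<Rightarrow> real^2" where "graph s = pt s (\<phi> s)"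
definition tang :: "real \<Rightarrow> real^2" where "tang s = e + \<phi>' s *\<^sub>R n"
definition nrm :: "real \<Rightarrow> real^2" where "nrm s = (1 / sqrt (1 + (\<phi>' s)\<^sup>2)) *\<^sub>R (n - \<phi>' s *\<^sub>R e)"

lemma ee: "e \<bullet> e = 1" and nn: "n \<bullet> n = 1" and ne: "n \<bullet> e = 0"
  using e n en by (auto simp: norm_eq_1 inner_commute)

lemma pt_coord [simp]: "(pt s h - p) \<bullet> e = s" "(pt s h - p) \<bullet> n = h"
  by (simp_all add: pt_def inner_left_distrib ee nn ne en)

lemma pt_eq: "pt ((x - p) \<bullet> e) ((x - p) \<bullet> n) = x"
  using plane_orthonormal_expansion[OF e n en, of "x - p"] unfolding pt_def by (simp add: algebra_simps)

lemma dist_pt: "dist p (pt s h) \<le> \<bar>s\<bar> + \<bar>h\<bar>"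
proof -
  have "norm (s *\<^sub>R e + h *\<^sub>R n) \<le> \<bar>s\<bar> + \<bar>h\<bar>"
    by (rule norm_triangle_le) (simp add: e n)
  then show ?thesis by (simp add: pt_def dist_norm norm_minus_commute algebra_simps)
qed

lemma coord_le: "\<bar>(x - p) \<bullet> e\<bar> \<le> dist p x" "\<bar>(x - p) \<bullet> n\<bar> \<le> dist p x"
  using Cauchy_Schwarz_ineq2[of "x - p" e] Cauchy_Schwarz_ineq2[of "x - p" n] e n
  by (auto simp: dist_norm norm_minus_commute)

lemma coord_in: "x \<in> ball p r \<Longrightarrow> (x - p) \<bullet> e \<in> {-r<..<r}"
  using coord_le[of x] by auto

lemma in_dom_iff: "x \<in> ball p r \<Longrightarrow> x \<in> \<Omega> \<longleftrightarrow> height x < 0"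
proof -
  assume x: "x \<in> ball p r"
  have "x \<in> \<Omega> \<inter> ball p r \<longleftrightarrow> x \<in> {x \<in> ball p r. (x - p) \<bullet> n < \<phi> ((x - p) \<bullet> e)}"
    by (subst sub) (rule refl)
  then show ?thesis using x by (simp add: height_def)
qed

lemma cont_phi: "continuous_on {-r<..<r} \<phi>"
  by (intro continuous_at_imp_continuous_on ballI DERIV_isCont[OF der])

lemma cont_height: "continuous_on (ball p r) height"
  unfolding height_def using coord_in
  by (intro continuous_intros continuous_on_compose2[OF cont_phi]) auto

lemma height_add_n: "height (x + t *\<^sub>R n) = height x + t"
  by (simp add: height_def inner_left_distrib inner_diff_left nn ne)

lemma in_closure_iff:
  assumes x: "x \<in> ball p r" shows "x \<in> closure \<Omega> \<longleftrightarrow> height x \<le> 0"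
proof
  assume cl: "x \<in> closure \<Omega>"
  show "height x \<le> 0"
  proof (rule ccontr)
    assume "\<not> height x \<le> 0"
    have "open {y \<in> ball p r. height y \<in> {0<..}}"
      using continuous_open_preimage[OF cont_height open_ball, of "{0<..}"] by (simp add: vimage_def Int_def)
    moreover have "x \<in> {y \<in> ball p r. height y \<in> {0<..}}" using x \<open>\<not> height x \<le> 0\<close> by auto
    ultimately have "\<Omega> \<inter> {y \<in> ball p r. height y \<in> {0<..}} \<noteq> {}"
      using cl open_Int_closure_eq_empty by blast
    then show False using in_dom_iff by fastforce
  qed
next
  assume h: "height x \<le> 0"
  show "x \<in> closure \<Omega>"
    unfolding closure_approachable
  proof (intro allI impI)
    fix d :: real assume d: "0 < d"
    define t where "t = min (d/2) ((r - dist p x)/2)"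
    have t: "0 < t" "t < d" "t < r - dist p x" using d x by (auto simp: t_def min_def)
    have dt: "dist (x + (-t) *\<^sub>R n) x = t" using t n by (simp add: dist_norm)
    have "x + (-t) *\<^sub>R n \<in> ball p r"
      using dist_triangle[of p "x + (-t) *\<^sub>R n" x] dt t by (auto simp: dist_commute)
    moreover have "height (x + (-t) *\<^sub>R n) < 0" using h t by (simp only: height_add_n)
    ultimately show "\<exists>y\<in>\<Omega>. dist y x < d" using dt t in_dom_iff by metis
  qed
qed

lemma in_frontier_iff: "x \<in> ball p r \<Longrightarrow> x \<in> frontier \<Omega> \<longleftrightarrow> height x = 0"
  using in_closure_iff[of x] in_dom_iff[of x] open_dom
  by (auto simp: frontier_def interior_open)

lemma phi0: "\<phi> 0 = 0"
  using in_frontier_iff[of p] centre r by (simp add: height_def)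

lemma graph0 [simp]: "graph 0 = p" by (simp add: graph_def pt_def phi0)

lemma height_pt: "height (pt s h) = h - \<phi> s" by (simp add: height_def)

lemma graph_coord [simp]: "(graph s - p) \<bullet> e = s" by (simp add: graph_def)

lemma graph_in_frontier: "graph s \<in> ball p r \<Longrightarrow> graph s \<in> frontier \<Omega>"
  by (simp add: in_frontier_iff graph_def height_pt)

lemma frontier_is_graph: "x \<in> ball p r \<Longrightarrow> x \<in> frontier \<Omega> \<Longrightarrow> x = graph ((x - p) \<bullet> e)"
  unfolding graph_def using in_frontier_iff[of x] pt_eq[of x] by (simp add: height_def)

lemma small_phi:
  assumes "d > 0" obtains \<epsilon> where "\<epsilon> > 0" "\<epsilon> \<le> r" "\<And>s. \<bar>s\<bar> < \<epsilon> \<Longrightarrow> \<bar>\<phi> s\<bar> < d"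
proof -
  have "isCont \<phi> 0" using der[of 0] r DERIV_isCont by auto
  then obtain \<epsilon> where "\<epsilon> > 0" "\<And>s. dist s 0 < \<epsilon> \<Longrightarrow> dist (\<phi> s) (\<phi> 0) < d"
    using assms unfolding continuous_at_eps_delta by metis
  then show ?thesis using that[of "min \<epsilon> r"] r phi0 by auto
qed

lemma graph_near: obtains \<epsilon> where "\<epsilon> > 0" "\<epsilon> \<le> r" "\<And>s. \<bar>s\<bar> < \<epsilon> \<Longrightarrow> graph s \<in> ball p r"
proof -
  obtain \<epsilon> where e: "\<epsilon> > 0" "\<epsilon> \<le> r" "\<And>s. \<bar>s\<bar> < \<epsilon> \<Longrightarrow> \<bar>\<phi> s\<bar> < r/2"
    using small_phi[of "r/2"] r by auto
  show ?thesis
  proof (rule that[of "min \<epsilon> (r/2)"])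
    fix s :: real assume "\<bar>s\<bar> < min \<epsilon> (r/2)"
    then show "graph s \<in> ball p r" using e(3)[of s] dist_pt[of s "\<phi> s"] by (auto simp: graph_def)
  qed (use e r in auto)
qed

text \<open>The exterior close to \<open>p\<close> lies in a vertically sheared rectangle above the graph, so it cannot meet
  two components of the exterior.\<close>
lemma local_exterior_connected:
  obtains C \<rho> where "\<rho> > 0" "connected C" "C \<subseteq> - closure \<Omega>" "ball p \<rho> - closure \<Omega> \<subseteq> C"
proof -
  define \<delta> where "\<delta> = r/3"
  have d: "\<delta> > 0" using r by (simp add: \<delta>_def)
  obtain \<epsilon>0 where e0: "\<epsilon>0 > 0" "\<epsilon>0 \<le> r" "\<And>s. \<bar>s\<bar> < \<epsilon>0 \<Longrightarrow> \<bar>\<phi> s\<bar> < \<delta>/2"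
    using small_phi[of "\<delta>/2"] d by auto
  define \<epsilon> where "\<epsilon> = min \<epsilon>0 (\<delta>/2)"
  have ep: "\<epsilon> > 0" "\<epsilon> \<le> \<delta>/2" "\<epsilon> \<le> r" "\<And>s. \<bar>s\<bar> < \<epsilon> \<Longrightarrow> \<bar>\<phi> s\<bar> < \<delta>/2"
    using e0 d by (auto simp: \<epsilon>_def)
  define g where "g q = pt (fst q) (\<phi> (fst q) + snd q)" for q :: "real \<times> real"
  let ?Q = "{-\<epsilon><..<\<epsilon>} \<times> {0<..<\<delta>}"
  show ?thesis
  proof (rule that[of \<epsilon> "g ` ?Q"])
    show "connected (g ` ?Q)"
    proof (rule connected_continuous_image)
      show "continuous_on ?Q g"
        unfolding g_def pt_def using ep
        by (intro continuous_intros continuous_on_compose2[OF cont_phi]) auto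
      show "connected ?Q" by (intro convex_connected convex_Times) auto
    qed
    show "g ` ?Q \<subseteq> - closure \<Omega>"
    proof clarify
      fix s t assume st: "s \<in> {-\<epsilon><..<\<epsilon>}" "t \<in> {0<..<\<delta>}" "g (s,t) \<in> closure \<Omega>"
      have "dist p (g (s,t)) \<le> \<bar>s\<bar> + \<bar>\<phi> s + t\<bar>" unfolding g_def using dist_pt by simp
      also have "\<dots> < r" using ep(4)[of s] st(1,2) ep(2) d unfolding \<delta>_def by (auto simp: abs_if split: if_splits)
      finally have "g (s,t) \<in> ball p r" by simp
      moreover have "height (g (s,t)) = t" by (simp add: g_def height_pt)
      ultimately show False using in_closure_iff st by auto
    qed
    show "ball p \<epsilon> - closure \<Omega> \<subseteq> g ` ?Q"
    proof
      fix x assume x: "x \<in> ball p \<epsilon> - closure \<Omega>"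
      define s where "s = (x - p) \<bullet> e"
      have s: "\<bar>s\<bar> < \<epsilon>" "\<bar>(x - p) \<bullet> n\<bar> < \<delta>/2" using coord_le[of x] x ep by (auto simp: s_def)
      have "x \<in> ball p r" using x ep by auto
      then have "height x > 0" using in_closure_iff x by auto
      moreover have "height x < \<delta>" using s ep(4)[of s] by (auto simp: height_def s_def abs_if split: if_splits)
      moreover have "x = g (s, height x)"
        unfolding g_def using pt_eq[of x] by (simp add: height_def s_def)
      ultimately show "x \<in> g ` ?Q" using s by (intro image_eqI[of _ _ "(s, height x)"]) auto
    qed
  qed (use ep in auto)
qed

lemma q_pos: "sqrt (1 + (\<phi>' s)\<^sup>2) > 0" "1 + (\<phi>' s)\<^sup>2 > 0" "sqrt (1 + (\<phi>' s)\<^sup>2) \<ge> 1"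
  by (auto simp: add_pos_nonneg)

lemma tang_sq: "tang s \<bullet> tang s = 1 + (\<phi>' s)\<^sup>2"
  by (simp add: tang_def inner_left_distrib inner_right_distrib ee nn ne en power2_eq_square)

lemma tang_nz: "tang s \<noteq> 0"
  using tang_sq[of s] q_pos(2)[of s] by force

lemma nrm_norm: "norm (nrm s) = 1"
proof -
  have "norm (n - \<phi>' s *\<^sub>R e) = sqrt (1 + (\<phi>' s)\<^sup>2)"
    by (simp add: norm_eq_sqrt_inner inner_diff_left inner_diff_right ee nn ne en power2_eq_square)
  then show ?thesis unfolding nrm_def using q_pos(1)[of s] by simp
qed

lemma tang_nrm: "tang s \<bullet> nrm s = 0"
  by (simp add: tang_def nrm_def inner_left_distrib inner_diff_right ee nn ne en)

lemma graph_deriv: "s \<in> {-r<..<r} \<Longrightarrow> (graph has_vector_derivative tang s) (at s)"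
  unfolding graph_def pt_def tang_def
  using der[of s] by (auto intro!: derivative_eq_intros simp: has_real_derivative_iff_has_vector_derivative)

text \<open>Moving along the normal changes the height at a nonzero rate, so the normal points out of the
  domain to one side and into it to the other.\<close>
lemma height_normal_deriv:
  assumes s: "s \<in> {-r<..<r}"
  shows "((\<lambda>t. height (graph s + t *\<^sub>R nrm s)) has_real_derivative sqrt (1 + (\<phi>' s)\<^sup>2)) (at 0)"
proof -
  define q where "q = sqrt (1 + (\<phi>' s)\<^sup>2)"
  have q: "q > 0" "q * q = 1 + (\<phi>' s)\<^sup>2" using q_pos[of s] by (auto simp: q_def)
  have eq: "height (graph s + t *\<^sub>R nrm s) = \<phi> s + t / q - \<phi> (s - t * \<phi>' s / q)" for t
  proof -
    have "(graph s + t *\<^sub>R nrm s - p) \<bullet> e = s - t * \<phi>' s / q"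
      by (simp add: graph_def pt_def nrm_def q_def inner_left_distrib inner_diff_left ee nn ne en)
    moreover have "(graph s + t *\<^sub>R nrm s - p) \<bullet> n = \<phi> s + t / q"
      by (simp add: graph_def pt_def nrm_def q_def inner_left_distrib inner_diff_left ee nn ne en)
    ultimately show ?thesis by (simp add: height_def)
  qed
  have "((\<lambda>t. s - t * \<phi>' s / q) has_real_derivative - (\<phi>' s / q)) (at 0)"
  proof -
    have "((\<lambda>t. s - t * (\<phi>' s / q)) has_real_derivative 0 - 1 * (\<phi>' s / q)) (at 0)"
      by (intro derivative_intros DERIV_cmult_right DERIV_ident)
    then show ?thesis by simp
  qed
  moreover have "(\<phi> has_real_derivative \<phi>' s) (at (s - 0 * \<phi>' s / q))" using der[OF s] by simp
  ultimately have "((\<lambda>t. \<phi> (s - t * \<phi>' s / q)) has_real_derivative \<phi>' s * - (\<phi>' s / q)) (at 0)"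
    by (rule DERIV_chain2[rotated])
  then have "((\<lambda>t. \<phi> s + t / q - \<phi> (s - t * \<phi>' s / q)) has_real_derivative 1/q + \<phi>' s * \<phi>' s / q) (at 0)"
  proof -
    assume *: "((\<lambda>t. \<phi> (s - t * \<phi>' s / q)) has_real_derivative \<phi>' s * - (\<phi>' s / q)) (at 0)"
    have "((\<lambda>t. \<phi> s + t * (1/q) - \<phi> (s - t * \<phi>' s / q)) has_real_derivative 0 + 1 * (1/q) - \<phi>' s * - (\<phi>' s / q)) (at 0)"
      by (intro derivative_intros DERIV_cmult_right DERIV_ident *)
    then show ?thesis by simp
  qed
  moreover have "1/q + \<phi>' s * \<phi>' s / q = q"
  proof -
    have "1/q + \<phi>' s * \<phi>' s / q = (1 + (\<phi>' s)\<^sup>2) / q" by (simp add: add_divide_distrib power2_eq_square)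
    also have "\<dots> = q" unfolding q(2)[symmetric] using q(1) by simp
    finally show ?thesis .
  qed
  ultimately show ?thesis unfolding eq q_def[symmetric] by simp
qed

lemma graph_normal_sides:
  assumes s: "graph s \<in> ball p r"
  shows "\<forall>\<^sub>F t in at_right 0. graph s + t *\<^sub>R nrm s \<notin> closure \<Omega>"
    and "\<forall>\<^sub>F t in at_right 0. graph s - t *\<^sub>R nrm s \<in> \<Omega>"
proof -
  have sr: "s \<in> {-r<..<r}" using coord_in[OF s] by simp
  have h0: "height (graph s) = 0" by (simp add: graph_def height_pt)
  have "isCont (\<lambda>t. graph s + t *\<^sub>R nrm s) 0" by (intro continuous_intros)
  then have "((\<lambda>t. graph s + t *\<^sub>R nrm s) \<longlongrightarrow> graph s) (at 0)" by (simp add: isCont_def)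
  then have nearb: "\<forall>\<^sub>F t in at 0. graph s + t *\<^sub>R nrm s \<in> ball p r"
    using s by (rule topological_tendstoD[OF _ open_ball])
  obtain d where d: "d > 0" "\<And>h. 0 < h \<Longrightarrow> h < d \<Longrightarrow> height (graph s + h *\<^sub>R nrm s) > 0"
    using DERIV_pos_inc_right[OF height_normal_deriv[OF sr] q_pos(1)] h0 by auto
  obtain d' where d': "d' > 0" "\<And>h. 0 < h \<Longrightarrow> h < d' \<Longrightarrow> height (graph s - h *\<^sub>R nrm s) < 0"
    using DERIV_pos_inc_left[OF height_normal_deriv[OF sr] q_pos(1)] h0 by auto
  have "\<forall>\<^sub>F t in at_right 0. t \<in> {0<..<d}" using d by (intro eventually_at_right_real) auto
  moreover have "\<forall>\<^sub>F t in at_right 0. graph s + t *\<^sub>R nrm s \<in> ball p r"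
    using nearb by (simp add: eventually_at_split)
  ultimately show "\<forall>\<^sub>F t in at_right 0. graph s + t *\<^sub>R nrm s \<notin> closure \<Omega>"
    by eventually_elim (metis d(2) greaterThanLessThan_iff in_closure_iff not_le)
  have "\<forall>\<^sub>F t in at_right 0. t \<in> {0<..<d'}" using d' by (intro eventually_at_right_real) auto
  moreover have "\<forall>\<^sub>F t in at_left 0. graph s + t *\<^sub>R nrm s \<in> ball p r"
    using nearb by (simp add: eventually_at_split)
  then have "\<forall>\<^sub>F t in at_right 0. graph s - t *\<^sub>R nrm s \<in> ball p r"
    using eventually_at_left_to_right[of _ "0::real"] by simp
  ultimately show "\<forall>\<^sub>F t in at_right 0. graph s - t *\<^sub>R nrm s \<in> \<Omega>"
    by eventually_elim (use d' in_dom_iff in auto)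
qed

lemma graph_secant_bound: "\<bar>s' - s\<bar> \<le> dist (graph s') (graph s)"
proof -
  have "(graph s' - graph s) \<bullet> e = s' - s"
    using graph_coord[of s'] graph_coord[of s] by (simp add: inner_diff_left)
  then show ?thesis using Cauchy_Schwarz_ineq2[of "graph s' - graph s" e] e by (simp add: dist_norm)
qed

text \<open>In the coordinates of the chart, \<open>nrm s \<bullet> (y - graph s)\<close> is up to a factor the error of the first
  order expansion of \<open>\<phi>\<close> at \<open>s\<close>.\<close>
lemma nrm_limit:
  assumes s: "graph s \<in> ball p r"
  shows "((\<lambda>y. nrm s \<bullet> (y - graph s) / norm (y - graph s)) \<longlongrightarrow> 0) (at (graph s) within frontier \<Omega>)"
proof (rule tendstoI)
  fix \<epsilon> :: real assume ep: "\<epsilon> > 0"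
  let ?q = "sqrt (1 + (\<phi>' s)\<^sup>2)"
  have sr: "s \<in> {-r<..<r}" using coord_in[OF s] by simp
  have "(\<phi> has_derivative (\<lambda>h. \<phi>' s * h)) (at s)" using der[OF sr] by (simp add: has_field_derivative_def)
  then obtain d where d: "d > 0" "\<And>s'. \<bar>s' - s\<bar> < d \<Longrightarrow> \<bar>\<phi> s' - \<phi> s - \<phi>' s * (s' - s)\<bar> \<le> (\<epsilon>/2) * \<bar>s' - s\<bar>"
    unfolding has_derivative_at_alt using ep by (force dest: spec[of _ "\<epsilon>/2"])
  have "\<forall>\<^sub>F y in at (graph s) within frontier \<Omega>. y \<in> ball p r"
    using s by (intro eventually_at_topological[THEN iffD2] exI[of _ "ball p r"]) auto
  moreover have "\<forall>\<^sub>F y in at (graph s) within frontier \<Omega>. dist y (graph s) < d"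
    using d by (auto simp: eventually_at)
  moreover have "\<forall>\<^sub>F y in at (graph s) within frontier \<Omega>. y \<in> frontier \<Omega> \<and> y \<noteq> graph s"
    by (auto simp: eventually_at_filter)
  ultimately show "\<forall>\<^sub>F y in at (graph s) within frontier \<Omega>. dist (nrm s \<bullet> (y - graph s) / norm (y - graph s)) 0 < \<epsilon>"
  proof eventually_elim
    case (elim y)
    define s' where "s' = (y - p) \<bullet> e"
    have y: "y = graph s'" using frontier_is_graph[of y] elim unfolding s'_def by auto
    have le: "\<bar>s' - s\<bar> \<le> norm (y - graph s)" using graph_secant_bound[of s' s] y by (simp add: dist_norm)
    have "(n - \<phi>' s *\<^sub>R e) \<bullet> (y - graph s) = \<phi> s' - \<phi> s - \<phi>' s * (s' - s)"
      unfolding y by (simp add: graph_def pt_def inner_left_distrib inner_diff_left inner_diff_right inner_right_distrib ee nn ne en algebra_simps)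
    then have "nrm s \<bullet> (y - graph s) = (\<phi> s' - \<phi> s - \<phi>' s * (s' - s)) / ?q"
      by (simp add: nrm_def)
    then have "\<bar>nrm s \<bullet> (y - graph s)\<bar> \<le> \<bar>\<phi> s' - \<phi> s - \<phi>' s * (s' - s)\<bar>"
      using q_pos[of s] by (simp add: abs_divide divide_le_eq mult_le_cancel_left1)
    also have "\<dots> \<le> (\<epsilon>/2) * \<bar>s' - s\<bar>" using le elim(2) by (intro d) (simp add: dist_norm)
    also have "\<dots> \<le> (\<epsilon>/2) * norm (y - graph s)" using le ep by (intro mult_left_mono) auto
    finally have "\<bar>nrm s \<bullet> (y - graph s)\<bar> / norm (y - graph s) \<le> \<epsilon>/2"
      using elim by (simp add: divide_le_eq)
    also have "\<dots> < \<epsilon>" using ep by simp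
    finally show ?case by (simp add: dist_real_def abs_divide)
  qed
qed

lemma unit_normal_cases:
  assumes m: "norm m = 1" "m \<bullet> tang s = 0"
  shows "m = nrm s \<or> m = - nrm s"
proof -
  have T: "norm (tang s /\<^sub>R norm (tang s)) = 1" using tang_nz[of s] by simp
  have "m = (m \<bullet> (tang s /\<^sub>R norm (tang s))) *\<^sub>R (tang s /\<^sub>R norm (tang s)) + (m \<bullet> nrm s) *\<^sub>R nrm s"
    by (rule plane_orthonormal_expansion[OF T nrm_norm]) (simp add: tang_nrm)
  then have m': "m = (m \<bullet> nrm s) *\<^sub>R nrm s" using m by simp
  then have "norm m = \<bar>m \<bullet> nrm s\<bar>" by (metis mult.right_neutral norm_scaleR nrm_norm)
  then have "m \<bullet> nrm s = 1 \<or> m \<bullet> nrm s = -1" using m by linarith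
  then show ?thesis using m' by (metis scaleR_minus1_left scaleR_one)
qed

lemma graph_near':
  assumes "graph s \<in> ball p r" shows "\<forall>\<^sub>F s' in nhds s. graph s' \<in> ball p r"
proof -
  have "s \<in> {-r<..<r}" using coord_in[OF assms] by simp
  then have "isCont graph s" using graph_deriv has_vector_derivative_continuous by blast
  then have "(graph \<longlongrightarrow> graph s) (nhds s)" by (simp add: isCont_def tendsto_at_iff_tendsto_nhds)
  then show ?thesis using assms by (intro topological_tendstoD[where S="ball p r"]) auto
qed

text \<open>A unit vector that satisfies the limit condition is orthogonal to the tangent, which leaves two
  candidates; the interior side excludes \<open>- nrm s\<close>.\<close>
lemma outer_normal_graph:
  assumes s: "graph s \<in> ball p r"
  shows "outer_normal \<Omega> (graph s) = nrm s"
  unfolding outer_normal_def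
proof (rule the_equality)
  show "norm (nrm s) = 1 \<and>
    ((\<lambda>y. nrm s \<bullet> (y - graph s) / norm (y - graph s)) \<longlongrightarrow> 0) (at (graph s) within frontier \<Omega>) \<and>
    (\<forall>\<^sub>F t in at_right 0. graph s + t *\<^sub>R nrm s \<notin> closure \<Omega>)"
    using nrm_norm nrm_limit[OF s] graph_normal_sides(1)[OF s] by blast
next
  fix m assume m: "norm m = 1 \<and>
    ((\<lambda>y. m \<bullet> (y - graph s) / norm (y - graph s)) \<longlongrightarrow> 0) (at (graph s) within frontier \<Omega>) \<and>
    (\<forall>\<^sub>F t in at_right 0. graph s + t *\<^sub>R m \<notin> closure \<Omega>)"
  have sr: "s \<in> {-r<..<r}" using coord_in[OF s] by simp
  have quot: "((\<lambda>s'. (graph s' - graph s) /\<^sub>R (s' - s)) \<longlongrightarrow> tang s) (at s)"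
    using graph_deriv[OF sr] by (simp add: has_vector_derivative_iff_quotient)
  have flim: "filterlim graph (at (graph s) within frontier \<Omega>) (at s)"
  proof (rule filterlim_at_withinI)
    have "isCont graph s" using graph_deriv[OF sr] has_vector_derivative_continuous by blast
    then show "(graph \<longlongrightarrow> graph s) (at s)" by (simp add: isCont_def)
    have "\<forall>\<^sub>F s' in at s. graph s' \<in> ball p r"
      using graph_near'[OF s] by (simp add: eventually_at_filter eventually_mono)
    moreover have "\<forall>\<^sub>F s' in at s. s' \<noteq> s" by (simp add: eventually_at_filter)
    ultimately show "\<forall>\<^sub>F s' in at s. graph s' \<in> frontier \<Omega> - {graph s}"
      by eventually_elim (metis Diff_iff graph_coord graph_in_frontier singletonD)
  qed
  have l1: "((\<lambda>s'. m \<bullet> (graph s' - graph s) / norm (graph s' - graph s)) \<longlongrightarrow> 0) (at s)"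
    using filterlim_compose[OF _ flim] m by blast
  have "((\<lambda>s'. m \<bullet> (graph s' - graph s) / norm (graph s' - graph s) * norm ((graph s' - graph s) /\<^sub>R (s' - s)))
       \<longlongrightarrow> 0 * norm (tang s)) (at s)"
    by (intro tendsto_mult l1 tendsto_norm quot)
  then have z: "((\<lambda>s'. \<bar>m \<bullet> (graph s' - graph s) / norm (graph s' - graph s) * norm ((graph s' - graph s) /\<^sub>R (s' - s))\<bar>)
       \<longlongrightarrow> 0) (at s)"
    unfolding mult_zero_left by (rule tendsto_rabs_zero)
  have eq: "\<bar>m \<bullet> v / norm v * norm (v /\<^sub>R h)\<bar> = \<bar>m \<bullet> (v /\<^sub>R h)\<bar>" for v h
    by (cases "v = 0") (simp_all add: abs_mult)
  have "((\<lambda>s'. \<bar>m \<bullet> ((graph s' - graph s) /\<^sub>R (s' - s))\<bar>) \<longlongrightarrow> 0) (at s)"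
    using z unfolding eq .
  moreover have "((\<lambda>s'. \<bar>m \<bullet> ((graph s' - graph s) /\<^sub>R (s' - s))\<bar>) \<longlongrightarrow> \<bar>m \<bullet> tang s\<bar>) (at s)"
    by (intro tendsto_intros quot)
  ultimately have "\<bar>m \<bullet> tang s\<bar> = 0"
    using tendsto_unique[OF trivial_limit_at] by blast
  then have "m = nrm s \<or> m = - nrm s" using m by (intro unit_normal_cases) auto
  moreover have "m \<noteq> - nrm s"
  proof
    assume "m = - nrm s"
    then have "\<forall>\<^sub>F t in at_right 0. graph s - t *\<^sub>R nrm s \<notin> closure \<Omega>" using m by simp
    then have "\<forall>\<^sub>F t in at_right (0::real). False"
      using graph_normal_sides(2)[OF s] by eventually_elim (use closure_subset in auto)
    then show False by simp
  qed
  ultimately show "m = nrm s" by blast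
qed

text \<open>The derivative of the unit normal is tangential, and the tangential divergence is its tangential
  component. The derivative \<open>D\<close> within the boundary curve is not unique, but the chain rule along
  \<open>graph\<close> determines its value on the tangent.\<close>
lemma nrm_deriv_curvature:
  assumes s: "graph s \<in> ball p r" and d: "\<phi>' differentiable (at s)"
  shows "(nrm has_vector_derivative (- curvature \<Omega> (graph s)) *\<^sub>R tang s) (at s)"
proof -
  let ?N = "outer_normal \<Omega>" and ?F = "frontier \<Omega>" and ?x = "graph s" and ?T = "tang s"
  have sr: "s \<in> {-r<..<r}" using coord_in[OF s] by simp
  \<comment> \<open>Only the existence of a derivative of the normal is extracted from its formula.\<close>
  obtain k where k: "(\<phi>' has_real_derivative k) (at s)" using d real_differentiable_def by blast
  have "((\<lambda>s. 1 / sqrt (1 + (\<phi>' s)\<^sup>2)) has_real_derivative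
      - (2 * \<phi>' s * k * (1 / sqrt (1 + (\<phi>' s)\<^sup>2) / 2)) / (sqrt (1 + (\<phi>' s)\<^sup>2))\<^sup>2) (at s)"
    using k q_pos[of s] by (auto intro!: derivative_eq_intros simp: power2_eq_square field_simps)
  then obtain c where c: "((\<lambda>s. 1 / sqrt (1 + (\<phi>' s)\<^sup>2)) has_real_derivative c) (at s)" by blast
  have "((\<lambda>s. n - \<phi>' s *\<^sub>R e) has_vector_derivative 0 - (\<phi>' s *\<^sub>R 0 + k *\<^sub>R e)) (at s)"
    by (intro derivative_intros k)
  then have "\<exists>nu. (nrm has_vector_derivative nu) (at s)"
    unfolding nrm_def using has_vector_derivative_scaleR[OF c] by blast
  then obtain nu where nu: "(nrm has_vector_derivative nu) (at s)" ..
  \<comment> \<open>The normal has constant length, so it is orthogonal to its derivative.\<close>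
  have "((\<lambda>s. nrm s \<bullet> nrm s) has_real_derivative nrm s \<bullet> nu + nu \<bullet> nrm s) (at s)"
    using bounded_bilinear.has_vector_derivative[OF bounded_bilinear_inner nu nu]
    by (simp add: has_real_derivative_iff_has_vector_derivative)
  moreover have "(\<lambda>s. nrm s \<bullet> nrm s) = (\<lambda>s. 1)" using nrm_norm by (auto simp: norm_eq_1)
  ultimately have "nrm s \<bullet> nu + nu \<bullet> nrm s = 0" using DERIV_unique DERIV_const by metis
  then have perp: "nu \<bullet> nrm s = 0" by (simp add: inner_commute)
  have par: "nu = ((nu \<bullet> ?T) / (?T \<bullet> ?T)) *\<^sub>R ?T"
    by (rule plane_perp_parallel[OF nrm_norm tang_nrm perp tang_nz])
  have nearF: "?N y = nrm ((y - p) \<bullet> e)" if "y \<in> ?F" "y \<in> ball p r" for y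
    using outer_normal_graph[of "(y - p) \<bullet> e"] frontier_is_graph[of y] that by simp
  have xF: "?x \<in> ?F" using graph_in_frontier[OF s] .
  \<comment> \<open>One possible derivative within the curve: extend the normal constantly in the direction of the coordinate \<open>n\<close>.\<close>
  have D0: "(?N has_derivative (\<lambda>v. (v \<bullet> e) *\<^sub>R nu)) (at ?x within ?F)"
  proof -
    have "((\<lambda>y. (y - p) \<bullet> e) has_derivative (\<lambda>v. (v - 0) \<bullet> e)) (at ?x)"
      by (intro derivative_intros)
    moreover have "(nrm has_derivative (\<lambda>h. h *\<^sub>R nu)) (at ((?x - p) \<bullet> e))"
      using nu by (simp add: has_vector_derivative_def)
    ultimately have "((\<lambda>y. nrm ((y - p) \<bullet> e)) has_derivative (\<lambda>v. (v \<bullet> e) *\<^sub>R nu)) (at ?x)"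
      using has_derivative_compose by fastforce
    then have "((\<lambda>y. nrm ((y - p) \<bullet> e)) has_derivative (\<lambda>v. (v \<bullet> e) *\<^sub>R nu)) (at ?x within ?F)"
      by (rule has_derivative_at_withinI)
    moreover obtain \<delta> where "\<delta> > 0" "ball ?x \<delta> \<subseteq> ball p r"
      using s open_contains_ball open_ball by metis
    ultimately show ?thesis
      by (rule_tac has_derivative_transform_within[where d = \<delta>]) (use xF nearF in \<open>auto simp: dist_commute subset_eq\<close>)
  qed
  have along: "D ?T = nu" if D: "(?N has_derivative D) (at ?x within ?F)" for D
  proof -
    obtain I where I: "open I" "s \<in> I" "\<And>s'. s' \<in> I \<Longrightarrow> graph s' \<in> ball p r"
      using graph_near'[OF s] unfolding eventually_nhds by blast
    have "(?N has_derivative D) (at ?x within graph ` I)"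
      by (rule has_derivative_subset[OF D]) (use I graph_in_frontier in auto)
    moreover have "(graph has_derivative (\<lambda>h. h *\<^sub>R ?T)) (at s within I)"
      using graph_deriv[OF sr] by (auto simp: has_vector_derivative_def intro: has_derivative_at_withinI)
    ultimately have "((\<lambda>s'. ?N (graph s')) has_derivative (\<lambda>h. D (h *\<^sub>R ?T))) (at s within I)"
      by (rule has_derivative_in_compose[rotated])
    then have "((\<lambda>s'. ?N (graph s')) has_derivative (\<lambda>h. D (h *\<^sub>R ?T))) (at s)"
      using I at_within_open by metis
    then have "(nrm has_derivative (\<lambda>h. D (h *\<^sub>R ?T))) (at s)"
      by (rule has_derivative_transform_within_open[OF _ I(1,2)]) (use I(3) outer_normal_graph in auto)
    then have "(\<lambda>h. D (h *\<^sub>R ?T)) = (\<lambda>h. h *\<^sub>R nu)"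
      using nu has_derivative_unique unfolding has_vector_derivative_def by blast
    then have "D (1 *\<^sub>R ?T) = 1 *\<^sub>R nu" by meson
    then show ?thesis by simp
  qed
  \<comment> \<open>The sign of the unit tangent does not matter, because it enters twice.\<close>
  have val: "\<tau> \<bullet> D \<tau> = (nu \<bullet> ?T) / (?T \<bullet> ?T)"
    if D: "(?N has_derivative D) (at ?x within ?F)" and t: "norm \<tau> = 1" "\<tau> \<bullet> ?N ?x = 0" for D \<tau>
  proof -
    have lin: "D (c *\<^sub>R w) = c *\<^sub>R D w" for c w
      using has_derivative_bounded_linear[OF D] bounded_linear.linear linear_scale by blast
    have "\<tau> \<bullet> nrm s = 0" using t outer_normal_graph[OF s] by simp
    then have tau: "\<tau> = ((\<tau> \<bullet> ?T) / (?T \<bullet> ?T)) *\<^sub>R ?T"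
      using plane_perp_parallel[OF nrm_norm tang_nrm _ tang_nz] by blast
    define a where "a = (\<tau> \<bullet> ?T) / (?T \<bullet> ?T)"
    have ta: "\<tau> = a *\<^sub>R ?T" using tau by (simp add: a_def)
    have "\<tau> \<bullet> \<tau> = 1" using t(1) by (simp add: norm_eq_1)
    then have "a * a * (?T \<bullet> ?T) = 1" unfolding ta by (simp add: mult.assoc)
    then have "a * a = 1 / (?T \<bullet> ?T)" using tang_nz[of s] by (simp add: field_simps)
    moreover have "\<tau> \<bullet> D \<tau> = a * a * (?T \<bullet> nu)" by (simp add: ta lin along[OF D])
    ultimately show ?thesis by (simp add: inner_commute)
  qed
  have "tangential_div ?F ?N ?N ?x = (nu \<bullet> ?T) / (?T \<bullet> ?T)"
    unfolding tangential_div_def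
  proof (rule the_equality)
    have "norm (?T /\<^sub>R norm ?T) = 1 \<and> (?T /\<^sub>R norm ?T) \<bullet> ?N ?x = 0"
      using tang_nz[of s] tang_nrm[of s] outer_normal_graph[OF s] by simp
    then show "\<exists>D \<tau>. (?N has_derivative D) (at ?x within ?F) \<and> norm \<tau> = 1 \<and> \<tau> \<bullet> ?N ?x = 0 \<and>
        nu \<bullet> ?T / (?T \<bullet> ?T) = \<tau> \<bullet> D \<tau>"
      using D0 val[OF D0] by metis
  qed (use val in auto)
  then have "(- curvature \<Omega> ?x) *\<^sub>R ?T = nu" using par by (simp add: curvature_def)
  then show ?thesis using nu by simp
qed

text \<open>The graph lies below the parabola \<open>\<phi>' 0 s + L s\<^sup>2\<close>, and a ball of radius at most about \<open>1 / (2 L)\<close>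
  that touches the parabola from above at \<open>s = 0\<close> stays above it. This is the exterior ball needed
  for the Hopf lemma.\<close>
lemma exterior_ball:
  obtains R where "R > 0" "ball (p + R *\<^sub>R nrm 0) R \<subseteq> - closure \<Omega>"
proof -
  have L0: "0 \<le> L" using lip by (rule lipschitz_on_nonneg)
  define R where "R = min (r/2) (1 / (2 * (L + 1)))"
  have R: "R > 0" "2 * R \<le> r" "2 * R * (L + 1) \<le> 1"
    using r L0 by (auto simp: R_def min_def field_simps)
  let ?q = "sqrt (1 + (\<phi>' 0)\<^sup>2)"
  have "ball (p + R *\<^sub>R nrm 0) R \<subseteq> - closure \<Omega>"
  proof
    fix x assume "x \<in> ball (p + R *\<^sub>R nrm 0) R"
    then have xR: "norm (x - p - R *\<^sub>R nrm 0) < R" by (simp add: dist_norm norm_minus_commute diff_diff_eq)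
    define v where "v = x - p"
    define s h where "s = v \<bullet> e" and "h = v \<bullet> n"
    have "norm v \<le> norm (v - R *\<^sub>R nrm 0) + norm (R *\<^sub>R nrm 0)"
      using norm_triangle_ineq[of "v - R *\<^sub>R nrm 0" "R *\<^sub>R nrm 0"] by simp
    then have "norm v < r" using xR R nrm_norm[of 0] by (simp add: v_def)
    then have xr: "x \<in> ball p r" by (simp add: v_def dist_norm norm_minus_commute)
    have sr: "s \<in> {-r<..<r}" using coord_in[OF xr] by (simp add: s_def v_def)
    have "(norm (v - R *\<^sub>R nrm 0))\<^sup>2 < R\<^sup>2" using xR by (simp add: v_def power_strict_mono)
    moreover have "(norm (v - R *\<^sub>R nrm 0))\<^sup>2 = v \<bullet> v - 2 * R * (v \<bullet> nrm 0) + R\<^sup>2"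
    proof -
      have "(norm (v - R *\<^sub>R nrm 0))\<^sup>2 = (v - R *\<^sub>R nrm 0) \<bullet> (v - R *\<^sub>R nrm 0)"
        by (rule power2_norm_eq_inner)
      also have "\<dots> = v \<bullet> v - 2 * R * (v \<bullet> nrm 0) + R\<^sup>2 * (nrm 0 \<bullet> nrm 0)"
        by (simp add: inner_diff_left inner_diff_right inner_commute power2_eq_square algebra_simps)
      finally show ?thesis using nrm_norm[of 0] by (simp add: norm_eq_1)
    qed
    ultimately have v1: "v \<bullet> v < 2 * R * (v \<bullet> nrm 0)" by simp
    have div_le: "0 < x \<Longrightarrow> 1 \<le> q \<Longrightarrow> x / q \<le> x" for x q :: real
      by (simp add: divide_le_eq mult_le_cancel_left1)
    have "\<bar>s\<bar> \<le> norm v" using coord_le[of x] by (simp add: s_def v_def dist_norm norm_minus_commute)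
    then have "s\<^sup>2 \<le> v \<bullet> v" by (metis abs_ge_zero power2_abs power2_norm_eq_inner power_mono)
    then have sv: "s\<^sup>2 < 2 * R * (v \<bullet> nrm 0)" using v1 by simp
    have vn: "v \<bullet> nrm 0 = (h - \<phi>' 0 * s) / ?q"
      by (simp add: nrm_def inner_diff_right s_def h_def)
    have "0 < 2 * R * (v \<bullet> nrm 0)" using sv zero_le_power2[of s] by linarith
    then have pos: "0 < v \<bullet> nrm 0" using R by (simp add: zero_less_mult_iff)
    then have "0 < h - \<phi>' 0 * s" unfolding vn using q_pos[of 0] by (simp add: zero_less_divide_iff)
    then have "v \<bullet> nrm 0 \<le> h - \<phi>' 0 * s" unfolding vn using q_pos(3)[of 0] div_le by blast
    then have "s\<^sup>2 < 2 * R * (h - \<phi>' 0 * s)" using sv R by (smt (verit) mult_left_mono)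
    then have "(L + 1) * s\<^sup>2 < (L + 1) * (2 * R * (h - \<phi>' 0 * s))" using L0 by simp
    also have "\<dots> = (2 * R * (L + 1)) * (h - \<phi>' 0 * s)" by simp
    also have "\<dots> \<le> 1 * (h - \<phi>' 0 * s)" using R \<open>0 < h - \<phi>' 0 * s\<close> by (intro mult_right_mono) auto
    finally have "(L + 1) * s\<^sup>2 < 1 * (h - \<phi>' 0 * s)" .
    moreover have "(L + 1) * s\<^sup>2 = L * s\<^sup>2 + s\<^sup>2" by (simp add: algebra_simps)
    ultimately have "L * s\<^sup>2 + s\<^sup>2 < h - \<phi>' 0 * s" by simp
    then have h1: "L * s\<^sup>2 < h - \<phi>' 0 * s" using zero_le_power2[of s] by linarith
    have "\<bar>\<phi> s - \<phi>' 0 * s\<bar> \<le> L * s\<^sup>2"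
    proof (cases "s = 0")
      case True then show ?thesis by (simp add: phi0)
    next
      case False
      obtain z where z: "\<bar>z\<bar> \<le> \<bar>s\<bar>" "\<phi> s = s * \<phi>' z"
      proof (cases "s > 0")
        case True
        have "\<exists>z. 0 < z \<and> z < s \<and> \<phi> s - \<phi> 0 = (s - 0) * \<phi>' z"
          using True sr by (intro MVT2) (auto intro!: der)
        then show ?thesis using that phi0 by force
      next
        case f: False
        have "\<exists>z. s < z \<and> z < 0 \<and> \<phi> 0 - \<phi> s = (0 - s) * \<phi>' z"
          using f False sr by (intro MVT2) (auto intro!: der)
        then show ?thesis using that phi0 by force
      qed
      have "z \<in> {-r<..<r}" using z sr by auto
      then have "\<bar>\<phi>' z - \<phi>' 0\<bar> \<le> L * \<bar>z\<bar>" using lipschitz_onD[OF lip, of z 0] r by (simp add: dist_real_def)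
      also have "\<dots> \<le> L * \<bar>s\<bar>" using z L0 by (intro mult_left_mono)
      finally have "\<bar>s\<bar> * \<bar>\<phi>' z - \<phi>' 0\<bar> \<le> \<bar>s\<bar> * (L * \<bar>s\<bar>)" by (intro mult_left_mono) auto
      moreover have "\<bar>\<phi> s - \<phi>' 0 * s\<bar> = \<bar>s\<bar> * \<bar>\<phi>' z - \<phi>' 0\<bar>"
        unfolding z(2) by (simp add: abs_mult[symmetric] algebra_simps)
      moreover have "\<bar>s\<bar> * (L * \<bar>s\<bar>) = L * s\<^sup>2" by (metis abs_mult_self_eq mult.assoc mult.commute power2_eq_square)
      ultimately show ?thesis by simp
    qed
    then have "height x > 0" using h1 by (simp add: height_def s_def h_def v_def)
    then show "x \<in> - closure \<Omega>" using in_closure_iff[OF xr] by simp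
  qed
  then show ?thesis using that R by blast
qed

end

lemma C11_boundary_chart:
  assumes "open \<Omega>" "C11_boundary \<Omega>" "p \<in> frontier \<Omega>"
  obtains e n r L \<phi> \<phi>' where "boundary_chart \<Omega> p e n r L \<phi> \<phi>'"
proof -
  obtain e n r \<phi> \<phi>' L where c: "norm e = 1 \<and> norm n = 1 \<and> e \<bullet> n = 0 \<and> r > 0 \<and>
     (\<forall>s\<in>{-r<..<r}. (\<phi> has_real_derivative \<phi>' s) (at s)) \<and>
     L-lipschitz_on {-r<..<r} \<phi>' \<and>
     \<Omega> \<inter> ball p r = {x \<in> ball p r. (x - p) \<bullet> n < \<phi> ((x - p) \<bullet> e)}"
    using assms unfolding C11_boundary_def by meson
  have "boundary_chart \<Omega> p e n r L \<phi> \<phi>'"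
    using assms c by unfold_locales auto
  then show ?thesis by (rule that)
qed

context boundary_chart begin

lemma nrm_lip_at:
  assumes s: "s \<in> {-r<..<r}" shows "lip_at nrm s"
proof -
  define \<nu> where "\<nu> x = (1 / sqrt (1 + x\<^sup>2)) *\<^sub>R (n - x *\<^sub>R e)" for x :: real
  have p: "1 + x\<^sup>2 > 0" for x :: real by (simp add: add_pos_nonneg)
  have "\<exists>c. ((\<lambda>x. 1 / sqrt (1 + x\<^sup>2)) has_real_derivative c) (at y)" for y :: real
    using p[of y] by (intro exI) (auto intro!: derivative_eq_intros)
  then obtain c where c: "((\<lambda>x. 1 / sqrt (1 + x\<^sup>2)) has_real_derivative c) (at (\<phi>' s))" by blast
  have "((\<lambda>x. n - x *\<^sub>R e) has_vector_derivative 0 - (\<phi>' s *\<^sub>R 0 + 1 *\<^sub>R e)) (at (\<phi>' s))"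
    by (intro derivative_intros)
  from has_vector_derivative_scaleR[OF c this] have "lip_at \<nu> (\<phi>' s)"
    unfolding \<nu>_def[abs_def] by (rule lip_at_differentiable)
  moreover have "lip_at \<phi>' s"
  proof -
    have "\<forall>\<^sub>F y in nhds s. y \<in> {-r<..<r}" using s by (intro eventually_nhds_in_open) auto
    then have "\<forall>\<^sub>F y in nhds s. dist (\<phi>' y) (\<phi>' s) \<le> L * dist y s"
      by eventually_elim (use lipschitz_onD[OF lip] s in blast)
    then show ?thesis unfolding lip_at_def by blast
  qed
  ultimately have "lip_at (\<lambda>s. \<nu> (\<phi>' s)) s" by (rule lip_at_compose)
  then show ?thesis unfolding \<nu>_def nrm_def[abs_def] .
qed

text \<open>A regular \<open>C\<^sup>1\<close> curve in the boundary is \<open>graph \<circ> s\<close> for a parameter change \<open>s\<close> with nonzero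
  derivative, and preimages of null sets under such an \<open>s\<close> are null. This moves the statements about
  the chart, valid where \<open>\<phi>'\<close> is differentiable, to the parameter of the curve.\<close>
lemma curve_in_chart:
  fixes c c' :: "real \<Rightarrow> real^2" and X :: "(real^2) set"
  assumes J: "open J" and cJ: "\<And>t. t \<in> J \<Longrightarrow> c t \<in> frontier \<Omega> \<inter> ball p r"
    and der: "\<And>t. t \<in> J \<Longrightarrow> (c has_vector_derivative c' t) (at t)" and nz: "\<And>t. t \<in> J \<Longrightarrow> c' t \<noteq> 0"
    and X: "hausdorff1 X = 0"
  shows "\<And>t. t \<in> J \<Longrightarrow> c' t \<bullet> outer_normal \<Omega> (c t) = 0"
    and "\<And>t. t \<in> J \<Longrightarrow> lip_at (\<lambda>t. outer_normal \<Omega> (c t)) t"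
    and "negligible {t\<in>J. \<not> (((\<lambda>t. outer_normal \<Omega> (c t)) has_vector_derivative (- curvature \<Omega> (c t)) *\<^sub>R c' t) (at t) \<and> c t \<notin> X)}"
proof -
  let ?N = "outer_normal \<Omega>"
  define s where "s t = (c t - p) \<bullet> e" for t
  have cg: "c t = graph (s t)" if "t \<in> J" for t
    using frontier_is_graph[of "c t"] cJ[OF that] by (simp add: s_def)
  have gb: "graph (s t) \<in> ball p r" if "t \<in> J" for t using cJ[OF that] cg[OF that] by auto
  have sr: "s t \<in> {-r<..<r}" if "t \<in> J" for t using coord_in cJ[OF that] by (simp add: s_def)
  have Ncg: "?N (c t) = nrm (s t)" if "t \<in> J" for t using outer_normal_graph[OF gb[OF that]] cg[OF that] by simp
  have ds: "(s has_real_derivative c' t \<bullet> e) (at t)" if "t \<in> J" for t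
  proof -
    have "((\<lambda>t. (c t - p) \<bullet> e) has_derivative (\<lambda>h. (h *\<^sub>R c' t - 0) \<bullet> e)) (at t)"
      using der[OF that] unfolding has_vector_derivative_def by (intro derivative_intros)
    moreover have "(\<lambda>h. (h *\<^sub>R c' t - 0) \<bullet> e) = (*) (c' t \<bullet> e)" by (auto simp: fun_eq_iff)
    ultimately show ?thesis unfolding s_def[abs_def] has_field_derivative_def by simp
  qed
  have ctang: "c' t = (c' t \<bullet> e) *\<^sub>R tang (s t)" if t: "t \<in> J" for t
  proof -
    have "((graph \<circ> s) has_vector_derivative (c' t \<bullet> e) *\<^sub>R tang (s t)) (at t)"
      using ds[OF t] graph_deriv[OF sr[OF t]]
      by (intro vector_diff_chain_at) (auto simp: has_real_derivative_iff_has_vector_derivative)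
    then have "(c has_vector_derivative (c' t \<bullet> e) *\<^sub>R tang (s t)) (at t)"
      by (rule has_vector_derivative_transform_within_open[OF _ J t]) (simp add: cg)
    then show ?thesis using der[OF t] vector_derivative_unique_at by blast
  qed
  have s'nz: "c' t \<bullet> e \<noteq> 0" if "t \<in> J" for t
    using ctang[OF that] nz[OF that] by force
  show perp: "c' t \<bullet> ?N (c t) = 0" if t: "t \<in> J" for t
  proof -
    have "c' t \<bullet> nrm (s t) = (c' t \<bullet> e) * (tang (s t) \<bullet> nrm (s t))"
      by (subst ctang[OF t]) simp
    then show ?thesis using tang_nrm Ncg[OF t] by simp
  qed
  have evJ: "\<forall>\<^sub>F y in nhds t. y \<in> J" if "t \<in> J" for t using J that by (intro eventually_nhds_in_open)
  show "lip_at (\<lambda>t. ?N (c t)) t" if t: "t \<in> J" for t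
  proof (rule lip_at_cong)
    show "lip_at (\<lambda>t. nrm (s t)) t"
      by (rule lip_at_compose[of nrm s t, OF nrm_lip_at[OF sr[OF t]]
            lip_at_differentiable[OF ds[OF t, unfolded has_real_derivative_iff_has_vector_derivative]]])
    show "\<forall>\<^sub>F y in nhds t. nrm (s y) = ?N (c y)" using evJ[OF t] by eventually_elim (simp add: Ncg)
  qed
  \<comment> \<open>The bad chart parameters: the slope is not differentiable, or the point is one of the exceptional set \<open>X\<close>.\<close>
  define Z where "Z = {\<sigma> \<in> {-r<..<r}. \<not> \<phi>' differentiable (at \<sigma>)} \<union> (\<lambda>x. (x - p) \<bullet> e) ` X"
  have "negligible ((\<lambda>x. (x - p) \<bullet> e) ` X)"
  proof (rule hausdorff1_null_projection_negligible[OF X])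
    fix x y
    have "\<bar>(x - y) \<bullet> e\<bar> \<le> norm (x - y) * norm e" by (rule Cauchy_Schwarz_ineq2)
    then show "\<bar>(x - p) \<bullet> e - (y - p) \<bullet> e\<bar> \<le> dist x y" using e by (simp add: dist_norm inner_diff_left)
  qed
  then have "negligible Z" unfolding Z_def using lipschitz_ae_differentiable[OF lip] by (rule negligible_Un[rotated])
  then have "negligible {t \<in> J. s t \<in> Z}"
  proof (rule negligible_differentiable_vimage)
    fix t assume t: "t \<in> J"
    show "(s has_derivative (\<lambda>h. h * (c' t \<bullet> e))) (at t within J)"
    proof -
      have "(*) (c' t \<bullet> e) = (\<lambda>h. h * (c' t \<bullet> e))" by (auto simp: fun_eq_iff)
      then show ?thesis using ds[OF t] by (simp add: has_field_derivative_def has_derivative_at_withinI)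
    qed
    show "inj (\<lambda>h. h * (c' t \<bullet> e))" using s'nz[OF t] by (auto simp: inj_on_def)
  qed
  moreover have "((\<lambda>t. ?N (c t)) has_vector_derivative (- curvature \<Omega> (c t)) *\<^sub>R c' t) (at t) \<and> c t \<notin> X"
    if t: "t \<in> J" "s t \<notin> Z" for t
  proof
    show "c t \<notin> X" using t by (auto simp: Z_def s_def)
    have "\<phi>' differentiable (at (s t))" using t sr[OF t(1)] by (auto simp: Z_def)
    then have "(nrm has_vector_derivative (- curvature \<Omega> (graph (s t))) *\<^sub>R tang (s t)) (at (s t))"
      by (rule nrm_deriv_curvature[OF gb[OF t(1)]])
    then have "((nrm \<circ> s) has_vector_derivative (c' t \<bullet> e) *\<^sub>R ((- curvature \<Omega> (graph (s t))) *\<^sub>R tang (s t))) (at t)"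
      using ds[OF t(1)] by (intro vector_diff_chain_at) (auto simp: has_real_derivative_iff_has_vector_derivative)
    moreover have "(c' t \<bullet> e) *\<^sub>R ((- curvature \<Omega> (graph (s t))) *\<^sub>R tang (s t)) = (- curvature \<Omega> (c t)) *\<^sub>R ((c' t \<bullet> e) *\<^sub>R tang (s t))"
      using cg[OF t(1)] by (simp add: mult.commute)
    ultimately have "((nrm \<circ> s) has_vector_derivative (- curvature \<Omega> (c t)) *\<^sub>R c' t) (at t)"
      using ctang[OF t(1)] by simp
    then show "((\<lambda>t. ?N (c t)) has_vector_derivative (- curvature \<Omega> (c t)) *\<^sub>R c' t) (at t)"
      by (rule has_vector_derivative_transform_within_open[OF _ J t(1)]) (simp add: Ncg)
  qed
  then have "{t\<in>J. \<not> (((\<lambda>t. ?N (c t)) has_vector_derivative (- curvature \<Omega> (c t)) *\<^sub>R c' t) (at t) \<and> c t \<notin> X)} \<subseteq> {t \<in> J. s t \<in> Z}"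
    by blast
  ultimately show "negligible {t\<in>J. \<not> (((\<lambda>t. ?N (c t)) has_vector_derivative (- curvature \<Omega> (c t)) *\<^sub>R c' t) (at t) \<and> c t \<notin> X)}"
    by (rule negligible_subset)
qed

end

text \<open>The three statements are local in the parameter, so the previous lemma in a chart around each point
  suffices.\<close>
lemma curve_in_boundary:
  fixes c c' :: "real \<Rightarrow> real^2" and X :: "(real^2) set"
  assumes \<Omega>: "open \<Omega>" "C11_boundary \<Omega>" and J: "open J" and cJ: "\<And>t. t \<in> J \<Longrightarrow> c t \<in> frontier \<Omega>"
    and cder: "\<And>t. t \<in> J \<Longrightarrow> (c has_vector_derivative c' t) (at t)" and nz: "\<And>t. t \<in> J \<Longrightarrow> c' t \<noteq> 0"
    and X: "hausdorff1 X = 0"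
  shows "\<And>t. t \<in> J \<Longrightarrow> c' t \<bullet> outer_normal \<Omega> (c t) = 0"
    and "\<And>t. t \<in> J \<Longrightarrow> lip_at (\<lambda>t. outer_normal \<Omega> (c t)) t"
    and "negligible {t\<in>J. \<not> (((\<lambda>t. outer_normal \<Omega> (c t)) has_vector_derivative (- curvature \<Omega> (c t)) *\<^sub>R c' t) (at t) \<and> c t \<notin> X)}"
proof -
  let ?Bad = "{t\<in>J. \<not> (((\<lambda>t. outer_normal \<Omega> (c t)) has_vector_derivative (- curvature \<Omega> (c t)) *\<^sub>R c' t) (at t) \<and> c t \<notin> X)}"
  have local: "\<exists>K. open K \<and> t0 \<in> K \<and> K \<subseteq> J \<and> (\<forall>t\<in>K. c' t \<bullet> outer_normal \<Omega> (c t) = 0) \<and>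
     (\<forall>t\<in>K. lip_at (\<lambda>t. outer_normal \<Omega> (c t)) t) \<and> negligible (?Bad \<inter> K)" if t0: "t0 \<in> J" for t0
  proof -
    obtain e n r L \<phi> \<phi>' where ch: "boundary_chart \<Omega> (c t0) e n r L \<phi> \<phi>'"
      using C11_boundary_chart[OF \<Omega> cJ[OF t0]] by blast
    then interpret boundary_chart \<Omega> "c t0" e n r L \<phi> \<phi>' .
    have "isCont c t0" using cder[OF t0] has_vector_derivative_continuous by blast
    then have "(c \<longlongrightarrow> c t0) (nhds t0)" by (simp add: isCont_def tendsto_at_iff_tendsto_nhds)
    then have "\<forall>\<^sub>F t in nhds t0. c t \<in> ball (c t0) r" using r by (intro topological_tendstoD[where S="ball (c t0) r"]) auto
    then obtain K0 where K0: "open K0" "t0 \<in> K0" "\<And>t. t \<in> K0 \<Longrightarrow> c t \<in> ball (c t0) r"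
      unfolding eventually_nhds by blast
    define K where "K = K0 \<inter> J"
    have K: "open K" "t0 \<in> K" "K \<subseteq> J" using K0 J t0 by (auto simp: K_def)
    have cK: "c t \<in> frontier \<Omega> \<inter> ball (c t0) r" if "t \<in> K" for t using that cJ K0 by (auto simp: K_def)
    have derK: "(c has_vector_derivative c' t) (at t)" and nzK: "c' t \<noteq> 0" if "t \<in> K" for t
      using that cder nz K by auto
    note cc = curve_in_chart[OF K(1) cK derK nzK X]
    have "?Bad \<inter> K = {t\<in>K. \<not> (((\<lambda>t. outer_normal \<Omega> (c t)) has_vector_derivative (- curvature \<Omega> (c t)) *\<^sub>R c' t) (at t) \<and> c t \<notin> X)}"
      using K(3) by blast
    then have "negligible (?Bad \<inter> K)" using cc(3) by simp
    then show ?thesis using K cc(1,2) by blast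
  qed
  show "c' t \<bullet> outer_normal \<Omega> (c t) = 0" if "t \<in> J" for t using local[OF that] by blast
  show "lip_at (\<lambda>t. outer_normal \<Omega> (c t)) t" if "t \<in> J" for t using local[OF that] by blast
  show "negligible ?Bad"
  proof (subst locally_negligible_alt, intro ballI)
    fix t0 assume t0: "t0 \<in> ?Bad"
    then obtain K where K: "open K" "t0 \<in> K" "negligible (?Bad \<inter> K)" using local[of t0] by blast
    have "openin (top_of_set ?Bad) (?Bad \<inter> K)" using K(1) by (rule openin_open_Int)
    then show "\<exists>U. openin (top_of_set ?Bad) U \<and> t0 \<in> U \<and> negligible U" using K t0 by blast
  qed
qed

section \<open>Harmonic functions and complex coordinates\<close>

text \<open>Harmonicity is expressed by a holomorphic complex gradient \<open>K\<close>: locally \<open>h\<close> is the real part of a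
  primitive \<open>P\<close> of \<open>K\<close>, and the maximum modulus principle for \<open>exp P\<close> makes the set where the maximum is
  attained open. The hypothesis on the sets \<open>h \<ge> \<epsilon>\<close> says that \<open>h\<close> has boundary values at most \<open>0\<close>, and
  it allows functions that are not defined on the boundary.\<close>
lemma harmonic_max_principle:
  fixes S :: "complex set" and h :: "complex \<Rightarrow> real"
  assumes S: "open S" "bounded S" and K: "K holomorphic_on S"
    and der: "\<And>z. z \<in> S \<Longrightarrow> (h has_derivative (\<lambda>v. Re (K z * v))) (at z)"
    and bdry: "\<And>\<epsilon>. \<epsilon> > 0 \<Longrightarrow> closed {z \<in> S. h z \<ge> \<epsilon>}"
    and z: "z \<in> S"
  shows "h z \<le> 0"
proof (rule ccontr)
  assume "\<not> h z \<le> 0"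
  define \<epsilon> where "\<epsilon> = h z"
  define C where "C = {z \<in> S. h z \<ge> \<epsilon>}"
  have ep: "\<epsilon> > 0" using \<open>\<not> h z \<le> 0\<close> by (simp add: \<epsilon>_def)
  have contS: "continuous_on S h"
    by (meson der continuous_at_imp_continuous_on has_derivative_continuous)
  have C: "compact C"
    unfolding C_def compact_eq_bounded_closed using bdry[OF ep] S by (auto intro: bounded_subset)
  have "z \<in> C" using z by (simp add: C_def \<epsilon>_def)
  have "continuous_on C h" using contS by (rule continuous_on_subset) (auto simp: C_def)
  then obtain z1 where z1: "z1 \<in> C" "\<And>y. y \<in> C \<Longrightarrow> h y \<le> h z1"
    using continuous_attains_sup[OF C] \<open>z \<in> C\<close> by (metis empty_iff)
  define M where "M = h z1"
  have M: "h y \<le> M" if "y \<in> S" for y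
    using z1 that unfolding M_def C_def by (cases "h y \<ge> \<epsilon>") auto
  have "\<epsilon> \<le> M" using z1 by (simp add: C_def M_def)
  define T where "T = {y \<in> C. h y = M}"
  have "closed T"
    unfolding T_def using \<open>continuous_on C h\<close> C by (intro continuous_closed_preimage_constant compact_imp_closed)
  moreover have "bounded T" using C compact_imp_bounded bounded_subset unfolding T_def by (metis (no_types, lifting) mem_Collect_eq subsetI)
  moreover have "z1 \<in> T" using z1 by (simp add: T_def M_def)
  moreover have "open T"
    unfolding open_contains_ball
  proof
    fix y assume y: "y \<in> T"
    then have yS: "y \<in> S" by (simp add: T_def C_def)
    then obtain d where d: "d > 0" "ball y d \<subseteq> S" using S open_contains_ball by blast
    have "K holomorphic_on ball y d" using K d holomorphic_on_subset by blast
    then obtain P where P: "\<And>x. x \<in> ball y d \<Longrightarrow> (P has_field_derivative K x) (at x)"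
      using holomorphic_convex_primitive' [of "ball y d" K] by (auto simp: at_within_open[OF _ open_ball])
    have "\<exists>c. \<forall>x\<in>ball y d. Re (P x) - h x = c"
    proof (rule has_derivative_zero_constant)
      fix x assume x: "x \<in> ball y d"
      have "((\<lambda>x. Re (P x)) has_derivative (\<lambda>v. Re (K x * v))) (at x)"
        using P[OF x] unfolding has_field_derivative_def by (rule has_derivative_Re)
      from has_derivative_diff[OF this der[of x]] show "((\<lambda>x. Re (P x) - h x) has_derivative (\<lambda>h. 0)) (at x within ball y d)"
        using x d by (simp add: has_derivative_at_withinI subset_iff)
    qed auto
    then obtain c where c: "\<And>x. x \<in> ball y d \<Longrightarrow> Re (P x) = h x + c" by (metis diff_add_cancel add.commute)
    have "P holomorphic_on ball y d" using P unfolding holomorphic_on_open[OF open_ball] by blast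
    have "(\<lambda>x. exp (P x)) constant_on ball y d"
    proof (rule maximum_modulus_principle[where U = "ball y d" and \<xi> = y])
      show "(\<lambda>x. exp (P x)) holomorphic_on ball y d"
        by (intro holomorphic_intros) fact
      fix x assume "x \<in> ball y d"
      then show "norm (exp (P x)) \<le> norm (exp (P y))"
        using c[of x] c[of y] M d y by (auto simp: T_def)
    qed (use d in auto)
    then have e: "exp (P x) = exp (P y)" if "x \<in> ball y d" for x
      using that d unfolding constant_on_def by (metis centre_in_ball)
    have "h x = M" if "x \<in> ball y d" for x
    proof -
      have "norm (exp (P x)) = norm (exp (P y))" using e[OF that] by simp
      then have "Re (P x) = Re (P y)" by simp
      then show ?thesis using c[OF that] c[of y] d y by (simp add: T_def)
    qed
    then have "ball y d \<subseteq> T" using d \<open>\<epsilon> \<le> M\<close> by (auto simp: T_def C_def)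
    then show "\<exists>e>0. ball y e \<subseteq> T" using d by blast
  qed
  ultimately have "T = UNIV" using clopen[of T] by auto
  then show False using \<open>bounded T\<close> not_bounded_UNIV by metis
qed

lemma partial_deriv_line:
  assumes "u differentiable (at (y + s *\<^sub>R a))"
  shows "((\<lambda>s. u (y + s *\<^sub>R a)) has_real_derivative partial_deriv a u (y + s *\<^sub>R a)) (at s)"
proof -
  let ?D = "frechet_derivative u (at (y + s *\<^sub>R a))"
  have D: "(u has_derivative ?D) (at (y + s *\<^sub>R a))" using assms by (simp add: frechet_derivative_works)
  have "((\<lambda>s. y + s *\<^sub>R a) has_derivative (\<lambda>h. 0 + h *\<^sub>R a)) (at s)"
    by (intro derivative_intros)
  from has_derivative_compose[OF this, of u ?D] D
  have "((\<lambda>s. u (y + s *\<^sub>R a)) has_derivative (\<lambda>h. ?D (h *\<^sub>R a))) (at s)" by simp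
  moreover have "?D (h *\<^sub>R a) = partial_deriv a u (y + s *\<^sub>R a) * h" for h
    using linear_scale[OF has_derivative_linear[OF D], of h a] by (simp add: partial_deriv_def)
  ultimately show ?thesis by (simp add: has_field_derivative_def)
qed

text \<open>The mean value theorem applied in direction \<open>a\<close> and then in direction \<open>b\<close>. The left-hand side is
  symmetric in \<open>a\<close> and \<open>b\<close>.\<close>
lemma second_difference_mvt:
  fixes u :: "'a::euclidean_space \<Rightarrow> real"
  assumes t: "t > 0" and a: "norm a = 1" and b: "norm b = 1"
    and sub: "ball x d \<subseteq> U" and td: "2 * t < d"
    and u: "\<And>y. y \<in> U \<Longrightarrow> u differentiable (at y)"
    and ua: "\<And>y. y \<in> U \<Longrightarrow> partial_deriv a u differentiable (at y)"
  obtains y where "y \<in> ball x d"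
    "u (x + t *\<^sub>R a + t *\<^sub>R b) - u (x + t *\<^sub>R a) - u (x + t *\<^sub>R b) + u x = t * t * partial_deriv b (partial_deriv a u) y"
proof -
  have inU: "x + s *\<^sub>R a + r *\<^sub>R b \<in> ball x d" if "0 \<le> s" "s \<le> t" "0 \<le> r" "r \<le> t" for s r
  proof -
    have "norm (s *\<^sub>R a + r *\<^sub>R b) \<le> s + r" using that by (intro norm_triangle_le) (simp add: a b)
    moreover have "dist (x + s *\<^sub>R a + r *\<^sub>R b) x = norm (s *\<^sub>R a + r *\<^sub>R b)"
      by (simp add: dist_norm add.assoc)
    ultimately show ?thesis using that td by (simp add: dist_commute)
  qed
  define g where "g s = u (x + s *\<^sub>R a + t *\<^sub>R b) - u (x + s *\<^sub>R a)" for s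
  have dg: "(g has_real_derivative partial_deriv a u (x + s *\<^sub>R a + t *\<^sub>R b) - partial_deriv a u (x + s *\<^sub>R a)) (at s)"
    if "0 \<le> s" "s \<le> t" for s
  proof -
    have eq: "x + t *\<^sub>R b + s *\<^sub>R a = x + s *\<^sub>R a + t *\<^sub>R b" for s by simp
    have A: "((\<lambda>s. u ((x + t *\<^sub>R b) + s *\<^sub>R a)) has_real_derivative partial_deriv a u ((x + t *\<^sub>R b) + s *\<^sub>R a)) (at s)"
      using inU[of s t] sub that t by (intro partial_deriv_line u) (auto simp: algebra_simps)
    have B: "((\<lambda>s. u (x + s *\<^sub>R a)) has_real_derivative partial_deriv a u (x + s *\<^sub>R a)) (at s)"
      using inU[of s 0] sub that t by (intro partial_deriv_line u) auto
    show ?thesis using DERIV_diff[OF A[unfolded eq] B] unfolding g_def .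
  qed
  have "\<exists>s. 0 < s \<and> s < t \<and> g t - g 0 = (t - 0) * (partial_deriv a u (x + s *\<^sub>R a + t *\<^sub>R b) - partial_deriv a u (x + s *\<^sub>R a))"
    by (intro MVT2 dg t) auto
  then obtain s where s: "0 < s" "s < t"
    "g t - g 0 = t * (partial_deriv a u (x + s *\<^sub>R a + t *\<^sub>R b) - partial_deriv a u (x + s *\<^sub>R a))" by auto
  have "\<exists>r. 0 < r \<and> r < t \<and> partial_deriv a u (x + s *\<^sub>R a + t *\<^sub>R b) - partial_deriv a u (x + s *\<^sub>R a + 0 *\<^sub>R b)
     = (t - 0) * partial_deriv b (partial_deriv a u) (x + s *\<^sub>R a + r *\<^sub>R b)"
    using inU s sub by (intro MVT2 t partial_deriv_line ua) auto
  then obtain r where r: "0 < r" "r < t" "partial_deriv a u (x + s *\<^sub>R a + t *\<^sub>R b) - partial_deriv a u (x + s *\<^sub>R a)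
     = t * partial_deriv b (partial_deriv a u) (x + s *\<^sub>R a + r *\<^sub>R b)" by auto
  show ?thesis
  proof (rule that)
    show "x + s *\<^sub>R a + r *\<^sub>R b \<in> ball x d" using inU s r by auto
    show "u (x + t *\<^sub>R a + t *\<^sub>R b) - u (x + t *\<^sub>R a) - u (x + t *\<^sub>R b) + u x
      = t * t * partial_deriv b (partial_deriv a u) (x + s *\<^sub>R a + r *\<^sub>R b)"
      using s(3) unfolding r(3) by (simp add: g_def)
  qed
qed

text \<open>Both mixed derivatives are limits of the same symmetric second difference quotient.\<close>
lemma C2_mixed_partials_commute:
  fixes u :: "'a::euclidean_space \<Rightarrow> real"
  assumes C2: "C2_on U u" and U: "open U" and x: "x \<in> U" and a: "a \<in> Basis" and b: "b \<in> Basis"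
  shows "partial_deriv b (partial_deriv a u) x = partial_deriv a (partial_deriv b u) x"
proof (rule ccontr)
  let ?A = "partial_deriv b (partial_deriv a u)" and ?B = "partial_deriv a (partial_deriv b u)"
  assume ne: "?A x \<noteq> ?B x"
  define \<epsilon> where "\<epsilon> = \<bar>?A x - ?B x\<bar> / 2"
  have ep: "\<epsilon> > 0" using ne by (simp add: \<epsilon>_def)
  have dif: "\<And>y. y \<in> U \<Longrightarrow> u differentiable (at y)"
    "\<And>y. y \<in> U \<Longrightarrow> partial_deriv a u differentiable (at y)"
    "\<And>y. y \<in> U \<Longrightarrow> partial_deriv b u differentiable (at y)"
    and cA: "continuous_on U ?A" and cB: "continuous_on U ?B"
    using C2 a b by (auto simp: C2_on_def C1_on_def)
  have "isCont ?A x" "isCont ?B x" using cA cB U x continuous_on_eq_continuous_at by blast+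
  then have ex: "\<exists>d>0. \<forall>y. dist y x < d \<longrightarrow> dist (?A y) (?A x) < \<epsilon>" "\<exists>d>0. \<forall>y. dist y x < d \<longrightarrow> dist (?B y) (?B x) < \<epsilon>"
    unfolding continuous_at_eps_delta using ep by simp_all
  obtain d1 where d1: "d1 > 0" "\<And>y. dist y x < d1 \<Longrightarrow> dist (?A y) (?A x) < \<epsilon>" using ex(1) by auto
  obtain d2 where d2: "d2 > 0" "\<And>y. dist y x < d2 \<Longrightarrow> dist (?B y) (?B x) < \<epsilon>" using ex(2) by auto
  obtain d3 where d3: "d3 > 0" "ball x d3 \<subseteq> U" using U x open_contains_ball by blast
  define d where "d = min d1 (min d2 d3)"
  have d: "d > 0" "ball x d \<subseteq> U" using d1 d2 d3 by (auto simp: d_def)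
  define t where "t = d/3"
  have t: "t > 0" "2 * t < d" using d by (auto simp: t_def)
  obtain y where y: "y \<in> ball x d"
    "u (x + t *\<^sub>R a + t *\<^sub>R b) - u (x + t *\<^sub>R a) - u (x + t *\<^sub>R b) + u x = t * t * ?A y"
    by (rule second_difference_mvt[OF t(1) _ _ d(2) t(2) dif(1,2)]) (use a b in auto)
  obtain y' where y': "y' \<in> ball x d"
    "u (x + t *\<^sub>R b + t *\<^sub>R a) - u (x + t *\<^sub>R b) - u (x + t *\<^sub>R a) + u x = t * t * ?B y'"
    by (rule second_difference_mvt[OF t(1) _ _ d(2) t(2) dif(1,3)]) (use a b in auto)
  have eq: "x + t *\<^sub>R b + t *\<^sub>R a = x + t *\<^sub>R a + t *\<^sub>R b" by simp
  have "t * t * ?A y = t * t * ?B y'" using y(2) y'(2) unfolding eq by linarith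
  then have "?A y = ?B y'" using t by simp
  moreover have "\<bar>?A y - ?A x\<bar> < \<epsilon>" using d1(2)[of y] y by (simp add: d_def dist_commute dist_real_def)
  moreover have "\<bar>?B y' - ?B x\<bar> < \<epsilon>" using d2(2)[of y'] y' by (simp add: d_def dist_commute dist_real_def)
  ultimately have "\<bar>?A x - ?B x\<bar> < 2 * \<epsilon>" by linarith
  then show False by (simp add: \<epsilon>_def)
qed

text \<open>The plane occurs as \<open>real^2\<close>, where the boundary value problem and measure theory live, and as
  \<open>complex\<close>, where conformal maps live. The two isometries convert between them.\<close>
definition c2v :: "complex \<Rightarrow> real^2" where "c2v z = Re z *\<^sub>R axis 1 1 + Im z *\<^sub>R axis 2 1"
definition v2c :: "real^2 \<Rightarrow> complex" where "v2c x = Complex (x $ 1) (x $ 2)"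

lemma c2v_nth [simp]: "c2v z $ 1 = Re z" "c2v z $ 2 = Im z"
  by (simp_all add: c2v_def axis_def)

lemma v2c_c2v [simp]: "v2c (c2v z) = z" by (simp add: v2c_def complex_eq_iff)
lemma c2v_v2c [simp]: "c2v (v2c x) = x" by (simp add: vec_eq_iff forall_2 v2c_def)
lemma Re_v2c [simp]: "Re (v2c x) = x $ 1" and Im_v2c [simp]: "Im (v2c x) = x $ 2" by (simp_all add: v2c_def)
lemma c2v_eq_iff [simp]: "c2v z = c2v w \<longleftrightarrow> z = w" by (metis v2c_c2v)
lemma v2c_eq_iff [simp]: "v2c z = v2c w \<longleftrightarrow> z = w" by (metis c2v_v2c)

lemma c2v_add: "c2v (z + w) = c2v z + c2v w" and c2v_scaleR: "c2v (r *\<^sub>R z) = r *\<^sub>R c2v z"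
  and c2v_diff: "c2v (z - w) = c2v z - c2v w"
  by (simp_all add: vec_eq_iff forall_2)
lemma v2c_add: "v2c (x + y) = v2c x + v2c y" and v2c_scaleR: "v2c (r *\<^sub>R x) = r *\<^sub>R v2c x"
  and v2c_diff: "v2c (x - y) = v2c x - v2c y"
  by (simp_all add: complex_eq_iff)

lemma norm_c2v [simp]: "norm (c2v z) = norm z"
  by (simp add: norm_vec_def L2_set_def sum_2 cmod_def)
lemma norm_v2c [simp]: "norm (v2c x) = norm x" by (metis c2v_v2c norm_c2v)
lemma dist_c2v [simp]: "dist (c2v z) (c2v w) = dist z w" by (simp add: dist_norm flip: c2v_diff)
lemma dist_v2c [simp]: "dist (v2c z) (v2c w) = dist z w" by (simp add: dist_norm flip: v2c_diff)
lemma inner_c2v: "c2v z \<bullet> c2v w = z \<bullet> w" by (simp add: inner_vec_def sum_2 inner_complex_def)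

lemma bounded_linear_c2v: "bounded_linear c2v"
  by (rule bounded_linear_intro[where K = 1]) (simp_all add: c2v_add c2v_scaleR)
lemma bounded_linear_v2c: "bounded_linear v2c"
  by (rule bounded_linear_intro[where K = 1]) (simp_all add: v2c_add v2c_scaleR)
lemmas c2v_derivative [derivative_intros] = bounded_linear.has_derivative[OF bounded_linear_c2v]
lemma continuous_on_c2v [continuous_intros]: "continuous_on S f \<Longrightarrow> continuous_on S (\<lambda>x. c2v (f x))"
  by (rule bounded_linear.continuous_on[OF bounded_linear_c2v])
lemma continuous_on_v2c [continuous_intros]: "continuous_on S f \<Longrightarrow> continuous_on S (\<lambda>x. v2c (f x))"
  by (rule bounded_linear.continuous_on[OF bounded_linear_v2c])

lemma Basis_real2: "Basis = {axis 1 1, axis 2 (1::real) :: real^2}"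
  by (auto simp: Basis_vec_def UNIV_2)

text \<open>The complex gradient \<open>u\<^sub>x - \<i> u\<^sub>y\<close>, which is twice the Wirtinger derivative \<open>\<partial>u / \<partial>z\<close>.\<close>
definition cgrad :: "(real^2 \<Rightarrow> real) \<Rightarrow> complex \<Rightarrow> complex" where
  "cgrad u z = Complex (partial_deriv (axis 1 1) u (c2v z)) (- partial_deriv (axis 2 1) u (c2v z))"

lemma cgrad_derivative:
  assumes "u differentiable (at (c2v z))"
  shows "((\<lambda>z. u (c2v z)) has_derivative (\<lambda>v. Re (cgrad u z * v))) (at z)"
proof -
  let ?D = "frechet_derivative u (at (c2v z))"
  have D: "(u has_derivative ?D) (at (c2v z))" using assms by (simp add: frechet_derivative_works)
  have "((\<lambda>z. u (c2v z)) has_derivative (\<lambda>v. ?D (c2v v))) (at z)"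
    using has_derivative_compose[OF bounded_linear_imp_has_derivative[OF bounded_linear_c2v], of u ?D z UNIV] D by simp
  moreover have "?D (c2v v) = Re (cgrad u z * v)" for v
    using has_derivative_linear[OF D]
    by (simp add: c2v_def[of v] linear_add linear_scale cgrad_def partial_deriv_def)
  ultimately show ?thesis by simp
qed

text \<open>The Cauchy-Riemann equations of \<open>u\<^sub>x - \<i> u\<^sub>y\<close> are the Laplace equation and the symmetry of
  the second derivatives.\<close>
lemma cgrad_holomorphic:
  fixes u :: "real^2 \<Rightarrow> real"
  assumes C2: "C2_on U u" and U: "open U" and lap: "\<And>x. x \<in> U \<Longrightarrow> laplacian u x = 0"
  shows "cgrad u holomorphic_on c2v -` U"
proof -
  let ?a = "axis 1 1 :: real^2" and ?b = "axis 2 1 :: real^2"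
  have ab: "?a \<noteq> ?b" by (simp add: axis_eq_axis)
  have "\<exists>f'. (cgrad u has_field_derivative f') (at z)" if z: "c2v z \<in> U" for z
  proof -
    let ?p = "partial_deriv ?a u" and ?q = "partial_deriv ?b u"
    have dp: "?p differentiable (at (c2v z))" and dq: "?q differentiable (at (c2v z))"
      using C2 z by (auto simp: C2_on_def C1_on_def Basis_real2)
    have sym: "partial_deriv ?b ?p (c2v z) = partial_deriv ?a ?q (c2v z)"
      by (rule C2_mixed_partials_commute[OF C2 U z]) (auto simp: Basis_real2)
    have "partial_deriv ?a ?p (c2v z) + partial_deriv ?b ?q (c2v z) = 0"
      using lap[OF z] ab by (simp add: laplacian_def Basis_real2)
    then have lp: "partial_deriv ?b ?q (c2v z) = - partial_deriv ?a ?p (c2v z)" by simp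
    have "((\<lambda>z. complex_of_real (?p (c2v z)) - \<i> * complex_of_real (?q (c2v z))) has_derivative
        (\<lambda>v. complex_of_real (Re (cgrad ?p z * v)) - \<i> * complex_of_real (Re (cgrad ?q z * v)))) (at z)"
      by (intro derivative_intros cgrad_derivative dp dq)
    moreover have "(\<lambda>v. complex_of_real (Re (cgrad ?p z * v)) - \<i> * complex_of_real (Re (cgrad ?q z * v)))
       = (*) (Complex (partial_deriv ?a ?p (c2v z)) (- partial_deriv ?a ?q (c2v z)))"
      by (auto simp: fun_eq_iff complex_eq_iff cgrad_def sym lp)
    moreover have "(\<lambda>z. complex_of_real (?p (c2v z)) - \<i> * complex_of_real (?q (c2v z))) = cgrad u"
      by (auto simp: fun_eq_iff complex_eq_iff cgrad_def)
    ultimately show ?thesis unfolding has_field_derivative_def by auto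
  qed
  moreover have "open (c2v -` U)"
    using U by (intro open_vimage continuous_on_c2v continuous_on_id)
  ultimately show ?thesis by (auto simp: holomorphic_on_open)
qed

section \<open>The conformal map onto the exterior of a compact set\<close>

lemma connected_delete_interior_point:
  fixes A :: "'a::euclidean_space set"
  assumes A: "connected A" and a: "a \<in> interior A" and dim: "2 \<le> DIM('a)"
  shows "connected (A - {a})"
proof (rule connectedI)
  fix E1 E2 :: "'a set"
  assume E: "open E1" "open E2" "E1 \<inter> (A - {a}) \<noteq> {}" "E2 \<inter> (A - {a}) \<noteq> {}"
    "E1 \<inter> E2 \<inter> (A - {a}) = {}" "A - {a} \<subseteq> E1 \<union> E2"
  obtain r where r: "r > 0" "ball a r \<subseteq> A" using a mem_interior by blast
  have con: "connected (ball a r - {a})"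
    using dim by (intro connected_open_delete) auto
  have sub: "ball a r - {a} \<subseteq> A - {a}" using r by auto
  have False if E: "open E1" "open E2" "E1 \<inter> (A - {a}) \<noteq> {}" "E2 \<inter> (A - {a}) \<noteq> {}"
    "E1 \<inter> E2 \<inter> (A - {a}) = {}" "A - {a} \<subseteq> E1 \<union> E2" and in1: "E2 \<inter> (ball a r - {a}) = {}" for E1 E2
  proof -
    let ?F1 = "E1 \<union> ball a r" and ?F2 = "E2 - {a}"
    have "?F1 \<inter> ?F2 \<inter> A = {}" using E(5) in1 by auto
    moreover have "A \<subseteq> ?F1 \<union> ?F2" using E(6) r by auto
    moreover have "?F1 \<inter> A \<noteq> {}" "?F2 \<inter> A \<noteq> {}" using E by auto
    moreover have "open ?F1" "open ?F2" using E by auto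
    ultimately show False using connectedD[OF A, of ?F1 ?F2] by blast
  qed
  moreover have "E1 \<inter> (ball a r - {a}) = {} \<or> E2 \<inter> (ball a r - {a}) = {}"
    using connectedD[OF con E(1,2)] E(5,6) sub by blast
  ultimately show False using E by (metis Int_commute Un_commute)
qed

text \<open>The inversion \<open>z \<mapsto> 1 / (z - a)\<close> turns the exterior of \<open>A\<close> together with infinity into a bounded open
  set \<open>W\<close> containing \<open>0\<close>. It is simply connected because its complement is the image of the connected
  set \<open>A - {a}\<close>. The maps \<open>\<phi>\<close> and \<open>\<psi>\<close> come from the Riemann mapping theorem for \<open>W\<close>, normalised so
  that \<open>\<phi> 0 = 0\<close>.\<close>
lemma exterior_uniformization:
  fixes A :: "complex set"
  assumes A: "compact A" "connected A" "connected (- A)" and a: "a \<in> interior A"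
  obtains \<phi> \<psi> where "\<phi> holomorphic_on ball 0 1" "\<phi> 0 = 0" "\<psi> holomorphic_on - A"
    "\<And>w. w \<in> ball 0 1 \<Longrightarrow> w \<noteq> 0 \<Longrightarrow> \<phi> w \<noteq> 0 \<and> a + 1 / \<phi> w \<notin> A \<and> \<psi> (a + 1 / \<phi> w) = w"
    "\<And>z. z \<notin> A \<Longrightarrow> \<psi> z \<in> ball 0 1 \<and> \<psi> z \<noteq> 0 \<and> a + 1 / \<phi> (\<psi> z) = z"
proof -
  define i where "i z = 1 / (z - a)" for z
  define W where "W = insert 0 (i ` (- A))"
  have aA: "a \<in> A" using a interior_subset by blast
  obtain r where r: "r > 0" "ball a r \<subseteq> A" using a mem_interior by blast
  obtain B where B: "B > 0" "A \<subseteq> ball a B"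
    using compact_imp_bounded[OF A(1)] bounded_subset_ballD[of A a] by auto
  have memW: "w \<in> W \<longleftrightarrow> w = 0 \<or> a + 1 / w \<notin> A" for w
  proof
    assume "w \<in> W" then show "w = 0 \<or> a + 1 / w \<notin> A"
      unfolding W_def i_def using aA by (auto simp: field_simps)
  next
    assume "w = 0 \<or> a + 1 / w \<notin> A"
    then show "w \<in> W"
    proof
      assume "a + 1 / w \<notin> A"
      then have "a + 1/w \<in> - A" by simp
      moreover have "w = i (a + 1 / w)" by (simp add: i_def)
      ultimately show ?thesis unfolding W_def by blast
    qed (simp add: W_def)
  qed
  have ballW: "ball 0 (1/B) \<subseteq> W"
  proof
    fix w :: complex assume w: "w \<in> ball 0 (1/B)"
    show "w \<in> W"
    proof (cases "w = 0")
      case False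
      then have "norm (1 / w) > B" using w B by (simp add: norm_divide field_simps)
      then have "a + 1 / w \<notin> ball a B" by (simp add: dist_norm)
      then show ?thesis using B memW by blast
    qed (simp add: memW)
  qed
  have Weq: "W = ((- {0}) \<inter> (\<lambda>w. a + 1 / w) -` (- A)) \<union> ball 0 (1/B)"
    using memW ballW B by auto
  have oW: "open W"
    unfolding Weq using compact_imp_closed[OF A(1)]
    by (intro open_Un continuous_open_preimage continuous_intros) auto
  have bW: "bounded W"
  proof (rule bounded_subset[OF bounded_cball])
    show "W \<subseteq> cball 0 (1/r)"
    proof
      fix w assume w: "w \<in> W"
      show "w \<in> cball 0 (1/r)"
      proof (cases "w = 0")
        case False
        then have "a + 1 / w \<notin> ball a r" using w memW r by blast
        then have "norm (1 / w) \<ge> r" by (simp add: dist_norm)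
        then show ?thesis using False r by (simp add: norm_divide field_simps)
      qed (use r in auto)
    qed
  qed
  have conti: "continuous_on (- {a}) i" unfolding i_def by (intro continuous_intros) auto
  have conW: "connected W"
  proof (rule connected_intermediate_closure)
    show "connected (i ` (- A))"
      using A(3) aA by (intro connected_continuous_image continuous_on_subset[OF conti]) auto
    show "i ` (- A) \<subseteq> W" by (auto simp: W_def)
    have "0 \<in> closure (i ` (- A))"
      unfolding closure_approachable
    proof (intro allI impI)
      fix e :: real assume e: "e > 0"
      define t where "t = min (1/B) e / 2"
      define w where "w = complex_of_real t"
      have "1/B > 0" using B by simp
      then have "min (1/B) e > 0" "min (1/B) e \<le> 1/B" "min (1/B) e \<le> e" using e by auto
      moreover have "0 < M / 2 \<and> M / 2 < x \<and> M / 2 < y" if "M > 0" "M \<le> x" "M \<le> y" for M x y :: real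
        using that by auto
      ultimately have "t > 0" "t < 1/B" "t < e" unfolding t_def by blast+
      then have w: "norm w < 1/B" "norm w < e" "w \<noteq> 0" by (auto simp: w_def)
      then have "w \<in> W" using ballW by auto
      then have "w \<in> i ` (- A)" using w by (simp add: W_def)
      then show "\<exists>y\<in>i ` (- A). dist y 0 < e" using w by (intro bexI[of _ w]) auto
    qed
    then show "W \<subseteq> closure (i ` (- A))" unfolding W_def using closure_subset[of "i ` (- A)"] by simp
  qed
  have "- W = i ` (A - {a})"
  proof (intro equalityI subsetI)
    fix w assume "w \<in> - W"
    then have "w \<noteq> 0" "a + 1 / w \<in> A" using memW by auto
    moreover have "w = i (a + 1 / w)" by (simp add: i_def)
    ultimately show "w \<in> i ` (A - {a})" by (metis DiffI add_cancel_left_right divide_eq_0_iff imageI one_neq_zero singletonD)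
  next
    fix w assume "w \<in> i ` (A - {a})"
    then obtain z where "z \<in> A" "z \<noteq> a" "w = i z" by auto
    then show "w \<in> - W" by (simp add: memW i_def)
  qed
  moreover have "connected (i ` (A - {a}))"
  proof (rule connected_continuous_image)
    show "connected (A - {a})" by (rule connected_delete_interior_point[OF A(2) a]) simp
  qed (auto intro: continuous_on_subset[OF conti])
  ultimately have "connected (- W)" by simp
  then have "simply_connected W" using simply_connected_iff_simple[OF oW bW] conW by blast
  moreover have "W \<noteq> {}" by (simp add: W_def)
  moreover have "W \<noteq> UNIV" using bW not_bounded_UNIV by auto
  ultimately obtain f g where fg: "f holomorphic_on W" "g holomorphic_on ball 0 1"
    "\<And>z. z \<in> W \<Longrightarrow> f z \<in> ball 0 1 \<and> g (f z) = z" "\<And>z. z \<in> ball 0 1 \<Longrightarrow> g z \<in> W \<and> f (g z) = z"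
    using Riemann_mapping_theorem[of W] oW by blast
  have W0: "0 \<in> W" by (simp add: W_def)
  have f0: "f 0 \<in> ball 0 1" using fg W0 by blast
  obtain m k where mk: "m (f 0) = 0"
                "m holomorphic_on ball 0 1" "m ` ball 0 1 \<subseteq> ball 0 1"
                "k holomorphic_on ball 0 1" "k ` ball 0 1 \<subseteq> ball 0 1"
                "\<And>z. z \<in> ball 0 1 \<Longrightarrow> m (k z) = z"
                "\<And>z. z \<in> ball 0 1 \<Longrightarrow> k (m z) = z"
    using ball_biholomorphism_exists[OF f0] by metis
  define \<phi> where "\<phi> w = g (k w)" for w
  define \<psi> where "\<psi> z = m (f (i z))" for z
  have k0: "k 0 = f 0" using mk f0 by metis
  have kb: "k w \<in> ball 0 1" if "w \<in> ball 0 1" for w using mk that by blast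
  have fb: "f w \<in> ball 0 1" if "w \<in> W" for w using fg that by blast
  have mb: "m w \<in> ball 0 1" if "w \<in> ball 0 1" for w using mk that by blast
  have iW: "i z \<in> W" if "z \<notin> A" for z using that by (simp add: W_def)
  have inv: "m (f (\<phi> w)) = w" if "w \<in> ball 0 1" for w
    using fg(4)[OF kb[OF that]] mk(6)[OF that] by (simp add: \<phi>_def)
  show ?thesis
  proof (rule that)
    show "\<phi> holomorphic_on ball 0 1"
      unfolding \<phi>_def using holomorphic_on_compose_gen[OF mk(4) fg(2) mk(5)] by (simp add: o_def)
    show phi0: "\<phi> 0 = 0" using k0 fg W0 by (simp add: \<phi>_def)
    have "i holomorphic_on - A" unfolding i_def using aA by (intro holomorphic_intros) auto
    from holomorphic_on_compose_gen[OF this fg(1)] iW have "(f \<circ> i) holomorphic_on - A" by auto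
    moreover have "(f \<circ> i) ` (- A) \<subseteq> ball 0 1" using iW fb by fastforce
    ultimately show "\<psi> holomorphic_on - A"
      using holomorphic_on_compose_gen[OF _ mk(2)] unfolding \<psi>_def by (fastforce simp: o_def)
    show "\<phi> w \<noteq> 0 \<and> a + 1 / \<phi> w \<notin> A \<and> \<psi> (a + 1 / \<phi> w) = w" if w: "w \<in> ball 0 1" "w \<noteq> 0" for w
    proof -
      have n0: "\<phi> w \<noteq> 0" using inv[OF w(1)] inv[of 0] phi0 w(2) by auto
      have "\<phi> w \<in> W" using fg kb[OF w(1)] by (simp add: \<phi>_def)
      then have "a + 1 / \<phi> w \<notin> A" using memW n0 by blast
      moreover have "\<psi> (a + 1 / \<phi> w) = w" using inv[OF w(1)] by (simp add: \<psi>_def i_def)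
      ultimately show ?thesis using n0 by blast
    qed
    show "\<psi> z \<in> ball 0 1 \<and> \<psi> z \<noteq> 0 \<and> a + 1 / \<phi> (\<psi> z) = z" if z: "z \<notin> A" for z
    proof -
      have za: "z \<noteq> a" using z aA by blast
      have e: "\<phi> (\<psi> z) = i z"
        using mk(7)[OF fb[OF iW[OF z]]] fg(3)[OF iW[OF z]] by (simp add: \<phi>_def \<psi>_def)
      have "\<psi> z \<noteq> 0" using e phi0 za by (auto simp: i_def)
      moreover have "\<psi> z \<in> ball 0 1" using mb[OF fb[OF iW[OF z]]] by (simp add: \<psi>_def)
      ultimately show ?thesis using e za by (simp add: i_def)
    qed
  qed
qed

text \<open>The conformal map itself has a pole at \<open>0\<close>; it is represented by the holomorphic function \<open>\<phi>\<close>,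
  the reciprocal of \<open>F w - a\<close>.\<close>
locale exterior_map =
  fixes A :: "complex set" and a :: complex and \<phi> \<psi> :: "complex \<Rightarrow> complex"
  assumes cA: "compact A" and hol_phi: "\<phi> holomorphic_on ball 0 1" and phi_0: "\<phi> 0 = 0"
    and hol_psi: "\<psi> holomorphic_on - A"
    and FA: "\<And>w. w \<in> ball 0 1 \<Longrightarrow> w \<noteq> 0 \<Longrightarrow> \<phi> w \<noteq> 0 \<and> a + 1 / \<phi> w \<notin> A \<and> \<psi> (a + 1 / \<phi> w) = w"
    and AF: "\<And>z. z \<notin> A \<Longrightarrow> \<psi> z \<in> ball 0 1 \<and> \<psi> z \<noteq> 0 \<and> a + 1 / \<phi> (\<psi> z) = z"
begin

definition F :: "complex \<Rightarrow> complex" where "F w = a + 1 / \<phi> w"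
definition q :: "complex \<Rightarrow> complex" where "q w = (if w = 0 then deriv \<phi> 0 else \<phi> w / w)"
text \<open>This is \<open>- w\<^sup>2 F' w\<close>, written so that the singularity at \<open>0\<close> is removed.\<close>
definition \<kappa> :: "complex \<Rightarrow> complex" where "\<kappa> w = deriv \<phi> w / (q w)\<^sup>2"
text \<open>The coefficient of \<open>1 / w\<close> in the expansion of \<open>F\<close>. Its modulus is the logarithmic capacity of \<open>A\<close>.\<close>
definition cap :: complex where "cap = 1 / deriv \<phi> 0"
text \<open>The regular part of \<open>F\<close>, which is a difference quotient of \<open>1 / q\<close>.\<close>
definition B :: "complex \<Rightarrow> complex" where
  "B w = (if w = 0 then deriv (\<lambda>w. 1 / q w) 0 else (1 / q w - 1 / q 0) / w)"

lemma inj_phi: "inj_on \<phi> (ball 0 1)"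
proof (rule inj_onI)
  fix x y assume xy: "x \<in> ball 0 1" "y \<in> ball 0 1" "\<phi> x = \<phi> y"
  show "x = y" using FA[OF xy(1)] FA[OF xy(2)] xy(3) phi_0 by metis
qed

lemma dphi_nz: "w \<in> ball 0 1 \<Longrightarrow> deriv \<phi> w \<noteq> 0"
  using holomorphic_injective_imp_regular[OF hol_phi open_ball inj_phi] by blast

lemma q_hol: "q holomorphic_on ball 0 1"
proof -
  have "(\<lambda>z. if z = 0 then deriv \<phi> 0 else \<phi> z / z - \<phi> 0 / (z - 0)) holomorphic_on ball 0 1"
    by (rule pole_theorem[OF hol_phi]) auto
  moreover have "(\<lambda>z. if z = 0 then deriv \<phi> 0 else \<phi> z / z - \<phi> 0 / (z - 0)) = q"
    by (auto simp: fun_eq_iff q_def phi_0)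
  ultimately show ?thesis by simp
qed

lemma q_nz: "w \<in> ball 0 1 \<Longrightarrow> q w \<noteq> 0"
  using dphi_nz[of 0] FA by (auto simp: q_def)

lemma kap_hol: "\<kappa> holomorphic_on ball 0 1"
  unfolding \<kappa>_def using q_nz by (intro holomorphic_intros holomorphic_deriv hol_phi q_hol) auto

lemma kap_nz: "w \<in> ball 0 1 \<Longrightarrow> \<kappa> w \<noteq> 0"
  using q_nz dphi_nz by (auto simp: \<kappa>_def)

lemma kap_0: "\<kappa> 0 = cap" using dphi_nz[of 0] by (simp add: \<kappa>_def q_def cap_def power2_eq_square)

lemma cap_nz: "cap \<noteq> 0" using dphi_nz[of 0] by (simp add: cap_def)

lemma B_hol: "B holomorphic_on ball 0 1"
proof -
  have "(\<lambda>w. 1 / q w) holomorphic_on ball 0 1"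
    using q_nz by (intro holomorphic_intros q_hol) auto
  then have "(\<lambda>z. if z = 0 then deriv (\<lambda>w. 1 / q w) 0 else (1 / q z) / z - (1 / q 0) / (z - 0)) holomorphic_on ball 0 1"
    by (rule pole_theorem) auto
  moreover have "(\<lambda>z. if z = 0 then deriv (\<lambda>w. 1 / q w) 0 else (1 / q z) / z - (1 / q 0) / (z - 0)) = B"
    by (auto simp: fun_eq_iff B_def diff_divide_distrib)
  ultimately show ?thesis by simp
qed

lemma F_expand: "w \<in> ball 0 1 \<Longrightarrow> w \<noteq> 0 \<Longrightarrow> F w = a + cap / w + B w"
  using FA[of w] dphi_nz[of 0] by (simp add: F_def B_def q_def cap_def field_simps)

lemma F_notin: "w \<in> ball 0 1 \<Longrightarrow> w \<noteq> 0 \<Longrightarrow> F w \<notin> A" using FA by (simp add: F_def)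
lemma psi_F: "w \<in> ball 0 1 \<Longrightarrow> w \<noteq> 0 \<Longrightarrow> \<psi> (F w) = w" using FA by (simp add: F_def)
lemma F_psi: "z \<notin> A \<Longrightarrow> F (\<psi> z) = z" using AF by (simp add: F_def)

lemma F_deriv:
  assumes w: "w \<in> ball 0 1" "w \<noteq> 0"
  shows "(F has_field_derivative - \<kappa> w / w\<^sup>2) (at w)"
proof -
  have n: "\<phi> w \<noteq> 0" using FA w by blast
  have d: "(\<phi> has_field_derivative deriv \<phi> w) (at w)"
    using hol_phi w by (intro holomorphic_derivI[OF _ open_ball])
  have "((\<lambda>w. a + 1 / \<phi> w) has_field_derivative - deriv \<phi> w / (\<phi> w)\<^sup>2) (at w)"
    by (rule derivative_eq_intros refl d n | use n in \<open>simp add: power2_eq_square\<close>)+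
  moreover have "- deriv \<phi> w / (\<phi> w)\<^sup>2 = - \<kappa> w / w\<^sup>2"
    using w n by (simp add: \<kappa>_def q_def field_simps)
  ultimately show ?thesis unfolding F_def[abs_def] by simp
qed

lemma F_hol: "F holomorphic_on ball 0 1 - {0}"
  unfolding holomorphic_on_open[OF open_delete[OF open_ball]] using F_deriv by blast

text \<open>As \<open>w\<close> approaches the circle, \<open>F w\<close> leaves every compact subset of the exterior, because the compact
  image \<open>\<psi> ` Q\<close> stays away from the circle.\<close>
lemma F_proper:
  assumes "compact Q" "Q \<subseteq> - A"
  obtains \<rho> where "0 < \<rho>" "\<rho> < 1" "\<And>w. \<rho> < norm w \<Longrightarrow> norm w < 1 \<Longrightarrow> F w \<notin> Q"
proof -
  have "compact (\<psi> ` Q)"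
    by (rule compact_continuous_image[OF continuous_on_subset[OF holomorphic_on_imp_continuous_on[OF hol_psi] assms(2)] assms(1)])
  then have "compact (norm ` \<psi> ` Q)" by (rule compact_continuous_image[rotated]) (intro continuous_intros)
  then have "compact (insert (1/2) (norm ` \<psi> ` Q))" by simp
  then obtain m where m: "m \<in> insert (1/2) (norm ` \<psi> ` Q)" "\<And>y. y \<in> insert (1/2) (norm ` \<psi> ` Q) \<Longrightarrow> y \<le> m"
    using compact_attains_sup by (metis insert_not_empty)
  have "m < 1" using m(1) AF assms(2) by (auto simp: subset_iff)
  moreover have "m \<ge> 1/2" using m(2)[of "1/2"] by simp
  ultimately show ?thesis
  proof (rule_tac that[of m])
    fix w :: complex assume w: "m < norm w" "norm w < 1"
    show "F w \<notin> Q"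
    proof
      assume "F w \<in> Q"
      then have "norm (\<psi> (F w)) \<le> m" using m(2) by auto
      moreover have "w \<noteq> 0" using w \<open>m \<ge> 1/2\<close> by auto
      ultimately show False using psi_F[of w] w by auto
    qed
  qed auto
qed

text \<open>By the open mapping theorem \<open>\<phi>\<close> covers a disc around \<open>0\<close> with small values of \<open>w\<close> alone, so \<open>\<phi>\<close> is
  bounded away from \<open>0\<close> elsewhere.\<close>
lemma F_bounded:
  obtains R where "R > 0" "\<And>w. 1/2 \<le> norm w \<Longrightarrow> norm w < 1 \<Longrightarrow> norm (F w) \<le> R"
proof -
  have "open (\<phi> ` ball 0 (1/2))"
    using hol_phi inj_phi by (intro open_mapping_thm3 holomorphic_on_subset[OF hol_phi] inj_on_subset[OF inj_phi]) auto
  moreover have "0 \<in> \<phi> ` ball 0 (1/2)" using phi_0 by (intro image_eqI[of _ _ 0]) auto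
  ultimately obtain s where s: "s > 0" "ball 0 s \<subseteq> \<phi> ` ball 0 (1/2)" using open_contains_ball by blast
  show ?thesis
  proof (rule that[of "norm a + 1/s"])
    fix w :: complex assume w: "1/2 \<le> norm w" "norm w < 1"
    have "\<phi> w \<notin> ball 0 s"
    proof
      assume "\<phi> w \<in> ball 0 s"
      then obtain v where v: "v \<in> ball 0 (1/2)" "\<phi> w = \<phi> v" using s by blast
      then have "w = v" using inj_phi w by (auto simp: inj_on_def)
      then show False using v w by auto
    qed
    then have "norm (1 / \<phi> w) \<le> 1 / s" using s frac_le[of 1 1 s "norm (\<phi> w)"] by (simp add: norm_divide)
    then show "norm (F w) \<le> norm a + 1/s" unfolding F_def by (intro norm_triangle_le) simp
  qed (use s in \<open>auto intro: add_nonneg_pos\<close>)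
qed
end

section \<open>The Green function with pole at infinity\<close>

lemma ln_norm_derivative:
  fixes w :: complex
  assumes "w \<noteq> 0"
  shows "((\<lambda>w. ln (norm w)) has_derivative (\<lambda>v. Re (1 / w * v))) (at w)"
proof -
  have l: "(ln has_derivative (\<lambda>h. inverse (norm w) * h)) (at (norm w))"
    using DERIV_ln[of "norm w"] assms by (simp add: has_field_derivative_def)
  have "((\<lambda>w. ln (norm w)) has_derivative (\<lambda>v. inverse (norm w) * (v \<bullet> sgn w))) (at w)"
    using has_derivative_compose[OF has_derivative_norm[OF assms] l] by (simp add: inner_commute)
  moreover have "inverse (norm w) * (v \<bullet> sgn w) = Re (1 / w * v)" for v
  proof -
    have "complex_of_real ((norm w)\<^sup>2) = w * cnj w" by (rule complex_norm_square)
    then have "1 / w = cnj w / complex_of_real ((norm w)\<^sup>2)" using assms by simp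
    then have "1 / w * v = (cnj w * v) / complex_of_real ((norm w)\<^sup>2)" by simp
    then have "Re (1 / w * v) = (Re w * Re v + Im w * Im v) / (norm w)\<^sup>2"
      by (simp only: Re_divide_of_real) simp
    moreover have "v \<bullet> sgn w = (Re w * Re v + Im w * Im v) / norm w"
      using assms by (simp add: sgn_div_norm inner_complex_def divide_inverse algebra_simps)
    ultimately show ?thesis by (simp add: divide_inverse power2_eq_square)
  qed
  ultimately show ?thesis by simp
qed

context exterior_map begin

text \<open>Where \<open>h\<close> is not close to \<open>1\<close>, the bounded part of the exterior is compact, and \<open>F w\<close> leaves it as
  \<open>w\<close> approaches the circle.\<close>
lemma near_circle:
  fixes h :: "complex \<Rightarrow> real"
  assumes cont: "continuous_on (closure (- A)) h" and bd: "\<And>z. z \<in> frontier A \<Longrightarrow> h z = 1" and \<eta>: "\<eta> > 0"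
  obtains \<rho> where "1/2 \<le> \<rho>" "\<rho> < 1" "\<And>w. \<rho> < norm w \<Longrightarrow> norm w < 1 \<Longrightarrow> \<bar>h (F w) - 1\<bar> < \<eta>"
proof -
  obtain R where R: "R > 0" "\<And>w. 1/2 \<le> norm w \<Longrightarrow> norm w < 1 \<Longrightarrow> norm (F w) \<le> R"
    using F_bounded by blast
  define Q where "Q = (closure (- A) \<inter> (\<lambda>z. \<bar>h z - 1\<bar>) -` {\<eta>..}) \<inter> cball 0 R"
  have "closed (closure (- A) \<inter> (\<lambda>z. \<bar>h z - 1\<bar>) -` {\<eta>..})"
    by (intro continuous_closed_preimage continuous_intros cont) auto
  then have "compact Q" unfolding Q_def by (rule closed_Int_compact) simp
  moreover have "Q \<subseteq> - A"
  proof
    fix z assume z: "z \<in> Q"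
    have "z \<notin> frontier A" using z bd[of z] \<eta> by (auto simp: Q_def)
    then show "z \<in> - A" using z by (auto simp: Q_def frontier_closures)
      (metis IntI closure_subset frontier_closures subsetD)
  qed
  ultimately obtain \<rho> where \<rho>: "0 < \<rho>" "\<rho> < 1" "\<And>w. \<rho> < norm w \<Longrightarrow> norm w < 1 \<Longrightarrow> F w \<notin> Q"
    using F_proper by blast
  show ?thesis
  proof (rule that[of "max \<rho> (1/2)"])
    fix w :: complex assume w: "max \<rho> (1/2) < norm w" "norm w < 1"
    have "w \<noteq> 0" using w by auto
    then have "F w \<in> closure (- A)" using F_notin[of w] w closure_subset by fastforce
    moreover have "F w \<in> cball 0 R" using R(2)[of w] w by simp
    moreover have "F w \<notin> Q" using \<rho>(3)[of w] w by simp
    ultimately show "\<bar>h (F w) - 1\<bar> < \<eta>" by (auto simp: Q_def)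
  qed (use \<rho> in auto)
qed

text \<open>The growth condition at infinity turns into \<open>ln \<bar>w\<bar> + O(1)\<close> at the pole, because \<open>w F w\<close> tends to a
  nonzero limit.\<close>
lemma near_pole:
  fixes h :: "complex \<Rightarrow> real"
  assumes inf: "\<And>z. R0 \<le> norm z \<Longrightarrow> \<bar>h z + ln (norm z)\<bar> \<le> M"
  obtains M' \<rho> where "0 < \<rho>" "\<rho> < 1" "\<And>w. 0 < norm w \<Longrightarrow> norm w < \<rho> \<Longrightarrow> \<bar>h (F w) - 1 - ln (norm w)\<bar> \<le> M'"
proof -
  have contq: "isCont q 0" using q_hol holomorphic_on_imp_continuous_on continuous_on_interior by fastforce
  have "isCont (\<lambda>w. w * a + 1 / q w) 0" using q_nz[of 0] by (intro continuous_intros contq) auto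
  then have l1: "((\<lambda>w. w * a + 1 / q w) \<longlongrightarrow> 1 / q 0) (at 0)" by (simp add: isCont_def)
  have "((\<lambda>w. ln (norm (w * a + 1 / q w))) \<longlongrightarrow> ln (norm (1 / q 0))) (at 0)"
    using q_nz[of 0] by (intro tendsto_intros l1) auto
  then have "\<forall>\<^sub>F w in at 0. \<bar>ln (norm (w * a + 1 / q w)) - ln (norm (1 / q 0))\<bar> < 1"
    by (auto dest: tendstoD[of _ _ _ 1] simp: dist_real_def)
  moreover have "\<forall>\<^sub>F w in at 0. R0 \<le> norm (F w) \<and> 0 < norm (F w)"
  proof -
    have "isCont \<phi> 0" using hol_phi holomorphic_on_imp_continuous_on continuous_on_interior by fastforce
    then have "(\<phi> \<longlongrightarrow> 0) (at 0)" by (simp add: isCont_def phi_0)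
    moreover have "\<forall>\<^sub>F w in at (0::complex). \<phi> w \<noteq> 0"
      unfolding eventually_at using FA by (intro exI[of _ 1]) auto
    ultimately have "filterlim \<phi> (at 0) (at 0)" by (simp add: filterlim_at)
    then have "filterlim (\<lambda>w. inverse (\<phi> w)) at_infinity (at 0)"
      by (rule filterlim_compose[OF filterlim_inverse_at_infinity])
    then have "filterlim (\<lambda>w. a + inverse (\<phi> w)) at_infinity (at 0)"
      by (rule tendsto_add_filterlim_at_infinity[OF tendsto_const])
    then have "filterlim F at_infinity (at 0)" by (simp add: F_def[abs_def] divide_inverse)
    then have "\<forall>\<^sub>F w in at 0. max R0 1 \<le> norm (F w)"
      unfolding filterlim_at_infinity[OF order_refl] by (metis less_max_iff_disj zero_less_one)
    then show ?thesis by eventually_elim auto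
  qed
  ultimately have "\<forall>\<^sub>F w in at 0. w \<in> ball 0 1 \<longrightarrow> \<bar>h (F w) - 1 - ln (norm w)\<bar> \<le> M + 2 + \<bar>ln (norm (1 / q 0))\<bar>"
    using eventually_neq_at_within[of 0 0 UNIV]
  proof eventually_elim
    case (elim w)
    show ?case
    proof
      assume wb: "w \<in> ball 0 1"
      have "w * F w = w * a + 1 / q w" using elim FA[OF wb] by (simp add: F_def q_def field_simps)
      then have "norm w * norm (F w) = norm (w * a + 1 / q w)" by (metis norm_mult)
      moreover have "ln (norm w * norm (F w)) = ln (norm w) + ln (norm (F w))" using elim by (intro ln_mult_pos) auto
      ultimately have "ln (norm w) + ln (norm (F w)) = ln (norm (w * a + 1 / q w))" by simp
      moreover have "\<bar>h (F w) + ln (norm (F w))\<bar> \<le> M" using inf elim by blast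
      ultimately show "\<bar>h (F w) - 1 - ln (norm w)\<bar> \<le> M + 2 + \<bar>ln (norm (1 / q 0))\<bar>"
        using elim(1) by linarith
    qed
  qed
  then obtain d where d: "d > 0" "\<And>w. w \<noteq> 0 \<Longrightarrow> norm w < d \<Longrightarrow> w \<in> ball 0 1 \<Longrightarrow> \<bar>h (F w) - 1 - ln (norm w)\<bar> \<le> M + 2 + \<bar>ln (norm (1 / q 0))\<bar>"
    unfolding eventually_at by auto
  show ?thesis
    by (rule that[of "min d (1/2)" "M + 2 + \<bar>ln (norm (1 / q 0))\<bar>"]) (use d in auto)
qed

text \<open>The difference \<open>g w = h (F w) - 1 - ln \<bar>w\<bar>\<close> is harmonic in the punctured disc, bounded near \<open>0\<close>, and
  tends to \<open>0\<close> at the circle. Adding \<open>\<delta> ln \<bar>w\<bar>\<close> beats the bound near \<open>0\<close>, so the maximum principle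
  applies to \<open>\<plusminus> g + \<delta> ln \<bar>w\<bar>\<close>, and letting \<open>\<delta>\<close> tend to \<open>0\<close> yields \<open>g = 0\<close>. The second claim is the
  chain rule.\<close>
lemma exterior_green_function:
  fixes h :: "complex \<Rightarrow> real"
  assumes G: "G holomorphic_on - A" and der: "\<And>z. z \<notin> A \<Longrightarrow> (h has_derivative (\<lambda>v. Re (G z * v))) (at z)"
    and cont: "continuous_on (closure (- A)) h" and bd: "\<And>z. z \<in> frontier A \<Longrightarrow> h z = 1"
    and inf: "\<And>z. R0 \<le> norm z \<Longrightarrow> \<bar>h z + ln (norm z)\<bar> \<le> M"
    and w: "w \<in> ball 0 1" "w \<noteq> 0"
  shows "h (F w) = 1 + ln (norm w)" and "G (F w) = - w / \<kappa> w"
proof -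
  let ?S = "ball 0 1 - {0::complex}"
  define g where "g w = h (F w) - 1 - ln (norm w)" for w
  define K where "K w = G (F w) * (- \<kappa> w / w\<^sup>2) - 1 / w" for w
  have holGF: "(\<lambda>w. G (F w)) holomorphic_on ?S"
  proof -
    have "F ` ?S \<subseteq> - A" using F_notin by auto
    from holomorphic_on_compose_gen[OF F_hol G this] show ?thesis by (simp add: o_def)
  qed
  have holK: "K holomorphic_on ?S"
    unfolding K_def by (intro holomorphic_intros holGF holomorphic_on_subset[OF kap_hol]) auto
  have derg: "(g has_derivative (\<lambda>v. Re (K w * v))) (at w)" if w: "w \<in> ?S" for w
  proof -
    have "(F has_derivative (*) (- \<kappa> w / w\<^sup>2)) (at w)"
      using F_deriv[of w] w by (simp add: has_field_derivative_def)
    from has_derivative_compose[OF this der]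
    have "((\<lambda>w. h (F w)) has_derivative (\<lambda>v. Re (G (F w) * ((- \<kappa> w / w\<^sup>2) * v)))) (at w)"
      using F_notin w by auto
    from has_derivative_diff[OF has_derivative_diff[OF this has_derivative_const[of 1]] ln_norm_derivative[of w]] w
    have "(g has_derivative (\<lambda>v. Re (G (F w) * ((- \<kappa> w / w\<^sup>2) * v)) - 0 - Re (1 / w * v))) (at w)"
      unfolding g_def by simp
    moreover have "(\<lambda>v. Re (G (F w) * ((- \<kappa> w / w\<^sup>2) * v)) - 0 - Re (1 / w * v)) = (\<lambda>v. Re (K w * v))"
      by (rule ext) (simp only: K_def left_diff_distrib mult.assoc minus_complex.sel diff_zero)
    ultimately show ?thesis by simp
  qed
  have bound: "\<sigma> * g w + \<delta> * ln (norm w) \<le> 0" if \<delta>: "\<delta> > 0" and \<sigma>: "\<bar>\<sigma>\<bar> = 1" and w: "w \<in> ?S" for \<sigma> \<delta> w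
  proof (rule harmonic_max_principle[where S = ?S and K = "\<lambda>w. complex_of_real \<sigma> * K w + complex_of_real \<delta> * (1 / w)"])
    show "open ?S" "bounded ?S" "w \<in> ?S" using w by (auto intro: open_delete)
    show "(\<lambda>w. complex_of_real \<sigma> * K w + complex_of_real \<delta> * (1 / w)) holomorphic_on ?S"
      by (intro holomorphic_intros holK) auto
    fix z assume z: "z \<in> ?S"
    have "((\<lambda>w. \<sigma> * g w + \<delta> * ln (norm w)) has_derivative (\<lambda>v. \<sigma> * Re (K z * v) + \<delta> * Re (1 / z * v))) (at z)"
      using z by (intro derivative_intros derg ln_norm_derivative) auto
    moreover have r: "Re (complex_of_real a * b) = a * Re b" for a b by simp
    ultimately show "((\<lambda>w. \<sigma> * g w + \<delta> * ln (norm w)) has_derivative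
         (\<lambda>v. Re ((complex_of_real \<sigma> * K z + complex_of_real \<delta> * (1 / z)) * v))) (at z)"
      by (simp only: distrib_right mult.assoc plus_complex.sel r)
  next
    fix \<epsilon> :: real assume ep: "\<epsilon> > 0"
    obtain \<rho>1 where r1: "1/2 \<le> \<rho>1" "\<rho>1 < 1" "\<And>w. \<rho>1 < norm w \<Longrightarrow> norm w < 1 \<Longrightarrow> \<bar>h (F w) - 1\<bar> < \<epsilon>/2"
      using near_circle[OF cont bd, of "\<epsilon>/2"] ep by auto
    obtain M' \<rho>0 where r0': "0 < \<rho>0" "\<rho>0 < 1" "\<And>w. 0 < norm w \<Longrightarrow> norm w < \<rho>0 \<Longrightarrow> \<bar>h (F w) - 1 - ln (norm w)\<bar> \<le> M'"
      using near_pole[OF inf] by blast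
    have r0: "0 < \<rho>0" "\<rho>0 < 1" "\<And>w. 0 < norm w \<Longrightarrow> norm w < \<rho>0 \<Longrightarrow> \<bar>g w\<bar> \<le> M'"
      using r0' by (simp_all add: g_def)
    \<comment> \<open>Outside the annulus between \<open>r3\<close> and \<open>r2\<close> the function is below \<open>\<epsilon>\<close>.\<close>
    define r2 where "r2 = max \<rho>1 (exp (- \<epsilon>/2))"
    have r2: "r2 < 1" "\<rho>1 \<le> r2" "exp (-\<epsilon>/2) \<le> r2" using r1 ep by (auto simp: r2_def)
    define r3 where "r3 = min \<rho>0 (exp (- \<bar>M'\<bar> / \<delta>))"
    have r3: "r3 > 0" "r3 \<le> \<rho>0" "r3 \<le> exp (- \<bar>M'\<bar> / \<delta>)" using r0 by (auto simp: r3_def)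
    let ?k = "\<lambda>w. \<sigma> * g w + \<delta> * ln (norm w)"
    have sg: "\<sigma> * x \<le> \<bar>x\<bar>" for x using \<sigma> by (metis abs_ge_self abs_mult mult_1)
    have out: "?k w < \<epsilon>" if "r2 < norm w" "norm w < 1" for w
    proof -
      have "w \<noteq> 0" using that r1 r2 by auto
      have "ln (exp (-\<epsilon>/2)) < ln (norm w)" using that r2 \<open>w \<noteq> 0\<close> by (subst ln_less_cancel_iff) auto
      then have l: "- \<epsilon>/2 < ln (norm w)" by simp
      have l0: "ln (norm w) < 0" using that \<open>w \<noteq> 0\<close> by simp
      then have "\<delta> * ln (norm w) < 0" using \<delta> by (simp add: mult_pos_neg)
      moreover have "\<bar>h (F w) - 1\<bar> < \<epsilon>/2" by (rule r1(3)) (use that r2 in auto)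
      then have "\<bar>g w\<bar> < \<epsilon>" unfolding g_def using l l0 by linarith
      ultimately show ?thesis using sg[of "g w"] by linarith
    qed
    have inn: "?k w < \<epsilon>" if "norm w < r3" "w \<noteq> 0" for w
    proof -
      have "ln (norm w) < ln (exp (- \<bar>M'\<bar> / \<delta>))" using that r3 by (subst ln_less_cancel_iff) auto
      then have "\<delta> * ln (norm w) < - \<bar>M'\<bar>" using \<delta> by (simp add: field_simps)
      moreover have "\<bar>g w\<bar> \<le> M'" using r0(3)[of w] that r3 by simp
      ultimately show ?thesis using sg[of "g w"] ep by linarith
    qed
    have "{z \<in> ?S. \<epsilon> \<le> ?k z} = (cball 0 r2 - ball 0 r3) \<inter> ?k -` {\<epsilon>..}"
    proof (intro equalityI subsetI)
      fix z assume z: "z \<in> {z \<in> ?S. \<epsilon> \<le> ?k z}"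
      then have "norm z \<le> r2" using out[of z] by force
      moreover have "r3 \<le> norm z" using inn[of z] z by force
      ultimately show "z \<in> (cball 0 r2 - ball 0 r3) \<inter> ?k -` {\<epsilon>..}" using z by simp
    next
      fix z assume z: "z \<in> (cball 0 r2 - ball 0 r3) \<inter> ?k -` {\<epsilon>..}"
      then show "z \<in> {z \<in> ?S. \<epsilon> \<le> ?k z}" using r2 r3 by auto
    qed
    moreover have "closed ((cball 0 r2 - ball 0 r3) \<inter> ?k -` {\<epsilon>..})"
    proof (rule continuous_closed_preimage)
      have "continuous_on ?S g" using derg by (meson continuous_at_imp_continuous_on has_derivative_continuous)
      then have "continuous_on (cball 0 r2 - ball 0 r3) g"
        by (rule continuous_on_subset) (use r2 r3 in auto)
      then show "continuous_on (cball 0 r2 - ball 0 r3) ?k"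
        using r3 by (intro continuous_intros) auto
    qed (auto intro: closed_Diff)
    ultimately show "closed {z \<in> ?S. \<epsilon> \<le> ?k z}" by simp
  qed
  have g0: "g w = 0" if w: "w \<in> ?S" for w
  proof -
    have "\<sigma> * g w \<le> 0" if \<sigma>: "\<bar>\<sigma>\<bar> = 1" for \<sigma>
    proof (rule field_le_epsilon)
      fix e :: real assume e: "e > 0"
      define l where "l = 1 - ln (norm w)"
      have l: "l > 0" using w by (simp add: l_def) (smt (verit) ln_le_zero_iff zero_less_norm_iff)
      have "\<sigma> * g w + (e / l) * ln (norm w) \<le> 0" using bound[OF _ \<sigma> w, of "e/l"] e l by simp
      moreover have "- (e / l) * ln (norm w) \<le> e"
      proof -
        have "e * - ln (norm w) \<le> e * l" using e by (intro mult_left_mono) (auto simp: l_def)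
        then show ?thesis using l by (simp add: field_simps)
      qed
      ultimately show "\<sigma> * g w \<le> 0 + e" by simp
    qed
    from this[of 1] this[of "-1"] show ?thesis by simp
  qed
  have wS: "w \<in> ?S" using w by auto
  show "h (F w) = 1 + ln (norm w)" using g0[OF wS] by (simp add: g_def)
  have "(g has_derivative (\<lambda>v. 0)) (at w)"
  proof (rule has_derivative_transform_within_open[OF has_derivative_const[of 0 "at w"], of ?S])
    show "open ?S" by (auto intro: open_delete)
  qed (use g0 wS in auto)
  then have "(\<lambda>v. Re (K w * v)) = (\<lambda>v. 0)" using derg[OF wS] has_derivative_unique by blast
  then have "Re (K w * 1) = 0" "Re (K w * \<i>) = 0" by meson+
  then have "K w = 0" by (simp add: complex_eq_iff)
  then have "G (F w) * (- \<kappa> w / w\<^sup>2) = 1 / w" by (simp add: K_def)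
  then have "- (G (F w) * \<kappa> w) = w" using w by (simp add: field_simps power2_eq_square)
  then have "G (F w) * \<kappa> w = - w" by (metis minus_minus)
  then show "G (F w) = - w / \<kappa> w"
    using kap_nz[OF w(1)] by (metis nonzero_mult_div_cancel_right)
qed

end

section \<open>Area and capacity\<close>

lemma mean_value_circle:
  assumes f: "f holomorphic_on ball 0 1" and r: "0 < r" "r < 1"
  shows "((\<lambda>t. f (of_real r * cis t)) has_integral 2 * of_real pi * f 0) {0..2*pi}"
proof -
  have "f holomorphic_on cball 0 r" by (rule holomorphic_on_subset[OF f]) (use r in auto)
  then have "((\<lambda>u. f u / (u - 0)) has_contour_integral (2 * of_real pi * \<i> * f 0)) (part_circlepath 0 r 0 (2*pi))"
    using Cauchy_integral_circlepath_simple[of f 0 r 0] r by (simp add: circlepath_def)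
  then have "((\<lambda>t. f (0 + of_real r * cis t) / (0 + of_real r * cis t - 0) * of_real r * \<i> * cis t) has_integral (2 * of_real pi * \<i> * f 0)) {0..2*pi}"
    by (subst (asm) has_contour_integral_part_circlepath_iff) auto
  moreover have "(\<lambda>t. f (0 + of_real r * cis t) / (0 + of_real r * cis t - 0) * of_real r * \<i> * cis t) = (\<lambda>t. \<i> * f (of_real r * cis t))"
    by (rule ext) (use r in \<open>simp add: field_simps\<close>)
  ultimately have "((\<lambda>t. \<i> * f (of_real r * cis t)) has_integral (2 * of_real pi * \<i> * f 0)) {0..2*pi}" by simp
  from has_integral_mult_right[OF this, of "-\<i>"] show ?thesis by (simp add: algebra_simps)
qed

text \<open>Fubini for continuous functions on a rectangle of \<open>real^2\<close>, transported from \<open>real \<times> real\<close>.\<close>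
lemma plane_integral_iterated:
  fixes f :: "real^2 \<Rightarrow> real"
  assumes cont: "continuous_on (cbox l u) f"
  shows "integral (cbox l u) f = integral {l$1..u$1} (\<lambda>s. integral {l$2..u$2} (\<lambda>t. f (vector [s, t])))"
proof -
  define g :: "real \<times> real \<Rightarrow> real^2" where "g p = vector [fst p, snd p]" for p
  define k :: "real^2 \<Rightarrow> real \<times> real" where "k x = (x$1, x$2)" for x
  have gk: "g (k x) = x" for x by (simp add: g_def k_def vec_eq_iff forall_2)
  have kg: "k (g p) = p" for p by (simp add: g_def k_def)
  have cbv: "cbox x y = g ` cbox (k x) (k y)" for x y :: "real^2"
  proof (intro equalityI subsetI)
    fix v assume "v \<in> cbox x y"
    then have "k v \<in> cbox (k x) (k y)" by (auto simp: k_def mem_box_cart cbox_Pair_eq forall_2)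
    then show "v \<in> g ` cbox (k x) (k y)" using gk by (metis imageI)
  next
    fix v assume "v \<in> g ` cbox (k x) (k y)"
    then show "v \<in> cbox x y" by (auto simp: k_def g_def mem_box_cart cbox_Pair_eq forall_2)
  qed
  have cbp: "g ` cbox p q = cbox (g p) (g q)" for p q using cbv[of "g p" "g q"] by (simp only: kg)
  have ck: "k ` cbox x y = cbox (k x) (k y)" for x y using cbv[of x y] by (simp only: image_image kg image_ident)
  have contg: "continuous_on S g" for S
  proof -
    have "g = (\<lambda>p. fst p *\<^sub>R axis 1 1 + snd p *\<^sub>R axis 2 1)" by (auto simp: g_def fun_eq_iff vec_eq_iff forall_2 axis_def)
    then show ?thesis by (auto intro!: continuous_intros)
  qed
  have cont_content: "measure lborel (k ` cbox x y) = 1 * measure lborel (cbox x y)" for x y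
  proof -
    have "cbox x y = {} \<longleftrightarrow> y$1 < x$1 \<or> y$2 < x$2"
      using forall_2[of "\<lambda>i. \<not> y$i < x$i"] by (simp add: interval_eq_empty_cart) blast
    then show ?thesis
      unfolding ck by (auto simp: k_def content_cbox_if_cart content_Pair content_real_if prod.insert UNIV_2)
  qed
  have int: "(f has_integral integral (cbox l u) f) (cbox l u)"
    using integrable_continuous[OF cont] by (simp add: integrable_integral)
  have "(f \<circ> g has_integral integral (cbox l u) f) (cbox (k l) (k u))"
  proof -
    have contf: "continuous_on (cbox (k l) (k u)) (\<lambda>p. f (g p))"
      by (rule continuous_on_compose2[OF cont contg]) (use cbv[of l u] in simp)
    then have i2: "((\<lambda>p. f (g p)) has_integral integral (cbox (k l) (k u)) (\<lambda>p. f (g p))) (cbox (k l) (k u))"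
      by (simp add: integrable_integral integrable_continuous)
    have "((\<lambda>x. f (g (k x))) has_integral (1/1) *\<^sub>R integral (cbox (k l) (k u)) (\<lambda>p. f (g p))) (g ` cbox (k l) (k u))"
    proof (rule has_integral_twiddle[where h = g and g = k, OF _ gk kg _ _ _ cont_content i2])
      have "continuous_on UNIV k" unfolding k_def by (intro continuous_intros)
      then show "continuous (at x) k" for x by (simp add: continuous_on_eq_continuous_at)
      show "\<exists>w z. k ` cbox u v = cbox w z" for u v using ck by blast
      show "\<exists>w z. g ` cbox u v = cbox w z" for u v using cbp by blast
    qed auto
    then have "(f has_integral integral (cbox (k l) (k u)) (\<lambda>p. f (g p))) (cbox l u)"
      unfolding cbv[of l u] gk by simp
    then have "integral (cbox l u) f = integral (cbox (k l) (k u)) (\<lambda>p. f (g p))" using int has_integral_unique by blast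
    then show ?thesis using i2 by (simp add: o_def)
  qed
  then have "integral (cbox l u) f = integral (cbox (k l) (k u)) (f \<circ> g)" by (simp add: integral_unique)
  also have "\<dots> = integral (cbox (l$1) (u$1)) (\<lambda>s. integral (cbox (l$2) (u$2)) (\<lambda>t. (f \<circ> g) (s, t)))"
    unfolding k_def
  proof (rule integral_prod_continuous)
    show "continuous_on (cbox (l$1, l$2) (u$1, u$2)) (f \<circ> g)"
      unfolding o_def by (rule continuous_on_compose2[OF cont contg]) (use cbv[of l u] in \<open>simp add: k_def\<close>)
  qed
  finally show ?thesis by (simp add: g_def)
qed

context exterior_map begin

text \<open>The integrand is the lower bound for \<open>\<bar>\<kappa>\<bar>\<^sup>2\<close> that results from \<open>\<bar>\<kappa> - cap\<bar>\<^sup>2 \<ge> 0\<close>. It is harmonic, so its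
  mean over each circle is its value at \<open>0\<close>.\<close>
lemma kap_lower_integral:
  assumes r: "0 < r" "r < 1"
  shows "((\<lambda>t. 2 * Re (cnj cap * \<kappa> (of_real r * cis t)) - (norm cap)\<^sup>2) has_integral 2 * pi * (norm cap)\<^sup>2) {0..2*pi}"
proof -
  have "((\<lambda>t. Re (cnj cap * \<kappa> (of_real r * cis t))) has_integral Re (cnj cap * (2 * of_real pi * \<kappa> 0))) {0..2*pi}"
    by (intro has_integral_Re has_integral_mult_right mean_value_circle kap_hol r)
  moreover have "Re (cnj cap * (2 * of_real pi * \<kappa> 0)) = 2 * pi * (norm cap)\<^sup>2"
  proof -
    have "cnj cap * (2 * of_real pi * \<kappa> 0) = of_real (2 * pi) * (cap * cnj cap)" by (simp add: kap_0 mult_ac)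
    also have "\<dots> = of_real (2 * pi * (norm cap)\<^sup>2)" using complex_norm_square[of cap] by simp
    finally show ?thesis by (metis Re_complex_of_real)
  qed
  ultimately have a: "((\<lambda>t. Re (cnj cap * \<kappa> (of_real r * cis t))) has_integral 2 * pi * (norm cap)\<^sup>2) {0..2*pi}"
    by simp
  have b: "((\<lambda>t. (norm cap)\<^sup>2) has_integral (2*pi - 0) *\<^sub>R (norm cap)\<^sup>2) {0..2*pi}"
    using has_integral_const_real[of "(norm cap)\<^sup>2" 0 "2*pi"] by simp
  have "((\<lambda>t. 2 * Re (cnj cap * \<kappa> (of_real r * cis t)) - (norm cap)\<^sup>2) has_integral 2 * (2 * pi * (norm cap)\<^sup>2) - (2*pi - 0) *\<^sub>R (norm cap)\<^sup>2) {0..2*pi}"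
    by (rule has_integral_diff[OF has_integral_mult_right[OF a] b])
  moreover have "2 * (2 * pi * (norm cap)\<^sup>2) - (2*pi - 0) *\<^sub>R (norm cap)\<^sup>2 = 2 * pi * (norm cap)\<^sup>2" by simp
  ultimately show ?thesis by (simp only:)
qed

text \<open>In logarithmic coordinates \<open>w = exp z\<close> the annulus is a rectangle, and \<open>z \<mapsto> F (exp z)\<close> has Jacobian
  \<open>\<bar>\<kappa>\<bar>\<^sup>2 exp (- 2 Re z)\<close>. The lower bound for \<open>\<bar>\<kappa>\<bar>\<^sup>2\<close> is integrated over circles first.\<close>
lemma annulus_image_area:
  assumes r: "0 < \<rho>" "\<rho> < \<sigma>" "\<sigma> < 1"
  obtains V where "V \<in> lmeasurable" "V \<subseteq> c2v ` F ` {w. \<rho> < norm w \<and> norm w < \<sigma>}"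
    "measure lebesgue V \<ge> pi * (norm cap)\<^sup>2 * (1/\<rho>\<^sup>2 - 1/\<sigma>\<^sup>2)"
proof -
  define l u :: "real^2" where "l = vector [ln \<rho>, 0]" and "u = vector [ln \<sigma>, 2*pi]"
  define f where "f x = c2v (F (exp (v2c x)))" for x
  define D where "D z = - \<kappa> (exp z) / (exp z)\<^sup>2 * exp z" for z
  have ez: "norm (exp (v2c x)) = exp (x$1)" for x by simp
  have bx: "\<rho> \<le> norm (exp (v2c x)) \<and> norm (exp (v2c x)) \<le> \<sigma>" if "x \<in> cbox l u" for x
  proof -
    have "ln \<rho> \<le> x$1" "x$1 \<le> ln \<sigma>" using that by (auto simp: l_def u_def mem_box_cart forall_2)
    then have "exp (ln \<rho>) \<le> exp (x$1)" "exp (x$1) \<le> exp (ln \<sigma>)" by simp_all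
    then show ?thesis using r by simp
  qed
  have bxo: "\<rho> < norm (exp (v2c x)) \<and> norm (exp (v2c x)) < \<sigma>" if "x \<in> box l u" for x
  proof -
    have "ln \<rho> < x$1" "x$1 < ln \<sigma>" using that by (auto simp: l_def u_def mem_box_cart forall_2)
    then have "exp (ln \<rho>) < exp (x$1)" "exp (x$1) < exp (ln \<sigma>)" by simp_all
    then show ?thesis using r by simp
  qed
  have eb: "exp (v2c x) \<in> ball 0 1" if "x \<in> cbox l u" for x
  proof -
    have "norm (exp (v2c x)) < 1" using bx[OF that] r by linarith
    then show ?thesis by (simp only: mem_ball_0)
  qed
  have der: "(f has_derivative (\<lambda>v. c2v (D (v2c x) * v2c v))) (at x within S)" if "x \<in> cbox l u" for x S
  proof -
    have "((\<lambda>z. F (exp z)) has_field_derivative D (v2c x)) (at (v2c x))"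
      unfolding D_def using F_deriv[OF eb[OF that]] by (intro DERIV_chain2 DERIV_exp) auto
    then have "((\<lambda>z. F (exp z)) has_derivative (*) (D (v2c x))) (at (v2c x))" by (simp add: has_field_derivative_def)
    moreover have "(v2c has_derivative v2c) (at x)" by (rule bounded_linear_imp_has_derivative[OF bounded_linear_v2c])
    ultimately have "((\<lambda>x. F (exp (v2c x))) has_derivative (\<lambda>v. D (v2c x) * v2c v)) (at x)"
      using has_derivative_compose by fastforce
    from c2v_derivative[OF has_derivative_at_withinI[OF this]] show ?thesis unfolding f_def .
  qed
  have det: "det (matrix (\<lambda>v. c2v (d * v2c v))) = (norm d)\<^sup>2" for d
  proof -
    have "det (matrix (\<lambda>v. c2v (d * v2c v))) = (Re d)\<^sup>2 + (Im d)\<^sup>2"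
      by (simp add: det_2 matrix_def axis_def power2_eq_square algebra_simps)
    then show ?thesis by (simp only: cmod_power2)
  qed
  have inj: "inj_on f (box l u)"
  proof (rule inj_onI)
    fix x y assume xy: "x \<in> box l u" "y \<in> box l u" "f x = f y"
    have "F (exp (v2c x)) = F (exp (v2c y))" using xy(3) by (simp add: f_def)
    moreover have "\<psi> (F (exp (v2c z))) = exp (v2c z)" if "z \<in> box l u" for z
      by (rule psi_F[OF eb]) (use that box_subset_cbox in auto)
    ultimately have "exp (v2c x) = exp (v2c y)" using xy(1,2) by metis
    moreover have "\<bar>Im (v2c x) - Im (v2c y)\<bar> < 2 * pi"
      using xy by (auto simp: l_def u_def mem_box_cart forall_2 abs_if)
    ultimately have "v2c x = v2c y" by (rule exp_complex_eqI[rotated])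
    then show "x = y" by simp
  qed
  have nD: "(norm (D z))\<^sup>2 = (norm (\<kappa> (exp z)))\<^sup>2 / (exp (Re z))\<^sup>2" for z
  proof -
    have "D z = - \<kappa> (exp z) / exp z" by (simp add: D_def power2_eq_square)
    then show ?thesis by (simp add: norm_divide power_divide)
  qed
  have contk: "continuous_on (cbox l u) (\<lambda>x. \<kappa> (exp (v2c x)))"
    using eb by (intro continuous_on_compose2[OF holomorphic_on_imp_continuous_on[OF kap_hol]] continuous_intros) auto
  have contD: "continuous_on (cbox l u) (\<lambda>x. (norm (D (v2c x)))\<^sup>2)"
    unfolding nD by (intro continuous_intros contk) auto
  have intD: "(\<lambda>x. (norm (D (v2c x)))\<^sup>2) integrable_on box l u"
    using integrable_continuous[OF contD] by (simp add: integrable_on_open_interval)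
  have meas: "f ` box l u \<in> lmeasurable" "measure lebesgue (f ` box l u) = integral (box l u) (\<lambda>x. (norm (D (v2c x)))\<^sup>2)"
  proof -
    have d: "(f has_derivative (\<lambda>v. c2v (D (v2c x) * v2c v))) (at x within box l u)" if "x \<in> box l u" for x
      using der that box_subset_cbox by blast
    have "(f ` box l u \<in> lmeasurable \<and> measure lebesgue (f ` box l u) = integral (box l u) (\<lambda>x. (norm (D (v2c x)))\<^sup>2))
      \<longleftrightarrow> ((\<lambda>x. \<bar>det (matrix (\<lambda>v. c2v (D (v2c x) * v2c v)))\<bar>) has_integral integral (box l u) (\<lambda>x. (norm (D (v2c x)))\<^sup>2)) (box l u)"
      by (rule has_measure_differentiable_image[OF _ d inj]) auto
    then show "f ` box l u \<in> lmeasurable" "measure lebesgue (f ` box l u) = integral (box l u) (\<lambda>x. (norm (D (v2c x)))\<^sup>2)"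
      using intD unfolding det by (auto simp: integrable_integral)
  qed
  define g where "g x = (2 * Re (cnj cap * \<kappa> (exp (v2c x))) - (norm cap)\<^sup>2) * exp (- 2 * x$1)" for x
  have contg: "continuous_on (cbox l u) g"
    unfolding g_def by (intro continuous_intros contk)
  have gle: "g x \<le> (norm (D (v2c x)))\<^sup>2" for x
  proof -
    let ?k = "\<kappa> (exp (v2c x))"
    have "0 \<le> (norm (?k - cap))\<^sup>2" by simp
    also have "\<dots> = (norm ?k)\<^sup>2 - 2 * Re (cnj cap * ?k) + (norm cap)\<^sup>2"
      by (simp only: cmod_power2) (simp add: power2_eq_square algebra_simps)
    finally have "2 * Re (cnj cap * ?k) - (norm cap)\<^sup>2 \<le> (norm ?k)\<^sup>2" by simp
    then have "g x \<le> (norm ?k)\<^sup>2 * exp (- 2 * x$1)" unfolding g_def by (intro mult_right_mono) auto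
    also have "\<dots> = (norm (D (v2c x)))\<^sup>2" unfolding nD
      by (simp add: exp_minus divide_inverse power2_eq_square exp_add[symmetric] flip: mult_2)
    finally show ?thesis .
  qed
  have "integral (cbox l u) g = integral {ln \<rho>..ln \<sigma>} (\<lambda>s. integral {0..2*pi} (\<lambda>t. g (vector [s, t])))"
    using plane_integral_iterated[OF contg] by (simp add: l_def u_def)
  also have "\<dots> = integral {ln \<rho>..ln \<sigma>} (\<lambda>s. 2 * pi * (norm cap)\<^sup>2 * exp (- 2 * s))"
  proof (rule integral_cong)
    fix s assume s: "s \<in> {ln \<rho>..ln \<sigma>}"
    have "exp s \<le> exp (ln \<sigma>)" using s by (subst exp_le_cancel_iff) simp
    then have "exp s \<le> \<sigma>" using r by simp
    then have "exp s < 1" using r by linarith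
    then have *: "((\<lambda>t. (2 * Re (cnj cap * \<kappa> (of_real (exp s) * cis t)) - (norm cap)\<^sup>2) * exp (-2 * s)) has_integral 2 * pi * (norm cap)\<^sup>2 * exp (- 2 * s)) {0..2*pi}"
      by (intro has_integral_mult_left kap_lower_integral) auto
    have "exp (v2c (vector [s, t])) = of_real (exp s) * cis t" for t
      by (simp add: exp_eq_polar)
    then have "(\<lambda>t. g (vector [s, t])) = (\<lambda>t. (2 * Re (cnj cap * \<kappa> (of_real (exp s) * cis t)) - (norm cap)\<^sup>2) * exp (-2 * s))"
      by (simp add: g_def)
    then show "integral {0..2*pi} (\<lambda>t. g (vector [s, t])) = 2 * pi * (norm cap)\<^sup>2 * exp (- 2 * s)"
      using integral_unique[OF *] by (simp only:)
  qed
  also have "\<dots> = pi * (norm cap)\<^sup>2 * (1/\<rho>\<^sup>2 - 1/\<sigma>\<^sup>2)"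
  proof (rule integral_unique)
    have "ln \<rho> \<le> ln \<sigma>" using r by simp
    then have "((\<lambda>s. 2 * pi * (norm cap)\<^sup>2 * exp (- 2 * s)) has_integral
       (- pi * (norm cap)\<^sup>2 * exp (- 2 * ln \<sigma>)) - (- pi * (norm cap)\<^sup>2 * exp (- 2 * ln \<rho>))) {ln \<rho>..ln \<sigma>}"
    proof (rule fundamental_theorem_of_calculus)
      fix s
      have "((\<lambda>s. - pi * (norm cap)\<^sup>2 * exp (- 2 * s)) has_real_derivative 2 * pi * (norm cap)\<^sup>2 * exp (- 2 * s)) (at s within {ln \<rho>..ln \<sigma>})"
        by (auto intro!: derivative_eq_intros)
      then show "((\<lambda>s. - pi * (norm cap)\<^sup>2 * exp (- 2 * s)) has_vector_derivative 2 * pi * (norm cap)\<^sup>2 * exp (- 2 * s)) (at s within {ln \<rho>..ln \<sigma>})"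
        unfolding has_real_derivative_iff_has_vector_derivative .
    qed
    moreover have "exp (- 2 * ln x) = 1 / x\<^sup>2" if "x > 0" for x :: real
    proof -
      have "exp (2 * ln x) = x\<^sup>2" using that by (simp add: exp_double)
      moreover have "exp (- 2 * ln x) = inverse (exp (2 * ln x))" by (simp add: exp_minus)
      ultimately show ?thesis by (simp add: divide_inverse)
    qed
    ultimately show "((\<lambda>s. 2 * pi * (norm cap)\<^sup>2 * exp (- 2 * s)) has_integral pi * (norm cap)\<^sup>2 * (1/\<rho>\<^sup>2 - 1/\<sigma>\<^sup>2)) {ln \<rho>..ln \<sigma>}"
      using r by (simp add: algebra_simps)
  qed
  finally have I: "integral (cbox l u) g = pi * (norm cap)\<^sup>2 * (1/\<rho>\<^sup>2 - 1/\<sigma>\<^sup>2)" .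
  have "integral (cbox l u) g \<le> integral (cbox l u) (\<lambda>x. (norm (D (v2c x)))\<^sup>2)"
    using gle by (intro integral_le integrable_continuous contg contD)
  also have "\<dots> = measure lebesgue (f ` box l u)"
    using meas(2) by (simp add: integral_open_interval)
  finally have "pi * (norm cap)\<^sup>2 * (1/\<rho>\<^sup>2 - 1/\<sigma>\<^sup>2) \<le> measure lebesgue (f ` box l u)" using I by simp
  moreover have "f ` box l u \<subseteq> c2v ` F ` {w. \<rho> < norm w \<and> norm w < \<sigma>}"
    using bxo by (auto simp: f_def)
  ultimately show ?thesis using that meas(1) by blast
qed

lemma diff_quotient_holomorphic:
  assumes "f holomorphic_on ball 0 1"
  shows "(\<lambda>w. if w = 0 then deriv f 0 else (f w - f 0) / w) holomorphic_on ball 0 1"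
proof -
  have "(\<lambda>w. if w = 0 then deriv f 0 else f w / w - f 0 / (w - 0)) holomorphic_on ball 0 1"
    by (rule pole_theorem[OF assms]) auto
  moreover have "(\<lambda>w. if w = 0 then deriv f 0 else f w / w - f 0 / (w - 0)) = (\<lambda>w. if w = 0 then deriv f 0 else (f w - f 0) / w)"
    by (auto simp: fun_eq_iff diff_divide_distrib)
  ultimately show ?thesis by simp
qed

text \<open>The determinant of \<open>\<zeta> \<mapsto> c \<zeta> + b cnj \<zeta>\<close> is \<open>\<bar>c\<bar>\<^sup>2 - \<bar>b\<bar>\<^sup>2\<close>.\<close>
lemma ellipse_area:
  fixes c b :: complex
  assumes "norm b \<le> norm c" "R \<ge> 0"
  defines "T \<equiv> \<lambda>x. c2v (c * v2c x + b * cnj (v2c x))"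
  shows "T ` cball 0 R \<in> lmeasurable" "measure lebesgue (T ` cball 0 R) \<le> (norm c)\<^sup>2 * (pi * R\<^sup>2)"
proof -
  have lin: "linear T"
    by (rule linearI) (simp_all add: T_def vec_eq_iff forall_2 algebra_simps)
  have det: "det (matrix T) = (norm c)\<^sup>2 - (norm b)\<^sup>2"
  proof -
    have "det (matrix T) = ((Re c)\<^sup>2 + (Im c)\<^sup>2) - ((Re b)\<^sup>2 + (Im b)\<^sup>2)"
      by (simp add: det_2 matrix_def axis_def T_def power2_eq_square algebra_simps)
    then show ?thesis by (simp only: cmod_power2)
  qed
  have "(norm b)\<^sup>2 \<le> (norm c)\<^sup>2" using assms(1) by (simp add: power_mono)
  then have d: "\<bar>det (matrix T)\<bar> \<le> (norm c)\<^sup>2" unfolding det by simp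
  show "T ` cball 0 R \<in> lmeasurable" by (rule measurable_linear_image[OF lin]) simp
  have "measure lebesgue (T ` cball 0 R) = \<bar>det (matrix T)\<bar> * measure lebesgue (cball (0::real^2) R)"
    by (rule measure_linear_image[OF lin]) simp
  also have "measure lebesgue (cball (0::real^2) R) = pi * R\<^sup>2"
    using assms(2) by (simp add: content_cball unit_ball_vol_2)
  finally show "measure lebesgue (T ` cball 0 R) \<le> (norm c)\<^sup>2 * (pi * R\<^sup>2)"
    using d by (simp add: mult_right_mono)
qed

text \<open>The left-hand side as a function of \<open>x\<close> is compared with its value at \<open>x = \<rho>\<close>; the decrease of
  \<open>1 / x\<close> dominates when \<open>\<rho>\<close> is small.\<close>
lemma radius_comparison:
  fixes \<rho> x \<beta> C :: real
  assumes "0 < \<rho>" "\<rho> \<le> x" "x \<le> 1/2" "0 \<le> \<beta>" "0 \<le> C" "\<rho> * (2 * \<beta> + C) \<le> 1"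
  shows "1 / x + \<beta> * (x * (1 - \<rho>\<^sup>2 / x\<^sup>2)) + C * x\<^sup>2 \<le> 1 / \<rho> + C * \<rho>\<^sup>2"
proof -
  have x: "x > 0" using assms by simp
  have "(x + \<rho>) / x \<le> 2" using x assms by (simp add: divide_le_eq)
  then have "\<beta> * ((x + \<rho>) / x) + C * (x + \<rho>) \<le> \<beta> * 2 + C * 1"
    using assms by (intro add_mono mult_left_mono) auto
  also have "\<dots> \<le> 1 / \<rho>" using assms by (simp add: field_simps)
  also have "\<dots> \<le> 1 / (\<rho> * x)" using assms x by (simp add: field_simps)
  finally have "(x - \<rho>) * (\<beta> * ((x + \<rho>) / x) + C * (x + \<rho>)) \<le> (x - \<rho>) * (1 / (\<rho> * x))"
    using assms by (intro mult_left_mono) auto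
  moreover have "(x - \<rho>) * (1 / (\<rho> * x)) = 1 / \<rho> - 1 / x" using assms x by (simp add: field_simps)
  moreover have "(x - \<rho>) * (\<beta> * ((x + \<rho>) / x) + C * (x + \<rho>)) = \<beta> * (x * (1 - \<rho>\<^sup>2 / x\<^sup>2)) + C * x\<^sup>2 - C * \<rho>\<^sup>2"
    using x by (simp add: field_simps power2_eq_square)
  ultimately show ?thesis by linarith
qed

text \<open>On the circle \<open>\<bar>w\<bar> = \<rho>\<close> the image under \<open>F\<close> is up to \<open>O(\<rho>\<^sup>2)\<close> the ellipse
  \<open>b0 + cap \<zeta> + b1 \<rho>\<^sup>2 cnj \<zeta>\<close> with \<open>\<zeta> = 1 / w\<close>, where \<open>b1\<close> is the derivative of \<open>B\<close> at \<open>0\<close>. The set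
  \<open>A\<close> and the points \<open>F w\<close> with \<open>\<bar>w\<bar> \<ge> \<rho>\<close> lie inside this curve, hence in a slightly larger ellipse. The precise shape matters:
  for a disc in place of the ellipse, the error in the area would not tend to zero with \<open>\<rho>\<close>.\<close>
lemma complement_in_ellipse:
  obtains C' \<rho>0 where "0 \<le> C'" "0 < \<rho>0" "\<rho>0 < 1/2"
    "\<And>\<rho>. 0 < \<rho> \<Longrightarrow> \<rho> < \<rho>0 \<Longrightarrow>
      \<exists>X \<in> lmeasurable. c2v ` A \<union> c2v ` F ` {w. \<rho> \<le> norm w \<and> norm w < 1} \<subseteq> X \<and>
        measure lebesgue X \<le> (norm cap)\<^sup>2 * (pi * (1/\<rho> + C' * \<rho>\<^sup>2)\<^sup>2)"
proof -
  define b0 b1 where "b0 = a + B 0" and "b1 = deriv B 0"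
  define p where "p w = (if w = 0 then b1 else (B w - B 0) / w)" for w
  define e where "e w = (if w = 0 then deriv p 0 else (p w - p 0) / w)" for w
  have "p holomorphic_on ball 0 1"
    unfolding p_def b1_def by (rule diff_quotient_holomorphic[OF B_hol])
  then have "e holomorphic_on ball 0 1" unfolding e_def by (rule diff_quotient_holomorphic)
  then have "e holomorphic_on cball 0 (1/2)" by (rule holomorphic_on_subset) auto
  then have "continuous_on (cball 0 (1/2)) e" by (rule holomorphic_on_imp_continuous_on)
  then have "bounded (e ` cball 0 (1/2))" by (intro compact_imp_bounded compact_continuous_image) auto
  then obtain C where C: "C > 0" "\<And>w. norm w \<le> 1/2 \<Longrightarrow> norm (e w) \<le> C"
    unfolding bounded_pos by auto
  have Bexp: "B w = B 0 + b1 * w + w\<^sup>2 * e w" for w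
    by (simp add: e_def p_def field_simps power2_eq_square)
  obtain R where R: "R > 0" "\<And>w. 1/2 \<le> norm w \<Longrightarrow> norm w < 1 \<Longrightarrow> norm (F w) \<le> R"
    using F_bounded by blast
  obtain RA where RA: "RA > 0" "\<And>z. z \<in> A \<Longrightarrow> norm z \<le> RA"
    using compact_imp_bounded[OF cA] unfolding bounded_pos by auto
  define M0 where "M0 = R + RA + norm b0"
  define c where "c = norm cap"
  have c: "c > 0" using cap_nz by (simp add: c_def)
  define \<beta> where "\<beta> = 2 * norm b1 / c"
  define C' where "C' = 2 * C / c"
  have bC: "0 \<le> \<beta>" "0 \<le> C'" using c C by (auto simp: \<beta>_def C'_def)
  have M0: "M0 > 0" using R RA by (auto simp: M0_def intro: add_pos_nonneg)
  \<comment> \<open>All smallness conditions on \<open>\<rho>\<close> are met for \<open>\<rho> < 1 / S\<close>.\<close>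
  define S where "S = 4 + \<beta> + (2 * \<beta> + C') + 2 * M0 / c"
  have S: "S \<ge> 4" "S \<ge> \<beta>" "S \<ge> 2 * \<beta> + C'" "S \<ge> 2 * M0 / c" using bC M0 c by (auto simp: S_def)
  define \<rho>0 where "\<rho>0 = 1 / S"
  have r0: "0 < \<rho>0" "\<rho>0 < 1/2" using S(1) by (auto simp: \<rho>0_def field_simps)
  have main: "\<exists>X \<in> lmeasurable. c2v ` A \<union> c2v ` F ` {w. \<rho> \<le> norm w \<and> norm w < 1} \<subseteq> X \<and>
        measure lebesgue X \<le> (norm cap)\<^sup>2 * (pi * (1/\<rho> + C' * \<rho>\<^sup>2)\<^sup>2)" if \<rho>: "0 < \<rho>" "\<rho> < \<rho>0" for \<rho>
  proof -
    have small: "\<rho> * y \<le> 1" if "y \<le> S" for y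
    proof -
      have "\<rho> * y \<le> \<rho> * S" using that \<rho> by (intro mult_left_mono) auto
      also have "\<dots> \<le> 1" using \<rho> S(1) by (simp add: \<rho>0_def field_simps)
      finally show ?thesis .
    qed
    have "\<rho> < 1" using \<rho> r0 by simp
    then have "\<rho>\<^sup>2 \<le> \<rho>" using \<rho> by (simp add: power2_eq_square)
    then have "norm b1 * \<rho>\<^sup>2 \<le> norm b1 * \<rho>" by (intro mult_left_mono) auto
    also have "\<dots> = (\<rho> * \<beta>) * (c / 2)" using c by (simp add: \<beta>_def)
    also have "\<dots> \<le> 1 * (c / 2)" using small[OF S(2)] c by (intro mult_right_mono) auto
    finally have b1c: "norm b1 * \<rho>\<^sup>2 \<le> c / 2" by simp
    define b where "b = b1 * of_real (\<rho>\<^sup>2)"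
    have nb: "norm b \<le> c / 2" using b1c by (simp add: b_def norm_mult norm_power)
    define T where "T \<zeta> = cap * \<zeta> + b * cnj \<zeta>" for \<zeta>
    have linT: "linear T" by (rule linearI) (simp_all add: T_def algebra_simps)
    have Tlow: "norm \<zeta> \<le> (2 / c) * norm (T \<zeta>)" for \<zeta>
    proof -
      have "norm (cap * \<zeta>) - norm (b * cnj \<zeta>) \<le> norm (T \<zeta>)" unfolding T_def by (rule norm_diff_ineq)
      moreover have "norm (b * cnj \<zeta>) \<le> (c / 2) * norm \<zeta>" using mult_right_mono[OF nb norm_ge_zero[of \<zeta>]] by (simp add: norm_mult)
      ultimately have "(c / 2) * norm \<zeta> \<le> norm (T \<zeta>)" by (simp add: norm_mult c_def[symmetric])
      then show ?thesis using c by (simp add: field_simps)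
    qed
    have "inj T"
      using linear_injective_0[OF linT] Tlow by (metis mult_zero_right norm_le_zero_iff norm_zero)
    then have surj: "surj T" using linear_injective_imp_surjective[OF linT] by blast
    define R' where "R' = 1/\<rho> + C' * \<rho>\<^sup>2"
    have R': "R' \<ge> 0" "R' \<ge> 1/\<rho>" using \<rho> bC by (auto simp: R'_def)
    \<comment> \<open>Points at bounded distance from the centre are covered because \<open>1 / \<rho>\<close> is large.\<close>
    have far: "norm \<zeta> \<le> R'" if "T \<zeta> = z - b0" "norm (z - b0) \<le> M0" for \<zeta> z
    proof -
      have "norm \<zeta> \<le> (2 / c) * M0" using Tlow[of \<zeta>] that c by (smt (verit, best) divide_pos_pos mult_left_mono)
      also have "\<dots> \<le> 1 / \<rho>" using small[OF S(4)] \<rho> by (simp add: field_simps)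
      finally show ?thesis using R' by simp
    qed
    have inT: "\<exists>\<zeta>. norm \<zeta> \<le> R' \<and> z = b0 + T \<zeta>" if z: "z \<in> A \<union> F ` {w. \<rho> \<le> norm w \<and> norm w < 1}" for z
    proof -
      obtain \<zeta> where zt: "T \<zeta> = z - b0" using surj by (metis surjD)
      have "norm \<zeta> \<le> R'"
      proof (cases "z \<in> A")
        case True
        then have "norm (z - b0) \<le> M0" using RA(2)[OF True] norm_triangle_ineq4[of z b0] R by (simp add: M0_def)
        then show ?thesis using far zt by blast
      next
        case False
        then obtain w where w: "z = F w" "\<rho> \<le> norm w" "norm w < 1" using z by auto
        show ?thesis
        proof (cases "1/2 \<le> norm w")
          case True
          then have "norm (z - b0) \<le> M0" using R(2)[of w] w norm_triangle_ineq4[of z b0] RA by (simp add: M0_def)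
          then show ?thesis using far zt by blast
        next
          case False
          define x where "x = norm w"
          have x: "x > 0" "\<rho> \<le> x" "x \<le> 1/2" "w \<noteq> 0" using w False \<rho> by (auto simp: x_def)
          have cw: "cnj (1 / w) = w / of_real (x\<^sup>2)"
          proof -
            have "of_real (x\<^sup>2) = w * cnj w" unfolding x_def by (rule complex_norm_square)
            then show ?thesis using x(4) by simp
          qed
          have "T (\<zeta> - 1 / w) = T \<zeta> - T (1 / w)" using linT by (rule linear_diff)
          also have "\<dots> = b1 * w + w\<^sup>2 * e w - b * (w / of_real (x\<^sup>2))"
            unfolding zt using w x F_expand[of w] Bexp[of w] by (simp only: T_def cw) (simp add: b0_def algebra_simps)
          also have "\<dots> = b1 * w * of_real (1 - \<rho>\<^sup>2 / x\<^sup>2) + w\<^sup>2 * e w"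
            by (simp add: b_def algebra_simps)
          finally have "norm (T (\<zeta> - 1 / w)) \<le> norm (b1 * w * of_real (1 - \<rho>\<^sup>2 / x\<^sup>2)) + norm (w\<^sup>2 * e w)"
            by (simp only: norm_triangle_ineq)
          also have "norm (b1 * w * of_real (1 - \<rho>\<^sup>2 / x\<^sup>2)) = norm b1 * (x * (1 - \<rho>\<^sup>2 / x\<^sup>2))"
          proof -
            have "\<rho>\<^sup>2 \<le> x\<^sup>2" using x \<rho> by (simp add: power_mono)
            then have "0 \<le> 1 - \<rho>\<^sup>2 / x\<^sup>2" using x by simp
            then show ?thesis by (simp only: norm_mult norm_of_real x_def[symmetric] abs_of_nonneg mult.assoc)
          qed
          also have "norm (w\<^sup>2 * e w) \<le> C * x\<^sup>2"
            using C(2)[of w] x by (simp add: norm_mult norm_power x_def[symmetric] mult.commute mult_left_mono)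
          finally have "(2 / c) * norm (T (\<zeta> - 1 / w)) \<le> (2 / c) * (norm b1 * (x * (1 - \<rho>\<^sup>2 / x\<^sup>2)) + C * x\<^sup>2)"
            using c by (intro mult_left_mono) auto
          also have "\<dots> = \<beta> * (x * (1 - \<rho>\<^sup>2 / x\<^sup>2)) + C' * x\<^sup>2"
            by (simp add: \<beta>_def C'_def algebra_simps)
          finally have "norm (\<zeta> - 1 / w) \<le> \<beta> * (x * (1 - \<rho>\<^sup>2 / x\<^sup>2)) + C' * x\<^sup>2"
            using Tlow[of "\<zeta> - 1 / w"] by linarith
          moreover have "norm \<zeta> \<le> norm (1 / w) + norm (\<zeta> - 1 / w)" by (rule norm_triangle_sub)
          moreover have "norm (1 / w) = 1 / x" by (simp add: x_def norm_divide)
          ultimately have "norm \<zeta> \<le> 1 / x + \<beta> * (x * (1 - \<rho>\<^sup>2 / x\<^sup>2)) + C' * x\<^sup>2" by linarith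
          also have "\<dots> \<le> R'" unfolding R'_def
            by (rule radius_comparison[OF \<rho>(1) x(2,3) bC small[OF S(3)]])
          finally show ?thesis .
        qed
      qed
      then show ?thesis using zt by (intro exI[of _ \<zeta>]) simp
    qed
    let ?E = "(\<lambda>x. c2v (cap * v2c x + b * cnj (v2c x))) ` cball 0 R'"
    have E: "?E \<in> lmeasurable" "measure lebesgue ?E \<le> (norm cap)\<^sup>2 * (pi * R'\<^sup>2)"
    proof -
      have "norm b \<le> norm cap" using nb c unfolding c_def by linarith
      then show "?E \<in> lmeasurable" "measure lebesgue ?E \<le> (norm cap)\<^sup>2 * (pi * R'\<^sup>2)"
        using ellipse_area[of b cap R'] R'(1) by blast+
    qed
    let ?X = "(+) (c2v b0) ` ?E"
    have "?X \<in> lmeasurable" using E by (simp add: measurable_translation)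
    moreover have "measure lebesgue ?X \<le> (norm cap)\<^sup>2 * (pi * R'\<^sup>2)" using E by (simp add: measure_translation)
    moreover have "c2v ` A \<union> c2v ` F ` {w. \<rho> \<le> norm w \<and> norm w < 1} \<subseteq> ?X"
    proof
      fix v assume "v \<in> c2v ` A \<union> c2v ` F ` {w. \<rho> \<le> norm w \<and> norm w < 1}"
      then obtain z where z: "v = c2v z" "z \<in> A \<union> F ` {w. \<rho> \<le> norm w \<and> norm w < 1}" by blast
      obtain \<zeta> where "norm \<zeta> \<le> R'" "z = b0 + T \<zeta>" using inT[OF z(2)] by blast
      then have "v = c2v b0 + (\<lambda>x. c2v (cap * v2c x + b * cnj (v2c x))) (c2v \<zeta>)" "c2v \<zeta> \<in> cball 0 R'"
        using z by (auto simp: T_def c2v_add)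
      then show "v \<in> ?X" by blast
    qed
    ultimately show ?thesis unfolding R'_def by blast
  qed
  show ?thesis by (rule that[OF bC(2) r0 main])
qed

text \<open>The area theorem in the form \<open>\<bar>A\<bar> \<le> \<pi> \<bar>cap\<bar>\<^sup>2\<close>. The set \<open>A\<close> is disjoint from the image of an annulus
  \<open>\<rho> < \<bar>w\<bar> < 1 - \<rho>\<close>, and both lie in the ellipse. In the difference of the areas the leading terms
  \<open>\<pi> \<bar>cap\<bar>\<^sup>2 / \<rho>\<^sup>2\<close> cancel, and \<open>\<rho>\<close> tends to \<open>0\<close>.\<close>
lemma cap_area: "measure lebesgue (c2v ` A) \<le> pi * (norm cap)\<^sup>2"
proof -
  obtain C' \<rho>0 where C: "0 \<le> C'" "0 < \<rho>0" "\<rho>0 < 1/2"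
    "\<And>\<rho>. 0 < \<rho> \<Longrightarrow> \<rho> < \<rho>0 \<Longrightarrow>
      \<exists>X \<in> lmeasurable. c2v ` A \<union> c2v ` F ` {w. \<rho> \<le> norm w \<and> norm w < 1} \<subseteq> X \<and>
        measure lebesgue X \<le> (norm cap)\<^sup>2 * (pi * (1/\<rho> + C' * \<rho>\<^sup>2)\<^sup>2)"
    using complement_in_ellipse by blast
  have cA': "c2v ` A \<in> lmeasurable"
    by (intro lmeasurable_compact compact_continuous_image cA continuous_on_c2v continuous_on_id)
  have bound: "measure lebesgue (c2v ` A) \<le> pi * (norm cap)\<^sup>2 * (2 * C' * \<rho> + C'\<^sup>2 * \<rho>^4 + 1 / (1 - \<rho>)\<^sup>2)"
    if \<rho>: "0 < \<rho>" "\<rho> < \<rho>0" for \<rho>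
  proof -
    obtain X where X: "X \<in> lmeasurable" "c2v ` A \<union> c2v ` F ` {w. \<rho> \<le> norm w \<and> norm w < 1} \<subseteq> X"
      "measure lebesgue X \<le> (norm cap)\<^sup>2 * (pi * (1/\<rho> + C' * \<rho>\<^sup>2)\<^sup>2)" using C(4)[OF \<rho>] by blast
    obtain V where V: "V \<in> lmeasurable" "V \<subseteq> c2v ` F ` {w. \<rho> < norm w \<and> norm w < 1 - \<rho>}"
      "measure lebesgue V \<ge> pi * (norm cap)\<^sup>2 * (1/\<rho>\<^sup>2 - 1/(1 - \<rho>)\<^sup>2)"
      using annulus_image_area[of \<rho> "1 - \<rho>"] \<rho> C(3) by auto
    have "V \<inter> c2v ` A = {}"
    proof -
      have "F w \<notin> A" if "\<rho> < norm w" "norm w < 1 - \<rho>" for w using F_notin[of w] that \<rho> by fastforce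
      then show ?thesis using V(2) by (auto simp: image_iff)
    qed
    then have "measure lebesgue (V \<union> c2v ` A) = measure lebesgue V + measure lebesgue (c2v ` A)"
      using fmeasurableD2[OF V(1)] fmeasurableD2[OF cA'] unfolding infinity_ennreal_def[symmetric]
      by (intro measure_Union fmeasurableD V(1) cA')
    moreover have "V \<union> c2v ` A \<subseteq> X"
    proof -
      have "{w. \<rho> < norm w \<and> norm w < 1 - \<rho>} \<subseteq> {w::complex. \<rho> \<le> norm w \<and> norm w < 1}" using \<rho> by auto
      then show ?thesis using V(2) X(2) by (meson Un_least image_mono le_sup_iff order_trans)
    qed
    then have "measure lebesgue (V \<union> c2v ` A) \<le> measure lebesgue X"
      using V(1) cA' X(1) by (intro measure_mono_fmeasurable) auto
    ultimately have "measure lebesgue (c2v ` A) \<le> (norm cap)\<^sup>2 * (pi * (1/\<rho> + C' * \<rho>\<^sup>2)\<^sup>2) - pi * (norm cap)\<^sup>2 * (1/\<rho>\<^sup>2 - 1/(1 - \<rho>)\<^sup>2)"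
      using V(3) X(3) by linarith
    also have "\<dots> = pi * (norm cap)\<^sup>2 * ((1/\<rho> + C' * \<rho>\<^sup>2)\<^sup>2 - (1/\<rho>\<^sup>2 - 1/(1 - \<rho>)\<^sup>2))"
      by (simp add: algebra_simps)
    also have "(1/\<rho> + C' * \<rho>\<^sup>2)\<^sup>2 = 1/\<rho>\<^sup>2 + 2 * C' * \<rho> + C'\<^sup>2 * \<rho>^4"
      using \<rho> by (simp add: power2_eq_square field_simps eval_nat_numeral)
    also have "1/\<rho>\<^sup>2 + 2 * C' * \<rho> + C'\<^sup>2 * \<rho>^4 - (1/\<rho>\<^sup>2 - 1/(1 - \<rho>)\<^sup>2) = 2 * C' * \<rho> + C'\<^sup>2 * \<rho>^4 + 1 / (1 - \<rho>)\<^sup>2"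
      by simp
    finally show ?thesis .
  qed
  have "((\<lambda>\<rho>. pi * (norm cap)\<^sup>2 * (2 * C' * \<rho> + C'\<^sup>2 * \<rho>^4 + 1 / (1 - \<rho>)\<^sup>2)) \<longlongrightarrow>
      pi * (norm cap)\<^sup>2 * (2 * C' * 0 + C'\<^sup>2 * 0^4 + 1 / (1 - 0)\<^sup>2)) (at_right 0)"
    by (intro tendsto_intros) auto
  moreover have "\<forall>\<^sub>F \<rho> in at_right 0. measure lebesgue (c2v ` A) \<le> pi * (norm cap)\<^sup>2 * (2 * C' * \<rho> + C'\<^sup>2 * \<rho>^4 + 1 / (1 - \<rho>)\<^sup>2)"
    using eventually_at_right_real[OF C(2)] by eventually_elim (auto intro: bound)
  ultimately have "measure lebesgue (c2v ` A) \<le> pi * (norm cap)\<^sup>2 * (2 * C' * 0 + C'\<^sup>2 * 0^4 + 1 / (1 - 0)\<^sup>2)"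
    by (intro tendsto_lowerbound) auto
  then show ?thesis by simp
qed

end

section \<open>Boundary values of the conformal map\<close>

lemma at_left_1_unit: "\<forall>\<^sub>F r::real in at_left 1. r \<in> {0<..<1}"
  by (rule eventually_at_left_real) simp

text \<open>The mean value inequality in the convex set \<open>ball 0 1 \<inter> ball w0 d\<close>, on which the derivative is close to
  \<open>dh w0\<close>, extended to the closed disc along radii.\<close>
lemma holomorphic_boundary_derivative:
  fixes f fh dh :: "complex \<Rightarrow> complex"
  assumes f: "f holomorphic_on ball 0 1"
    and fh: "continuous_on (cball 0 1) fh" "\<And>w. w \<in> ball 0 1 \<Longrightarrow> fh w = f w"
    and dh: "continuous_on (cball 0 1) dh" "\<And>w. w \<in> ball 0 1 \<Longrightarrow> dh w = deriv f w"
    and w0: "w0 \<in> cball 0 1"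
  shows "(fh has_field_derivative dh w0) (at w0 within cball 0 1)"
  unfolding has_field_derivative_def has_derivative_within_alt
proof (intro conjI allI impI)
  show "bounded_linear ((*) (dh w0))" by (rule bounded_linear_mult_right)
  fix e :: real assume e: "e > 0"
  obtain d where d: "d > 0" "\<And>w. w \<in> cball 0 1 \<Longrightarrow> dist w w0 < d \<Longrightarrow> dist (dh w) (dh w0) < e"
    using dh(1) w0 e unfolding continuous_on_iff by blast
  have "norm (fh y - fh w0 - dh w0 * (y - w0)) \<le> e * norm (y - w0)"
    if y: "y \<in> cball 0 1" "norm (y - w0) < d" for y
  proof -
    define X where "X = ball 0 1 \<inter> ball w0 d"
    have X: "convex X" "X \<subseteq> ball 0 1" by (auto simp: X_def convex_Int)
    have bnd: "norm ((f z - dh w0 * z) - (f z' - dh w0 * z')) \<le> e * norm (z - z')" if "z \<in> X" "z' \<in> X" for z z'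
    proof (rule field_differentiable_bound[OF X(1)])
      fix v assume v: "v \<in> X"
      then have vb: "v \<in> ball 0 1" using X by blast
      have "(f has_field_derivative deriv f v) (at v)" using f vb by (intro holomorphic_derivI[OF _ open_ball])
      then show "((\<lambda>z. f z - dh w0 * z) has_field_derivative deriv f v - dh w0) (at v within X)"
        by (auto intro!: derivative_eq_intros intro: has_field_derivative_at_within)
      have "dist (dh v) (dh w0) < e" using v by (intro d(2)) (auto simp: X_def dist_commute)
      then show "norm (deriv f v - dh w0) \<le> e" using dh(2)[OF vb] by (simp add: dist_norm)
    qed (use that in auto)
    have lim: "((\<lambda>r. fh (of_real r * z)) \<longlongrightarrow> fh z) (at_left 1)" if z: "z \<in> cball 0 1" for z
    proof -
      have "((\<lambda>r::real. of_real r * z) \<longlongrightarrow> of_real 1 * z) (at_left 1)" by (intro tendsto_intros)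
      then have "((\<lambda>r::real. of_real r * z) \<longlongrightarrow> z) (at_left 1)" by simp
      moreover have "\<forall>\<^sub>F r::real in at_left 1. of_real r * z \<in> cball 0 1"
        using at_left_1_unit by eventually_elim (use z in \<open>auto simp: norm_mult mult_le_one\<close>)
      ultimately show ?thesis by (rule continuous_on_tendsto_compose[OF fh(1) _ z])
    qed
    have "((\<lambda>r::real. norm ((fh (of_real r * y) - dh w0 * (of_real r * y)) - (fh (of_real r * w0) - dh w0 * (of_real r * w0))))
       \<longlongrightarrow> norm ((fh y - dh w0 * (of_real 1 * y)) - (fh w0 - dh w0 * (of_real 1 * w0)))) (at_left 1)"
      using y w0 by (intro tendsto_intros lim)
    moreover have "((\<lambda>r::real. e * norm (of_real r * y - of_real r * w0)) \<longlongrightarrow> e * norm (of_real 1 * y - of_real 1 * w0)) (at_left 1)"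
      by (intro tendsto_intros)
    moreover have "\<forall>\<^sub>F r::real in at_left 1. norm ((fh (of_real r * y) - dh w0 * (of_real r * y)) - (fh (of_real r * w0) - dh w0 * (of_real r * w0)))
        \<le> e * norm (of_real r * y - of_real r * w0)"
    proof -
      have inX: "\<forall>\<^sub>F r::real in at_left 1. of_real r * z \<in> X" if z: "z \<in> cball 0 1" "norm (z - w0) < d" for z
      proof -
        have "((\<lambda>r::real. of_real r * z) \<longlongrightarrow> of_real 1 * z) (at_left 1)" by (intro tendsto_intros)
        then have "\<forall>\<^sub>F r::real in at_left 1. of_real r * z \<in> ball w0 d"
          using z by (intro topological_tendstoD[where S="ball w0 d"]) (auto simp: dist_norm norm_minus_commute)
        then show ?thesis using at_left_1_unit
        proof eventually_elim
          case (elim r)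
          have "r * norm z \<le> r * 1" using z elim by (intro mult_left_mono) auto
          also have "\<dots> < 1" using elim by simp
          finally show ?case using elim unfolding X_def by (simp add: norm_mult)
        qed
      qed
      have "\<forall>\<^sub>F r::real in at_left 1. of_real r * y \<in> X" using inX y by blast
      moreover have "\<forall>\<^sub>F r::real in at_left 1. of_real r * w0 \<in> X" using inX[of w0] w0 d(1) by simp
      ultimately show ?thesis
      proof eventually_elim
        case (elim r)
        have "fh (of_real r * y) = f (of_real r * y)" "fh (of_real r * w0) = f (of_real r * w0)"
          using elim X(2) fh(2) by blast+
        then show ?case using bnd[OF elim] by simp
      qed
    qed
    ultimately have "norm ((fh y - dh w0 * (of_real 1 * y)) - (fh w0 - dh w0 * (of_real 1 * w0))) \<le> e * norm (of_real 1 * y - of_real 1 * w0)"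
      by (intro tendsto_le[of "at_left (1::real)"]) auto
    then show ?thesis by (simp add: algebra_simps)
  qed
  then show "\<exists>d>0. \<forall>y\<in>cball 0 1. norm (y - w0) < d \<longrightarrow> norm (fh y - fh w0 - dh w0 * (y - w0)) \<le> e * norm (y - w0)"
    using d(1) by blast
qed

lemma continuous_on_cball_glue:
  fixes f g :: "complex \<Rightarrow> complex"
  assumes f: "continuous_on (ball 0 1) f" and g: "continuous_on (cball 0 1 - {0}) g"
    and eq: "\<And>w. w \<in> ball 0 1 \<Longrightarrow> w \<noteq> 0 \<Longrightarrow> f w = g w"
  shows "continuous_on (cball 0 1) (\<lambda>w. if w \<in> ball 0 1 then f w else g w)"
proof -
  have U: "cball 0 1 = ball 0 1 \<union> (cball 0 1 - {0::complex})" by auto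
  have o1: "openin (top_of_set (ball 0 1 \<union> (cball 0 1 - {0}))) (ball 0 (1::real) :: complex set)"
    using openin_open_Int[OF open_ball[of 0 1], of "ball 0 1 \<union> (cball 0 1 - {0::complex})"] by (simp add: Int_absorb1)
  have "(ball 0 1 \<union> (cball 0 1 - {0})) \<inter> - {0} = cball 0 1 - {0::complex}" by auto
  then have o2: "openin (top_of_set (ball 0 1 \<union> (cball 0 1 - {0}))) (cball 0 1 - {0::complex})"
    unfolding openin_open by (intro exI[of _ "- {0}"]) auto
  show ?thesis
    by (subst U, rule continuous_on_cases_local_open[OF o1 o2 f g]) (use eq in auto)
qed

text \<open>By the maximum principle the imaginary part vanishes in the disc, hence so does the derivative.\<close>
lemma real_boundary_values_imp_constant:
  fixes f fh :: "complex \<Rightarrow> complex"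
  assumes f: "f holomorphic_on ball 0 1"
    and fh: "continuous_on (cball 0 1) fh" "\<And>w. w \<in> ball 0 1 \<Longrightarrow> fh w = f w"
    and re: "\<And>w. norm w = 1 \<Longrightarrow> Im (fh w) = 0"
    and w: "w \<in> ball 0 1"
  shows "f w = f 0"
proof -
  have le: "\<sigma> * Im (f w) \<le> 0" if w: "w \<in> ball 0 1" for \<sigma> w
  proof (rule harmonic_max_principle[where S = "ball 0 1" and h = "\<lambda>z. \<sigma> * Im (f z)" and z = w and K = "\<lambda>z. of_real \<sigma> * (- \<i>) * deriv f z"])
    show "(\<lambda>z. of_real \<sigma> * (- \<i>) * deriv f z) holomorphic_on ball 0 1"
      by (intro holomorphic_intros holomorphic_deriv f open_ball)
    fix z :: complex assume z: "z \<in> ball 0 1"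
    have "(f has_derivative (*) (deriv f z)) (at z)"
      using holomorphic_derivI[OF f open_ball z] by (simp add: has_field_derivative_def)
    then have "((\<lambda>z. Im (f z)) has_derivative (\<lambda>v. Im (deriv f z * v))) (at z)" by (rule has_derivative_Im)
    then have "((\<lambda>z. \<sigma> * Im (f z)) has_derivative (\<lambda>v. \<sigma> * Im (deriv f z * v))) (at z)" by (rule has_derivative_mult_right)
    then show "((\<lambda>z. \<sigma> * Im (f z)) has_derivative (\<lambda>v. Re (of_real \<sigma> * (- \<i>) * deriv f z * v))) (at z)"
      by (simp add: algebra_simps)
  next
    fix \<epsilon> :: real assume ep: "\<epsilon> > 0"
    have "{z \<in> ball 0 1. \<epsilon> \<le> \<sigma> * Im (f z)} = cball 0 1 \<inter> (\<lambda>z. \<sigma> * Im (fh z)) -` {\<epsilon>..}"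
    proof (rule set_eqI)
      fix z :: complex
      consider "norm z < 1" | "norm z = 1" | "norm z > 1" by linarith
      then show "z \<in> {z \<in> ball 0 1. \<epsilon> \<le> \<sigma> * Im (f z)} \<longleftrightarrow> z \<in> cball 0 1 \<inter> (\<lambda>z. \<sigma> * Im (fh z)) -` {\<epsilon>..}"
        by cases (use fh(2)[of z] re[of z] ep in auto)
    qed
    moreover have "closed (cball 0 1 \<inter> (\<lambda>z. \<sigma> * Im (fh z)) -` {\<epsilon>..})"
      by (intro continuous_closed_preimage continuous_intros fh(1)) auto
    ultimately show "closed {z \<in> ball 0 1. \<epsilon> \<le> \<sigma> * Im (f z)}" by simp
  qed (use w in auto)
  have Im0: "Im (f w) = 0" if "w \<in> ball 0 1" for w using le[OF that, of 1] le[OF that, of "-1"] by simp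
  have "deriv f w = 0" if w: "w \<in> ball 0 1" for w
  proof -
    have "(f has_derivative (*) (deriv f w)) (at w)"
      using holomorphic_derivI[OF f open_ball w] by (simp add: has_field_derivative_def)
    then have "((\<lambda>z. Im (f z)) has_derivative (\<lambda>v. Im (deriv f w * v))) (at w)" by (rule has_derivative_Im)
    moreover have "((\<lambda>z. Im (f z)) has_derivative (\<lambda>v. 0)) (at w)"
      by (rule has_derivative_transform_within_open[OF has_derivative_const[of 0 "at w"] open_ball w]) (simp add: Im0)
    ultimately have "(\<lambda>v. Im (deriv f w * v)) = (\<lambda>v. 0)" by (rule has_derivative_unique)
    then have "Im (deriv f w * 1) = 0" "Im (deriv f w * \<i>) = 0" by meson+
    then show ?thesis by (simp add: complex_eq_iff)
  qed
  then have "\<exists>c. \<forall>x\<in>ball 0 1. f x = c"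
    using holomorphic_derivI[OF f open_ball]
    by (intro has_field_derivative_zero_constant) (auto intro: has_field_derivative_at_within simp: convex_ball)
  then show ?thesis using w by auto
qed

context exterior_map begin

lemma deriv_B:
  assumes w: "w \<in> ball 0 1" "w \<noteq> 0"
  shows "deriv B w = (cap - \<kappa> w) / w\<^sup>2"
proof -
  have "(F has_field_derivative - \<kappa> w / w\<^sup>2) (at w)" by (rule F_deriv[OF w])
  moreover have "((\<lambda>w. a + cap / w + B w) has_field_derivative (- cap / w\<^sup>2 + deriv B w)) (at w)"
    using w holomorphic_derivI[OF B_hol open_ball w(1)]
    by (auto intro!: derivative_eq_intros simp: power2_eq_square)
  then have "(F has_field_derivative (- cap / w\<^sup>2 + deriv B w)) (at w)"
  proof (rule has_field_derivative_transform_within_open[where S = "ball 0 1 - {0}"])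
    show "open (ball 0 1 - {0::complex})" by (auto intro: open_delete)
  qed (use w F_expand in auto)
  ultimately have "- \<kappa> w / w\<^sup>2 = - cap / w\<^sup>2 + deriv B w" by (rule DERIV_unique)
  then have "deriv B w = - \<kappa> w / w\<^sup>2 - (- cap / w\<^sup>2)" by (metis add_diff_cancel_left')
  then show ?thesis by (simp add: diff_divide_distrib)
qed

text \<open>The continuous extension \<open>g\<close> of \<open>- w / \<kappa>\<close> has a positive lower bound near the frontier of \<open>A\<close>, and
  \<open>F w\<close> is close to the frontier when \<open>w\<close> is close to the circle.\<close>
lemma kap_bounded:
  assumes g: "continuous_on (closure (- A)) g" and gz: "\<And>z. z \<in> frontier A \<Longrightarrow> g z \<noteq> 0"
    and gF: "\<And>w. w \<in> ball 0 1 \<Longrightarrow> w \<noteq> 0 \<Longrightarrow> g (F w) = - w / \<kappa> w"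
  obtains K where "\<And>w. w \<in> ball 0 1 \<Longrightarrow> norm (\<kappa> w) \<le> K"
proof -
  have cfr: "compact (frontier A)" using cA by (rule compact_frontier)
  have frsub: "frontier A \<subseteq> closure (- A)" by (simp add: frontier_closures)
  have "\<exists>m>0. \<forall>z\<in>frontier A. m \<le> norm (g z)"
  proof (cases "frontier A = {}")
    case True then show ?thesis by (intro exI[of _ 1]) auto
  next
    case False
    obtain z where "z \<in> frontier A" "\<And>y. y \<in> frontier A \<Longrightarrow> norm (g z) \<le> norm (g y)"
      using continuous_attains_inf[OF cfr False, of "\<lambda>z. norm (g z)"] continuous_on_norm[OF continuous_on_subset[OF g frsub]] by blast
    then show ?thesis using gz by (intro exI[of _ "norm (g z)"]) auto
  qed
  then obtain m where m: "m > 0" "\<And>z. z \<in> frontier A \<Longrightarrow> m \<le> norm (g z)" by blast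
  obtain R where R: "R > 0" "\<And>w. 1/2 \<le> norm w \<Longrightarrow> norm w < 1 \<Longrightarrow> norm (F w) \<le> R" using F_bounded by blast
  define Q where "Q = (closure (- A) \<inter> (\<lambda>z. norm (g z)) -` {..m/2}) \<inter> cball 0 R"
  have "closed (closure (- A) \<inter> (\<lambda>z. norm (g z)) -` {..m/2})"
    by (intro continuous_closed_preimage continuous_intros g) auto
  then have "compact Q" unfolding Q_def by (rule closed_Int_compact) simp
  moreover have "Q \<subseteq> - A"
  proof
    fix z assume z: "z \<in> Q"
    have "z \<notin> frontier A" using z m(2)[of z] m(1) by (auto simp: Q_def)
    then show "z \<in> - A" using z closure_subset[of A] by (auto simp: Q_def frontier_closures)
  qed
  ultimately obtain \<rho> where \<rho>: "0 < \<rho>" "\<rho> < 1" "\<And>w. \<rho> < norm w \<Longrightarrow> norm w < 1 \<Longrightarrow> F w \<notin> Q"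
    using F_proper by blast
  define r where "r = max \<rho> (1/2)"
  have "\<kappa> holomorphic_on cball 0 r" by (rule holomorphic_on_subset[OF kap_hol]) (use \<rho> in \<open>auto simp: r_def\<close>)
  then have "continuous_on (cball 0 r) \<kappa>" by (rule holomorphic_on_imp_continuous_on)
  then have "bounded (\<kappa> ` cball 0 r)" by (intro compact_imp_bounded compact_continuous_image) auto
  then obtain K0 where "\<forall>x\<in>\<kappa> ` cball 0 r. norm x \<le> K0" unfolding bounded_iff by blast
  then have K0: "norm (\<kappa> w) \<le> K0" if "norm w \<le> r" for w using that by simp
  show ?thesis
  proof (rule that[of "max K0 (2/m)"])
    fix w :: complex assume w: "w \<in> ball 0 1"
    show "norm (\<kappa> w) \<le> max K0 (2/m)"
    proof (cases "norm w \<le> r")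
      case True then show ?thesis using K0[of w] by simp
    next
      case False
      then have w2: "\<rho> < norm w" "1/2 \<le> norm w" "norm w < 1" "w \<noteq> 0" using w \<rho> by (auto simp: r_def)
      have "F w \<in> closure (- A)" using F_notin[OF w w2(4)] closure_subset by fastforce
      moreover have "F w \<notin> Q" by (rule \<rho>(3)[OF w2(1,3)])
      ultimately have "m / 2 < norm (g (F w))" using R(2)[OF w2(2,3)] by (auto simp: Q_def)
      also have "norm (g (F w)) = norm w / norm (\<kappa> w)" using gF[OF w w2(4)] by (simp add: norm_divide)
      also have "\<dots> \<le> 1 / norm (\<kappa> w)" using w2 by (intro divide_right_mono) auto
      finally have "norm (\<kappa> w) \<le> 2 / m" using m kap_nz[OF w] by (simp add: field_simps)
      then show ?thesis by simp
    qed
  qed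
qed

lemma B_lipschitz:
  assumes K: "\<And>w. w \<in> ball 0 1 \<Longrightarrow> norm (\<kappa> w) \<le> K"
  obtains L where "L-lipschitz_on (ball 0 1) B"
proof -
  have "deriv B holomorphic_on cball 0 (1/2)"
    by (rule holomorphic_on_subset[OF holomorphic_deriv[OF B_hol open_ball]]) auto
  then have "continuous_on (cball 0 (1/2)) (deriv B)" by (rule holomorphic_on_imp_continuous_on)
  then have "bounded (deriv B ` cball 0 (1/2))" by (intro compact_imp_bounded compact_continuous_image) auto
  then obtain L0 where L0: "L0 > 0" "\<And>w. norm w \<le> 1/2 \<Longrightarrow> norm (deriv B w) \<le> L0" unfolding bounded_pos by auto
  have K0: "K \<ge> 0" using K[of 0] norm_ge_zero order_trans by (metis centre_in_ball zero_less_one)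
  define L where "L = L0 + 4 * (norm cap + K)"
  have bd: "norm (deriv B w) \<le> L" if w: "w \<in> ball 0 1" for w
  proof (cases "norm w \<le> 1/2")
    case True
    have "0 \<le> 4 * (norm cap + K)" using K0 by simp
    then show ?thesis unfolding L_def using L0(2)[OF True] by linarith
  next
    case False
    then have "w \<noteq> 0" by auto
    have "1/4 \<le> (norm w)\<^sup>2" using False power_mono[of "1/2" "norm w" 2] by (simp add: power2_eq_square)
    moreover have "norm (cap - \<kappa> w) \<le> norm cap + K" using norm_triangle_ineq4[of cap "\<kappa> w"] K[OF w] by linarith
    ultimately have "norm (cap - \<kappa> w) / (norm w)\<^sup>2 \<le> (norm cap + K) / (1/4)" using K0 by (intro frac_le add_nonneg_nonneg) auto
    then show ?thesis using deriv_B[OF w \<open>w \<noteq> 0\<close>] L0 by (simp add: L_def norm_divide norm_power)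
  qed
  have "L-lipschitz_on (ball 0 1) B"
  proof (rule lipschitz_onI)
    fix x y :: complex assume xy: "x \<in> ball 0 1" "y \<in> ball 0 1"
    have "norm (B x - B y) \<le> L * norm (x - y)"
      by (rule field_differentiable_bound[OF convex_ball _ bd xy])
         (use holomorphic_derivI[OF B_hol open_ball] in \<open>auto intro: has_field_derivative_at_within\<close>)
    then show "dist (B x) (B y) \<le> L * dist x y" by (simp add: dist_norm)
  qed (use L0 K0 in \<open>simp add: L_def\<close>)
  then show ?thesis by (rule that)
qed

text \<open>A bounded \<open>\<kappa>\<close> makes \<open>B\<close> Lipschitz, so \<open>F\<close> extends continuously to the circle, with values on the
  frontier because \<open>F\<close> is proper. Then \<open>\<kappa> w = - w / g (F w)\<close> extends as well, thus also the derivative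
  of \<open>B\<close>, and the extended \<open>F\<close> is differentiable along the circle.\<close>
lemma boundary_curve:
  assumes g: "continuous_on (closure (- A)) g" and gz: "\<And>z. z \<in> frontier A \<Longrightarrow> g z \<noteq> 0"
    and gF: "\<And>w. w \<in> ball 0 1 \<Longrightarrow> w \<noteq> 0 \<Longrightarrow> g (F w) = - w / \<kappa> w"
  obtains kh \<gamma> where "continuous_on (cball 0 1) kh" "\<And>w. w \<in> ball 0 1 \<Longrightarrow> kh w = \<kappa> w"
    "\<And>w. w \<in> cball 0 1 \<Longrightarrow> kh w \<noteq> 0" "\<And>t. \<gamma> t \<in> frontier A"
    "\<And>t. (\<gamma> has_vector_derivative (- \<i> * kh (cis t) * cis (- t))) (at t)"
    "\<And>t. g (\<gamma> t) = - cis t / kh (cis t)"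
proof -
  obtain K where K: "\<And>w. w \<in> ball 0 1 \<Longrightarrow> norm (\<kappa> w) \<le> K" using kap_bounded[OF g gz gF] by blast
  obtain L where L: "L-lipschitz_on (ball 0 1) B" using B_lipschitz[OF K] by blast
  obtain Bh where Bh: "uniformly_continuous_on (closure (ball 0 1)) Bh" "\<And>w. w \<in> ball 0 1 \<Longrightarrow> B w = Bh w"
    using uniformly_continuous_on_extension_on_closure[OF lipschitz_on_uniformly_continuous[OF L]] by metis
  have cBh: "continuous_on (cball 0 1) Bh" using uniformly_continuous_imp_continuous[OF Bh(1)] by simp
  define Fh where "Fh w = a + cap / w + Bh w" for w
  have cFh: "continuous_on (cball 0 1 - {0}) Fh"
    unfolding Fh_def by (intro continuous_intros continuous_on_subset[OF cBh]) auto
  have FhF: "Fh w = F w" if "w \<in> ball 0 1" "w \<noteq> 0" for w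
    using F_expand[OF that] Bh(2)[OF that(1)] by (simp add: Fh_def)
  have frF: "Fh w \<in> frontier A" if w: "norm w = 1" for w
  proof -
    have lim: "((\<lambda>r::real. Fh (of_real r * w)) \<longlongrightarrow> Fh w) (at_left 1)"
    proof -
      have "((\<lambda>r::real. of_real r * w) \<longlongrightarrow> of_real 1 * w) (at_left 1)" by (intro tendsto_intros)
      then have "((\<lambda>r::real. of_real r * w) \<longlongrightarrow> w) (at_left 1)" by simp
      moreover have "\<forall>\<^sub>F r::real in at_left 1. of_real r * w \<in> cball 0 1 - {0}"
        using at_left_1_unit by eventually_elim (use w in \<open>auto simp: norm_mult\<close>)
      moreover have "w \<in> cball 0 1 - {0}" using w by auto
      ultimately show ?thesis using continuous_on_tendsto_compose[OF cFh] by blast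
    qed
    have ev: "\<forall>\<^sub>F r::real in at_left 1. Fh (of_real r * w) = F (of_real r * w) \<and> F (of_real r * w) \<notin> A"
      using at_left_1_unit
    proof eventually_elim
      case (elim r)
      then have "of_real r * w \<in> ball 0 1" "of_real r * w \<noteq> 0" using w by (auto simp: norm_mult)
      then show ?case using FhF F_notin by blast
    qed
    have cl: "Fh w \<in> closure (- A)"
    proof (rule Lim_in_closed_set[OF closed_closure _ _ lim])
      show "\<forall>\<^sub>F r::real in at_left 1. Fh (of_real r * w) \<in> closure (- A)"
        using ev by eventually_elim (use closure_subset in fastforce)
    qed simp
    have "Fh w \<in> A"
    proof (rule ccontr)
      assume nA: "Fh w \<notin> A"
      have "open (- A)" using compact_imp_closed[OF cA] by (rule open_Compl)
      then obtain e where e: "e > 0" "cball (Fh w) e \<subseteq> - A" using nA open_contains_cball by (metis ComplI)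
      obtain \<rho> where \<rho>: "0 < \<rho>" "\<rho> < 1" "\<And>w'. \<rho> < norm w' \<Longrightarrow> norm w' < 1 \<Longrightarrow> F w' \<notin> cball (Fh w) e"
        using F_proper[OF compact_cball e(2)] by blast
      have "\<forall>\<^sub>F r::real in at_left 1. Fh (of_real r * w) \<in> ball (Fh w) e"
        using e by (intro topological_tendstoD[OF lim open_ball]) auto
      then have "\<forall>\<^sub>F r::real in at_left 1. False"
        using ev eventually_at_left_real[OF \<rho>(2)]
      proof eventually_elim
        case (elim r)
        then have "norm (of_real r * w) = r" using w \<rho> by (simp add: norm_mult)
        then have "F (of_real r * w) \<notin> cball (Fh w) e" using \<rho>(3) elim by auto
        then show False using elim by auto
      qed
      then show False by simp
    qed
    then show ?thesis using cl closure_subset by (auto simp: frontier_closures)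
  qed
  have clF: "Fh w \<in> closure (- A)" if "w \<in> cball 0 1" "w \<noteq> 0" for w
  proof (cases "norm w = 1")
    case True then show ?thesis using frF[OF True] by (simp add: frontier_closures)
  next
    case False
    then have "w \<in> ball 0 1" using that by auto
    then show ?thesis using FhF F_notin that closure_subset by fastforce
  qed
  have gnz: "g (Fh w) \<noteq> 0" if w: "w \<in> cball 0 1" "w \<noteq> 0" for w
  proof (cases "norm w = 1")
    case True then show ?thesis using frF gz by blast
  next
    case False
    then have wb: "w \<in> ball 0 1" using w by auto
    then show ?thesis using FhF[OF wb w(2)] gF[OF wb w(2)] w(2) kap_nz[OF wb] by simp
  qed
  have cgF: "continuous_on (cball 0 1 - {0}) (\<lambda>w. g (Fh w))"
    by (rule continuous_on_compose2[OF g cFh]) (use clF in force)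
  define kh where "kh w = (if w \<in> ball 0 1 then \<kappa> w else - w / g (Fh w))" for w
  have kk: "\<kappa> w = - w / g (Fh w)" if w: "w \<in> ball 0 1" "w \<noteq> 0" for w
    using gF[OF w] FhF[OF w] w kap_nz[OF w(1)] by simp
  have ckh: "continuous_on (cball 0 1) kh"
    unfolding kh_def
  proof (rule continuous_on_cball_glue)
    show "continuous_on (ball 0 1) \<kappa>" using kap_hol by (rule holomorphic_on_imp_continuous_on)
    show "continuous_on (cball 0 1 - {0}) (\<lambda>w. - w / g (Fh w))"
      by (intro continuous_intros cgF) (use gnz in auto)
  qed (rule kk)
  have khnz: "kh w \<noteq> 0" if "w \<in> cball 0 1" for w
  proof (cases "w \<in> ball 0 1")
    case True then show ?thesis using kap_nz by (simp add: kh_def)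
  next
    case False
    then have "w \<noteq> 0" by auto
    then show ?thesis using False gnz[OF that] by (simp add: kh_def)
  qed
  define dh where "dh w = (if w \<in> ball 0 1 then deriv B w else (cap - kh w) / w\<^sup>2)" for w
  have cdh: "continuous_on (cball 0 1) dh"
    unfolding dh_def
  proof (rule continuous_on_cball_glue)
    show "continuous_on (ball 0 1) (deriv B)"
      by (intro holomorphic_on_imp_continuous_on holomorphic_deriv B_hol open_ball)
    show "continuous_on (cball 0 1 - {0}) (\<lambda>w. (cap - kh w) / w\<^sup>2)"
      by (intro continuous_intros continuous_on_subset[OF ckh]) auto
    show "deriv B w = (cap - kh w) / w\<^sup>2" if "w \<in> ball 0 1" "w \<noteq> 0" for w
      using deriv_B[OF that] that by (simp add: kh_def)
  qed
  define \<gamma> where "\<gamma> t = Fh (cis t)" for t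
  have gd: "(\<gamma> has_vector_derivative (- \<i> * kh (cis t) * cis (- t))) (at t)" for t
  proof -
    have c: "(cis has_vector_derivative \<i> * cis t) (at t)"
      using has_derivative_cis[OF has_derivative_ident[of "at t"]] by (simp add: has_vector_derivative_def)
    have "(Bh has_field_derivative dh (cis t)) (at (cis t) within cball 0 1)"
      by (rule holomorphic_boundary_derivative[OF B_hol cBh _ cdh]) (auto simp: Bh(2) dh_def)
    then have "(Bh has_field_derivative dh (cis t)) (at (cis t) within cis ` UNIV)"
      by (rule has_field_derivative_subset) auto
    from field_vector_diff_chain_within[OF c this]
    have 1: "((\<lambda>t. Bh (cis t)) has_vector_derivative \<i> * cis t * dh (cis t)) (at t)" by (simp add: o_def)
    have "((\<lambda>z. a + cap / z) has_field_derivative - cap / (cis t)\<^sup>2) (at (cis t))"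
      by (auto intro!: derivative_eq_intros simp: power2_eq_square)
    from field_vector_diff_chain_at[OF c this]
    have 2: "((\<lambda>t. a + cap / cis t) has_vector_derivative \<i> * cis t * (- cap / (cis t)\<^sup>2)) (at t)" by (simp add: o_def)
    have "(\<gamma> has_vector_derivative \<i> * cis t * (- cap / (cis t)\<^sup>2) + \<i> * cis t * dh (cis t)) (at t)"
      using has_vector_derivative_add[OF 2 1] by (simp add: \<gamma>_def[abs_def] Fh_def)
    moreover have "\<i> * cis t * (- cap / (cis t)\<^sup>2) + \<i> * cis t * dh (cis t) = - \<i> * kh (cis t) * cis (- t)"
    proof -
      have "dh (cis t) = (cap - kh (cis t)) / (cis t)\<^sup>2" by (simp add: dh_def)
      then have e: "cis t * dh (cis t) = (cap - kh (cis t)) / cis t" by (simp add: power2_eq_square)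
      have "\<i> * cis t * (- cap / (cis t)\<^sup>2) = - (\<i> * cap / cis t)" by (simp add: power2_eq_square)
      moreover have "\<i> * cis t * dh (cis t) = \<i> * cap / cis t - \<i> * kh (cis t) / cis t"
        unfolding mult.assoc e by (simp add: diff_divide_distrib right_diff_distrib)
      ultimately have "\<i> * cis t * (- cap / (cis t)\<^sup>2) + \<i> * cis t * dh (cis t) = - \<i> * kh (cis t) / cis t"
        by simp
      then show ?thesis by (simp add: divide_inverse)
    qed
    ultimately show ?thesis by simp
  qed
  show ?thesis
  proof (rule that[of kh \<gamma>, OF ckh _ khnz _ gd])
    show "kh w = \<kappa> w" if "w \<in> ball 0 1" for w using that by (simp add: kh_def)
    show "\<gamma> t \<in> frontier A" for t unfolding \<gamma>_def by (rule frF) simp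
    show "g (\<gamma> t) = - cis t / kh (cis t)" for t
      using gnz[of "cis t"] by (simp add: kh_def \<gamma>_def)
  qed
qed

lemma constant_kap_imp_disc:
  assumes k: "\<And>w. w \<in> ball 0 1 \<Longrightarrow> \<kappa> w = cap"
  shows "A = cball (a + B 0) (norm cap)"
    and "\<And>w. w \<in> ball 0 1 \<Longrightarrow> w \<noteq> 0 \<Longrightarrow> F w = a + B 0 + cap / w"
proof -
  have dB0: "deriv B w = 0" if "w \<in> ball 0 1 - {0}" for w using deriv_B[of w] k that by simp
  have "continuous_on (ball 0 1) B" using B_hol by (rule holomorphic_on_imp_continuous_on)
  have "\<exists>c. \<forall>x\<in>ball 0 1. B x = c"
  proof -
    have "deriv B w = 0" if w: "w \<in> ball 0 1" for w
    proof (rule ccontr)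
      assume nz: "deriv B w \<noteq> 0"
      then have w0: "w = 0" using dB0 w by auto
      have "isCont (deriv B) 0"
        using holomorphic_on_imp_continuous_on[OF holomorphic_deriv[OF B_hol open_ball]] continuous_on_interior by fastforce
      then have "((deriv B) \<longlongrightarrow> deriv B 0) (at 0)" by (simp add: isCont_def)
      moreover have "\<forall>\<^sub>F w in at 0. deriv B w = 0"
        unfolding eventually_at using dB0 by (intro exI[of _ 1]) auto
      then have "((deriv B) \<longlongrightarrow> 0) (at 0)" by (rule tendsto_eventually)
      ultimately have "deriv B 0 = 0" using LIM_unique by blast
      then show False using nz w0 by simp
    qed
    then show ?thesis
      using holomorphic_derivI[OF B_hol open_ball]
      by (intro has_field_derivative_zero_constant) (auto intro: has_field_derivative_at_within simp: convex_ball)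
  qed
  then have Bc: "B w = B 0" if "w \<in> ball 0 1" for w using that by auto
  show Fe: "F w = a + B 0 + cap / w" if "w \<in> ball 0 1" "w \<noteq> 0" for w
    using F_expand[OF that] Bc[OF that(1)] by simp
  show "A = cball (a + B 0) (norm cap)"
  proof (intro equalityI subsetI)
    fix z assume "z \<in> A"
    show "z \<in> cball (a + B 0) (norm cap)"
    proof (rule ccontr)
      assume "z \<notin> cball (a + B 0) (norm cap)"
      then have d: "norm cap < norm (z - (a + B 0))" by (simp add: dist_norm norm_minus_commute)
      define w where "w = cap / (z - (a + B 0))"
      have nz: "z - (a + B 0) \<noteq> 0" using d by force
      then have "w \<in> ball 0 1" using d by (simp add: w_def norm_divide divide_less_eq)
      moreover have "w \<noteq> 0" using cap_nz nz by (simp add: w_def)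
      ultimately have "F w \<notin> A" "F w = a + B 0 + cap / w" using F_notin Fe by auto
      moreover have "cap / w = z - (a + B 0)" using cap_nz nz by (simp add: w_def)
      ultimately show False using \<open>z \<in> A\<close> by simp
    qed
  next
    fix z assume z: "z \<in> cball (a + B 0) (norm cap)"
    show "z \<in> A"
    proof (rule ccontr)
      assume nA: "z \<notin> A"
      have p: "\<psi> z \<in> ball 0 1" "\<psi> z \<noteq> 0" using AF[OF nA] by auto
      have "z = a + B 0 + cap / \<psi> z" using F_psi[OF nA] Fe[OF p] by simp
      then have "cap / \<psi> z = z - (a + B 0)" by (metis add_diff_cancel_left')
      moreover have "norm (z - (a + B 0)) \<le> norm cap" using z by (simp add: dist_norm norm_minus_commute)
      ultimately have "norm (cap / \<psi> z) \<le> norm cap" by simp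
      then have "norm cap \<le> norm cap * norm (\<psi> z)" using p by (simp add: norm_divide divide_le_eq)
      then show False using p cap_nz by (simp add: mult_le_cancel_left1)
    qed
  qed
qed

end

section \<open>Zero winding of the phase and rigidity of the mean modulus\<close>

lemma cont_cis: "continuous_on S cis" using continuous_on_cis[OF continuous_on_id] .

text \<open>The phase of \<open>kh\<close> on the circle has a continuous logarithm over the whole disc, so its argument
  returns to its initial value after one turn. The differential equation identifies this argument with
  an antiderivative \<open>M\<close> of \<open>q\<close> up to a constant.\<close>
lemma closed_phase_winding:
  fixes kh :: "complex \<Rightarrow> complex"
  assumes kh: "continuous_on (cball 0 1) kh" "\<And>w. w \<in> cball 0 1 \<Longrightarrow> kh w \<noteq> 0"
    and q: "continuous_on UNIV q"
    and lip: "\<And>t. lip_at (\<lambda>t. kh (cis t) / of_real (norm (kh (cis t)))) t"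
    and Z: "negligible Z"
    and der: "\<And>t. t \<notin> Z \<Longrightarrow> ((\<lambda>t. kh (cis t) / of_real (norm (kh (cis t)))) has_vector_derivative
        \<i> * of_real (q t) * (kh (cis t) / of_real (norm (kh (cis t))))) (at t)"
  shows "(q has_integral 0) {0..2*pi}"
proof -
  define P where "P t = kh (cis t) / of_real (norm (kh (cis t)))" for t
  \<comment> \<open>Starting the integral at \<open>-1\<close> puts the interval from \<open>0\<close> to \<open>2 \<pi>\<close> into the open domain of differentiability.\<close>
  define M where "M t = integral {-1..t} q" for t
  have M: "(M has_real_derivative q t) (at t)" if t: "t \<in> {0..2*pi}" for t
  proof -
    have t': "t \<in> interior {-1..2*pi+1}" using t by auto
    have "((\<lambda>u. integral {-1..u} q) has_vector_derivative q t) (at t within {-1..2*pi+1})"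
      by (rule integral_has_vector_derivative[OF continuous_on_subset[OF q]]) (use t in auto)
    then show ?thesis unfolding M_def[abs_def] has_real_derivative_iff_has_vector_derivative
      using at_within_interior[OF t'] by simp
  qed
  define E where "E t = exp (- \<i> * of_real (M t))" for t
  have E: "(E has_vector_derivative - \<i> * of_real (q t) * E t) (at t)" if t: "t \<in> {0..2*pi}" for t
  proof -
    have "((\<lambda>t. complex_of_real (M t)) has_vector_derivative of_real (q t)) (at t)"
      using M[OF t] by (rule has_vector_derivative_of_real[folded has_real_derivative_iff_has_vector_derivative])
    moreover have "((\<lambda>z. exp (- \<i> * z)) has_field_derivative - \<i> * exp (- \<i> * of_real (M t))) (at (of_real (M t)))"
      by (auto intro!: derivative_eq_intros)
    ultimately have "((\<lambda>z. exp (- \<i> * z)) \<circ> (\<lambda>t. complex_of_real (M t)) has_vector_derivative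
        of_real (q t) * (- \<i> * exp (- \<i> * of_real (M t)))) (at t)"
      by (rule field_vector_diff_chain_at)
    then show ?thesis by (simp add: E_def[abs_def] o_def mult_ac)
  qed
  have const: "P 0 * E 0 = P t * E t" if t: "t \<in> {0..2*pi}" for t
  proof (rule lip_at_ae_zero_derivative_imp_const[OF _ _ Z])
    show "0 \<le> t" using t by simp
    fix x assume x: "x \<in> {0..t}"
    then have x': "x \<in> {0..2*pi}" using t by auto
    show "lip_at (\<lambda>t. P t * E t) x"
      using lip unfolding P_def by (intro lip_at_mult lip_at_differentiable[OF E[OF x']])
  next
    fix x assume x: "x \<in> {0..t} - Z"
    then have x': "x \<in> {0..2*pi}" "x \<notin> Z" using t by auto
    have "(P has_vector_derivative \<i> * of_real (q x) * P x) (at x)" using der[OF x'(2)] unfolding P_def[abs_def] .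
    from has_vector_derivative_mult[OF this E[OF x'(1)]]
    show "((\<lambda>t. P t * E t) has_vector_derivative 0) (at x)" by (simp add: mult_ac)
  qed
  obtain hh where hh: "continuous_on (cball 0 1) hh" "\<And>z. z \<in> cball 0 1 \<Longrightarrow> kh z = exp (hh z)"
    using continuous_logarithm_on_cball[OF kh] by blast
  define \<theta> where "\<theta> t = (Im (hh (cis t)) - M t) - (Im (hh 1) - M 0)" for t
  have P: "P t = cis (Im (hh (cis t)))" for t
  proof -
    have "kh (cis t) = exp (hh (cis t))" by (rule hh(2)) simp
    then show ?thesis by (simp add: P_def exp_eq_polar norm_mult)
  qed
  have Ec: "E t = cis (- M t)" for t by (simp add: E_def cis_conv_exp)
  have "\<theta> t / (2*pi) \<in> \<int>" if t: "t \<in> {0..2*pi}" for t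
  proof -
    have "cis (Im (hh (cis 0)) - M 0) = cis (Im (hh (cis t)) - M t)"
      using const[OF t] unfolding P Ec cis_mult by simp
    then have "cis (\<theta> t) = 1" unfolding \<theta>_def cis_divide[symmetric] by simp
    then have "cos (\<theta> t) = 1" by (metis cis.sel(1) one_complex.sel(1))
    then obtain k :: int where "\<theta> t = of_int k * 2 * pi" unfolding cos_one_2pi_int by blast
    then show ?thesis by simp
  qed
  note Ints = this
  have "\<theta> constant_on {0..2*pi}"
  proof (rule continuous_discrete_range_constant)
    have "continuous_on {0..2*pi} M"
      by (intro continuous_at_imp_continuous_on ballI DERIV_isCont[OF M])
    then show "continuous_on {0..2*pi} \<theta>" unfolding \<theta>_def
      by (intro continuous_intros continuous_on_compose2[OF hh(1) cont_cis]) auto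
    fix x assume x: "x \<in> {0..2*pi}"
    show "\<exists>e>0. \<forall>y. y \<in> {0..2*pi} \<and> \<theta> y \<noteq> \<theta> x \<longrightarrow> e \<le> norm (\<theta> y - \<theta> x)"
    proof (intro exI[of _ "2*pi"] conjI allI impI)
      fix y assume y: "y \<in> {0..2*pi} \<and> \<theta> y \<noteq> \<theta> x"
      have "\<theta> y / (2*pi) - \<theta> x / (2*pi) \<in> \<int>" using Ints[OF x] Ints[of y] y by (intro Ints_diff) auto
      moreover have "\<theta> y / (2*pi) - \<theta> x / (2*pi) \<noteq> 0" using y by simp
      ultimately have "1 \<le> \<bar>\<theta> y / (2*pi) - \<theta> x / (2*pi)\<bar>" by (rule Ints_nonzero_abs_ge1)
      then show "2*pi \<le> norm (\<theta> y - \<theta> x)" by (simp add: abs_divide le_divide_eq flip: diff_divide_distrib)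
    qed simp
  qed simp
  then have "\<theta> (2*pi) = \<theta> 0" unfolding constant_on_def by auto
  then have MM: "M (2*pi) = M 0" by (simp add: \<theta>_def)
  have "(q has_integral (M (2*pi) - M 0)) {0..2*pi}"
    using M by (intro fundamental_theorem_of_calculus)
      (auto simp: has_real_derivative_iff_has_vector_derivative[symmetric] intro: has_field_derivative_at_within)
  then show ?thesis by (simp add: MM)
qed

text \<open>The equation \<open>\<Gamma> P' = \<i> (\<Gamma> - 1) (1 - \<bar>kh\<bar>) P\<close> for the phase \<open>P\<close>. For \<open>\<Gamma> = 0\<close> it is algebraic and says
  that \<open>\<bar>kh\<bar> = 1\<close> almost everywhere; otherwise it determines \<open>P'\<close>, and zero winding says that the mean
  of \<open>1 - \<bar>kh\<bar>\<close> is \<open>0\<close> unless \<open>\<Gamma> = 1\<close>.\<close>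
lemma phase_equation:
  fixes kh :: "complex \<Rightarrow> complex" and \<Gamma> :: real and m :: "real \<Rightarrow> real"
  assumes kh: "continuous_on (cball 0 1) kh" "\<And>w. w \<in> cball 0 1 \<Longrightarrow> kh w \<noteq> 0"
    and lip: "\<And>t. lip_at (\<lambda>t. kh (cis t) / of_real (norm (kh (cis t)))) t"
    and Z: "negligible Z"
    and der: "\<And>t. t \<notin> Z \<Longrightarrow> ((\<lambda>t. kh (cis t) / of_real (norm (kh (cis t)))) has_vector_derivative
        \<i> * of_real (m t) * (kh (cis t) / of_real (norm (kh (cis t))))) (at t)"
    and m: "\<And>t. t \<notin> Z \<Longrightarrow> \<Gamma> * m t = (\<Gamma> - 1) * (1 - norm (kh (cis t)))"
  shows "\<Gamma> = 1 \<Longrightarrow> 0 \<le> t \<Longrightarrow> kh (cis t) / of_real (norm (kh (cis t))) = kh 1 / of_real (norm (kh 1))"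
    and "\<Gamma> \<noteq> 1 \<Longrightarrow> ((\<lambda>t. norm (kh (cis t))) has_integral 2 * pi) {0..2*pi}"
proof -
  let ?P = "\<lambda>t. kh (cis t) / of_real (norm (kh (cis t)))"
  have cont: "continuous_on UNIV (\<lambda>t. norm (kh (cis t)))"
    by (intro continuous_intros continuous_on_compose2[OF kh(1) cont_cis]) auto
  {
    assume \<Gamma>: "\<Gamma> = 1" and t: "0 \<le> t"
    have "?P 0 = ?P t"
    proof (rule lip_at_ae_zero_derivative_imp_const[OF t lip Z])
      fix x assume "x \<in> {0..t} - Z"
      then show "(?P has_vector_derivative 0) (at x)" using der[of x] m[of x] \<Gamma> by simp
    qed
    then show "?P t = kh 1 / of_real (norm (kh 1))" by simp
  }
  assume \<Gamma>: "\<Gamma> \<noteq> 1"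
  show "((\<lambda>t. norm (kh (cis t))) has_integral 2 * pi) {0..2*pi}"
  proof (cases "\<Gamma> = 0")
    case True
    have "((\<lambda>t. 1 :: real) has_integral 2*pi) {0..2*pi}" using has_integral_const_real[of "1::real" 0 "2*pi"] by simp
    then show ?thesis
      by (rule has_integral_spike[OF Z, rotated]) (use m True in force)
  next
    case False
    \<comment> \<open>The function \<open>m\<close> is replaced by the continuous function that it agrees with almost everywhere.\<close>
    define q where "q t = (\<Gamma> - 1) / \<Gamma> * (1 - norm (kh (cis t)))" for t
    have mq: "m t = q t" if "t \<notin> Z" for t
      using m[OF that] False by (simp add: q_def divide_simps mult.commute)
    have "(q has_integral 0) {0..2*pi}"
    proof (rule closed_phase_winding[OF kh _ lip Z])
      show "continuous_on UNIV q" unfolding q_def by (intro continuous_intros cont)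
    qed (use der mq in auto)
    then have "((\<lambda>t. 1 - \<Gamma> / (\<Gamma> - 1) * q t) has_integral 2*pi - \<Gamma> / (\<Gamma> - 1) * 0) {0..2*pi}"
      using has_integral_const_real[of "1::real" 0 "2*pi"] by (intro has_integral_diff has_integral_mult_right) auto
    moreover have "1 - \<Gamma> / (\<Gamma> - 1) * q t = norm (kh (cis t))" for t
      using False \<Gamma> by (simp add: q_def)
    ultimately show ?thesis by simp
  qed
qed

lemma mean_value_boundary:
  fixes f fh :: "complex \<Rightarrow> complex"
  assumes f: "f holomorphic_on ball 0 1"
    and fh: "continuous_on (cball 0 1) fh" "\<And>w. w \<in> ball 0 1 \<Longrightarrow> fh w = f w"
  shows "((\<lambda>t. fh (cis t)) has_integral 2 * of_real pi * f 0) {0..2*pi}"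
proof -
  define I where "I r = integral (cbox 0 (2*pi)) (\<lambda>t. fh (of_real r * cis t))" for r :: real
  have cI: "continuous_on {0..1} I"
    unfolding I_def
  proof (rule integral_continuous_on_param)
    have "continuous_on ({0..1::real} \<times> cbox 0 (2*pi)) (\<lambda>p. fh (of_real (fst p) * cis (snd p)))"
      by (rule continuous_on_compose2[OF fh(1)]) (auto intro!: continuous_intros simp: norm_mult)
    then show "continuous_on ({0..1} \<times> cbox 0 (2 * pi)) (\<lambda>(r, t). fh (of_real r * cis t))"
      by (simp add: case_prod_unfold)
  qed
  have cl: "closure {0<..<1::real} = {0..1}" by simp
  have "I 1 = 2 * of_real pi * f 0"
  proof (rule continuous_constant_on_closure[of "{0<..<1}" I])
    show "continuous_on (closure {0<..<1}) I" unfolding cl by (rule cI)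
    fix r :: real assume r: "r \<in> {0<..<1}"
    have "fh (of_real r * cis t) = f (of_real r * cis t)" for t
      by (rule fh(2)) (use r in \<open>simp add: norm_mult\<close>)
    then show "I r = 2 * of_real pi * f 0"
      using mean_value_circle[OF f, of r] r by (simp add: I_def integral_unique)
  qed (unfold cl, simp)
  moreover have "(\<lambda>t. fh (cis t)) integrable_on {0..2*pi}"
    by (intro integrable_continuous_real continuous_on_compose2[OF fh(1) cont_cis]) auto
  ultimately show ?thesis by (simp add: I_def has_integral_integral)
qed

lemma unit_is_cis: assumes "norm w = 1" obtains t where "t \<in> {0..2*pi}" "w = cis t"
proof (rule that[of "Arg2pi w"])
  show "Arg2pi w \<in> {0..2*pi}" using Arg2pi[of w] by auto
  show "w = cis (Arg2pi w)" using Arg2pi_eq[of w] assms by (simp add: cis_conv_exp)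
qed

text \<open>With \<open>c = f 0\<close>, the mean value property gives \<open>\<bar>c\<bar>\<^sup>2\<close> as the mean of \<open>Re (cnj c * fh)\<close>, and this
  function is at most \<open>\<bar>c\<bar> \<bar>fh\<bar>\<close>, with mean \<open>\<bar>c\<bar>\<close>. So \<open>\<bar>c\<bar> \<le> 1\<close>, and
  if \<open>\<bar>c\<bar> = 1\<close> the two functions agree.\<close>
lemma mean_modulus_rigidity:
  fixes f fh :: "complex \<Rightarrow> complex"
  assumes f: "f holomorphic_on ball 0 1"
    and fh: "continuous_on (cball 0 1) fh" "\<And>w. w \<in> ball 0 1 \<Longrightarrow> fh w = f w"
    and mod: "((\<lambda>t. norm (fh (cis t))) has_integral 2 * pi) {0..2*pi}"
    and ge: "norm (f 0) \<ge> 1"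
  shows "norm (f 0) = 1" and "norm w = 1 \<Longrightarrow> Im (cnj (f 0) * fh w) = 0"
proof -
  define c where "c = f 0"
  have mv: "((\<lambda>t. fh (cis t)) has_integral 2 * of_real pi * c) {0..2*pi}"
    unfolding c_def by (rule mean_value_boundary[OF f fh])
  have cc: "Re (cnj c * c) = (norm c)\<^sup>2" by (simp add: cmod_power2) (simp add: power2_eq_square)
  have "((\<lambda>t. Re (cnj c * fh (cis t))) has_integral Re (cnj c * (2 * of_real pi * c))) {0..2*pi}"
    by (intro has_integral_Re has_integral_mult_right mv)
  moreover have "Re (cnj c * (2 * of_real pi * c)) = 2 * pi * (norm c)\<^sup>2"
  proof -
    have "cnj c * (2 * of_real pi * c) = of_real (2*pi) * (cnj c * c)" by (simp add: mult_ac)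
    moreover have "Re (of_real x * y) = x * Re y" for x y by simp
    ultimately show ?thesis by (simp only: cc)
  qed
  ultimately have re: "((\<lambda>t. Re (cnj c * fh (cis t))) has_integral 2 * pi * (norm c)\<^sup>2) {0..2*pi}" by simp
  have md: "((\<lambda>t. norm c * norm (fh (cis t))) has_integral norm c * (2 * pi)) {0..2*pi}"
    by (intro has_integral_mult_right mod)
  have le: "Re (cnj c * fh w) \<le> norm c * norm (fh w)" for w
    using complex_Re_le_cmod[of "cnj c * fh w"] by (simp add: norm_mult)
  have "2 * pi * (norm c)\<^sup>2 \<le> norm c * (2 * pi)" by (rule has_integral_le[OF re md]) (rule le)
  then have "norm c * norm c \<le> norm c * 1" by (simp add: power2_eq_square mult.commute)
  moreover have "norm c > 0" using ge unfolding c_def by linarith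
  ultimately have n1: "norm c = 1" using ge by (simp add: c_def mult_le_cancel_left_pos)
  then show "norm (f 0) = 1" by (simp add: c_def)
  assume w: "norm w = 1"
  then obtain t where t: "t \<in> {0..2*pi}" "w = cis t" by (rule unit_is_cis)
  have "norm (fh (cis t)) - Re (cnj c * fh (cis t)) = 0"
  proof (rule has_integral_0_cbox_imp_0[of 0 "2*pi" "\<lambda>t. norm (fh (cis t)) - Re (cnj c * fh (cis t))"])
    show "continuous_on (cbox 0 (2*pi)) (\<lambda>t. norm (fh (cis t)) - Re (cnj c * fh (cis t)))"
      by (intro continuous_intros continuous_on_compose2[OF fh(1) cont_cis]) auto
    show "0 \<le> norm (fh (cis t)) - Re (cnj c * fh (cis t))" for t using le[of "cis t"] n1 by simp
    show "((\<lambda>t. norm (fh (cis t)) - Re (cnj c * fh (cis t))) has_integral 0) (cbox 0 (2*pi))"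
    proof -
      have "2 * pi - 2 * pi * (norm c)\<^sup>2 = 0" using n1 by simp
      then show ?thesis using has_integral_diff[OF mod re] by (simp only: cbox_interval)
    qed
    show "box 0 (2*pi) \<noteq> {}" by (simp add: box_ne_empty not_le)
    show "t \<in> cbox 0 (2*pi)" using t by simp
  qed
  moreover have "norm (cnj c * fh w) = norm (fh w)" using n1 by (simp add: norm_mult)
  ultimately have "Re (cnj c * fh w) = norm (cnj c * fh w)" unfolding t(2) by linarith
  moreover have "Re z = norm z \<Longrightarrow> Im z = 0" for z using cmod_power2[of z] by simp
  ultimately show "Im (cnj (f 0) * fh w) = 0" unfolding c_def by blast
qed

section \<open>The overdetermined problem on the exterior\<close>

text \<open>This connects the one-sided derivative at the boundary with the continuous extension of the
  gradient.\<close>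
lemma right_derivative_limit:
  fixes f :: "real \<Rightarrow> real"
  assumes d: "\<delta> > 0" and cont: "continuous_on {0..<\<delta>} f"
    and der: "\<And>t. 0 < t \<Longrightarrow> t < \<delta> \<Longrightarrow> (f has_real_derivative f' t) (at t)"
    and lim: "(f' \<longlongrightarrow> l) (at_right 0)"
  shows "(f has_real_derivative l) (at_right 0)"
  unfolding has_field_derivative_iff
proof (rule tendstoI)
  fix e :: real assume e: "e > 0"
  have "\<forall>\<^sub>F t in at_right 0. dist (f' t) l < e" using lim e by (rule tendstoD)
  then obtain b where b: "b > 0" "\<And>t. 0 < t \<Longrightarrow> t < b \<Longrightarrow> dist (f' t) l < e"
    unfolding eventually_at_right_field by auto
  have "\<forall>\<^sub>F t in at_right 0. t \<in> {0<..<min b \<delta>}" using b d by (intro eventually_at_right_real) auto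
  then show "\<forall>\<^sub>F t in at_right 0. dist ((f t - f 0) / (t - 0)) l < e"
  proof eventually_elim
    case (elim t)
    have "\<exists>k z. 0 < z \<and> z < t \<and> (f has_real_derivative k) (at z) \<and> f t - f 0 = (t - 0) * k"
    proof (rule MVT)
      show "continuous_on {0..t} f" by (rule continuous_on_subset[OF cont]) (use elim in auto)
      show "f differentiable (at z)" if "0 < z" "z < t" for z
        using der[of z] that elim by (auto simp: real_differentiable_def)
    qed (use elim in auto)
    then obtain k z where z: "0 < z" "z < t" "(f has_real_derivative k) (at z)" "f t - f 0 = (t - 0) * k" by blast
    have "k = f' z" using z(3) der[of z] z elim DERIV_unique by fastforce
    then have "(f t - f 0) / (t - 0) = f' z" using z(4) elim by simp
    then show ?case using b(2)[of z] z elim by simp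
  qed
qed

definition filled :: "(real^2) set \<Rightarrow> complex set" where
  "filled \<Omega> = v2c ` (closure \<Omega> \<union> inside (closure \<Omega>))"

lemma v2c_image: "v2c ` S = c2v -` S"
  by (auto simp: image_iff) (metis v2c_c2v)

lemma v2c_in_image [simp]: "v2c x \<in> v2c ` S \<longleftrightarrow> x \<in> S" by (auto simp: v2c_image)

lemma closure_v2c: "closure (v2c ` S) = v2c ` closure S"
  using closure_injective_linear_image[of v2c S] bounded_linear.linear[OF bounded_linear_v2c]
  by (simp add: inj_def)

lemma open_v2c: "open S \<Longrightarrow> open (v2c ` S)"
  unfolding v2c_image by (intro open_vimage continuous_on_c2v continuous_on_id)

text \<open>The exterior of \<open>\<Omega>\<close> consists of the unbounded component \<open>outer\<close> and the bounded components, whose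
  union is \<open>holes\<close>. The continuous extension of the gradient of \<open>u\<close> to the boundary appears as the
  vector \<open>grad_bd\<close> and as the complex gradient \<open>cgrad_bd\<close>.\<close>
locale overdetermined =
  fixes \<Gamma> :: real and \<Omega> :: "(real^2) set" and u :: "real^2 \<Rightarrow> real"
  assumes dom: "is_domain \<Omega>" and bdd: "bounded \<Omega>" and area: "measure lebesgue \<Omega> = pi"
    and C11: "C11_boundary \<Omega>"
    and C2: "C2_on (- closure \<Omega>) u" and C1b: "C1_up_to_boundary (- \<Omega>) u"
    and harm: "\<forall>x\<in>- closure \<Omega>. - laplacian u x = 0"
    and bdry: "\<forall>x\<in>frontier \<Omega>. u x = 1"
    and neumann: "ae_on_curve (frontier \<Omega>)
           (\<lambda>x. has_exterior_normal_derivative u \<Omega> x (\<Gamma> * curvature \<Omega> x + \<Gamma> - 1))"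
    and infty: "(\<lambda>x. u x + ln (norm x)) \<in> O[at_infinity](\<lambda>_. 1)"
begin

abbreviation "A \<equiv> filled \<Omega>"
definition outer where "outer = outside (closure \<Omega>)"
definition holes where "holes = inside (closure \<Omega>)"
definition gx where "gx = (SOME g. continuous_on (- \<Omega>) g \<and> (\<forall>x\<in>interior (- \<Omega>). g x = partial_deriv (axis 1 1) u x))"
definition gy where "gy = (SOME g. continuous_on (- \<Omega>) g \<and> (\<forall>x\<in>interior (- \<Omega>). g x = partial_deriv (axis 2 1) u x))"
definition grad_bd :: "real^2 \<Rightarrow> real^2" where "grad_bd x = gx x *\<^sub>R axis 1 1 + gy x *\<^sub>R axis 2 1"
definition cgrad_bd :: "complex \<Rightarrow> complex" where "cgrad_bd z = Complex (gx (c2v z)) (- gy (c2v z))"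

lemma open_dom: "open \<Omega>" and conn_dom: "connected \<Omega>" and dom_ne: "\<Omega> \<noteq> {}"
  using dom by (auto simp: is_domain_def)

lemma split_exterior: "outer \<union> holes = - closure \<Omega>" "outer \<inter> holes = {}"
  unfolding outer_def holes_def by (metis Un_commute inside_Un_outside, metis Int_commute inside_Int_outside)

lemma open_outer: "open outer" and open_holes: "open holes"
  by (auto simp: outer_def holes_def open_outside open_inside)

lemma filled_eq: "A = v2c ` (- outer)" "- A = v2c ` outer"
proof -
  have "closure \<Omega> \<union> inside (closure \<Omega>) = - outer"
    using union_with_inside[of "closure \<Omega>"] by (simp add: outer_def)
  then show 1: "A = v2c ` (- outer)" by (simp add: filled_def)
  show "- A = v2c ` outer" unfolding 1 v2c_image by auto
qed

lemma notin_A: "z \<notin> A \<longleftrightarrow> c2v z \<in> outer" by (auto simp: filled_eq(1) v2c_image)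

lemma compact_A: "compact A"
proof -
  have "bounded (closure \<Omega> \<union> inside (closure \<Omega>))"
    using bdd by (simp add: bounded_inside bounded_closure)
  then have "bounded A" unfolding filled_def by (rule bounded_linear_image[OF _ bounded_linear_v2c])
  moreover have "closed A" unfolding closed_def filled_eq(2) by (rule open_v2c[OF open_outer])
  ultimately show ?thesis by (simp add: compact_eq_bounded_closed)
qed

lemma connected_A: "connected A"
  unfolding filled_def
  by (intro connected_continuous_image continuous_on_v2c continuous_on_id connected_with_inside
      connected_imp_connected_closure conn_dom closed_closure)

lemma connected_compl_A: "connected (- A)"
  unfolding filled_eq(2) outer_def using bdd
  by (intro connected_continuous_image continuous_on_v2c continuous_on_id connected_outside) auto

lemma dom_interior_A: "x \<in> \<Omega> \<Longrightarrow> v2c x \<in> interior A"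
proof -
  assume x: "x \<in> \<Omega>"
  have "v2c ` \<Omega> \<subseteq> A" unfolding filled_def using closure_subset by blast
  then have "v2c ` \<Omega> \<subseteq> interior A" by (rule interior_maximal) (rule open_v2c[OF open_dom])
  then show ?thesis using x by blast
qed

lemma frontier_dom: "frontier \<Omega> = closure \<Omega> - \<Omega>"
  using open_dom by (simp add: frontier_def interior_open)

text \<open>Each of the two open pieces has its boundary in the boundary of \<open>\<Omega>\<close>, since it is disjoint from the
  other piece and from \<open>\<Omega>\<close>.\<close>
lemma frontier_piece:
  assumes W: "W = outer \<or> W = holes" and p: "p \<in> closure W" "p \<notin> W"
  shows "p \<in> frontier \<Omega>"
proof -
  have o: "open (outer \<union> holes - W)" using W split_exterior open_outer open_holes by (metis Diff_triv Un_Diff Un_empty_left Un_empty_right Diff_cancel inf_commute)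
  have "W \<inter> (outer \<union> holes - W) = {}" by blast
  then have "p \<notin> outer \<union> holes - W" using p open_Int_closure_eq_empty[OF o, of W] by blast
  then have "p \<in> closure \<Omega>" using p split_exterior by blast
  moreover have "W \<inter> \<Omega> = {}" using W split_exterior closure_subset by blast
  then have "p \<notin> \<Omega>" using p open_Int_closure_eq_empty[OF open_dom, of W] by blast
  ultimately show ?thesis by (simp add: frontier_dom)
qed

text \<open>Near a boundary point the exterior is contained in a connected part of the exterior, so it belongs to
  a single piece.\<close>
lemma exterior_near_boundary:
  assumes W: "W = outer \<or> W = holes" and p: "p \<in> closure W" "p \<in> frontier \<Omega>"
  obtains \<rho> where "\<rho> > 0" "ball p \<rho> - closure \<Omega> \<subseteq> W"
proof -
  obtain e n r L \<phi> \<phi>' where "boundary_chart \<Omega> p e n r L \<phi> \<phi>'"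
    using C11_boundary_chart[OF open_dom C11 p(2)] by blast
  then interpret boundary_chart \<Omega> p e n r L \<phi> \<phi>' .
  obtain C \<rho> where C: "\<rho> > 0" "connected C" "C \<subseteq> - closure \<Omega>" "ball p \<rho> - closure \<Omega> \<subseteq> C"
    using local_exterior_connected by metis
  have "W \<inter> ball p \<rho> \<noteq> {}"
    using p(1) C(1) by (metis Int_commute centre_in_ball disjoint_iff open_Int_closure_eq_empty open_ball)
  moreover have "W \<subseteq> - closure \<Omega>" using W split_exterior by blast
  ultimately have "W \<inter> C \<noteq> {}" using C(4) by blast
  moreover have "C \<subseteq> outer \<union> holes" using C(3) split_exterior by blast
  moreover have "outer \<inter> C = {} \<or> holes \<inter> C = {}"
    using connectedD[OF C(2) open_outer open_holes] split_exterior(2) \<open>C \<subseteq> outer \<union> holes\<close> by blast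
  ultimately have "C \<subseteq> W" using W by blast
  then show ?thesis using that[OF C(1)] C(4) by blast
qed

lemma closure_compl_A: "closure (- A) = c2v -` closure outer"
  by (simp only: filled_eq(2) closure_v2c) (simp only: v2c_image)

lemma frontier_A:
  assumes "z \<in> frontier A" shows "c2v z \<in> frontier \<Omega>" "c2v z \<in> closure outer"
proof -
  have z: "z \<in> A" "z \<in> closure (- A)"
    using assms compact_imp_closed[OF compact_A] by (auto simp: frontier_closures)
  show c: "c2v z \<in> closure outer" using z(2) by (simp only: closure_compl_A vimage_eq)
  show "c2v z \<in> frontier \<Omega>" by (rule frontier_piece[of outer]) (use c z(1) notin_A in auto)
qed

lemma u_cont: "continuous_on (- \<Omega>) u" using C1b by (simp add: C1_up_to_boundary_def)

lemma closure_exterior: "W = outer \<or> W = holes \<Longrightarrow> closure W \<subseteq> - \<Omega>"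
  using frontier_piece[of W] split_exterior closure_subset frontier_dom by blast

lemma u_diff: "x \<notin> closure \<Omega> \<Longrightarrow> u differentiable (at x)"
  using C2 by (auto simp: C2_on_def C1_on_def)

lemma interior_compl: "interior (- \<Omega>) = - closure \<Omega>" by (simp add: interior_complement)

lemma gx: "continuous_on (- \<Omega>) gx" "x \<notin> closure \<Omega> \<Longrightarrow> gx x = partial_deriv (axis 1 1) u x"
  and gy: "continuous_on (- \<Omega>) gy" "x \<notin> closure \<Omega> \<Longrightarrow> gy x = partial_deriv (axis 2 1) u x"
proof -
  have ex: "\<exists>g. continuous_on (- \<Omega>) g \<and> (\<forall>x\<in>interior (- \<Omega>). g x = partial_deriv b u x)" if "b \<in> Basis" for b
    using C1b that by (auto simp: C1_up_to_boundary_def)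
  have "continuous_on (- \<Omega>) gx \<and> (\<forall>x\<in>interior (- \<Omega>). gx x = partial_deriv (axis 1 1) u x)"
    unfolding gx_def by (rule someI_ex[OF ex]) (simp add: Basis_real2)
  then show "continuous_on (- \<Omega>) gx" "x \<notin> closure \<Omega> \<Longrightarrow> gx x = partial_deriv (axis 1 1) u x"
    by (auto simp: interior_compl)
  have "continuous_on (- \<Omega>) gy \<and> (\<forall>x\<in>interior (- \<Omega>). gy x = partial_deriv (axis 2 1) u x)"
    unfolding gy_def by (rule someI_ex[OF ex]) (simp add: Basis_real2)
  then show "continuous_on (- \<Omega>) gy" "x \<notin> closure \<Omega> \<Longrightarrow> gy x = partial_deriv (axis 2 1) u x"
    by (auto simp: interior_compl)
qed

lemma grad_bd_cont: "continuous_on (- \<Omega>) grad_bd" unfolding grad_bd_def by (intro continuous_intros gx gy)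

lemma cgrad_bd_eq: "c2v z \<notin> closure \<Omega> \<Longrightarrow> cgrad_bd z = cgrad u z" by (simp add: cgrad_bd_def cgrad_def gx gy)

lemma cgrad_bd_cont: "S \<subseteq> c2v -` (- \<Omega>) \<Longrightarrow> continuous_on S cgrad_bd"
  unfolding cgrad_bd_def Complex_eq
  by (intro continuous_intros continuous_on_compose2[OF gx(1)] continuous_on_compose2[OF gy(1)] continuous_on_c2v) auto

lemma v2c_grad_bd: "v2c (grad_bd x) = cnj (cgrad_bd (v2c x))"
  by (simp add: complex_eq_iff grad_bd_def cgrad_bd_def axis_def)

lemma cgrad_hol: "cgrad u holomorphic_on c2v -` (- closure \<Omega>)"
  by (rule cgrad_holomorphic[OF C2]) (use harm in auto)

lemma cgrad_der: "c2v z \<notin> closure \<Omega> \<Longrightarrow> ((\<lambda>z. u (c2v z)) has_derivative (\<lambda>v. Re (cgrad u z * v))) (at z)"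
  by (rule cgrad_derivative[OF u_diff])

lemma directional_derivative:
  assumes "x + t *\<^sub>R v \<notin> closure \<Omega>"
  shows "((\<lambda>t. u (x + t *\<^sub>R v)) has_real_derivative grad_bd (x + t *\<^sub>R v) \<bullet> v) (at t)"
proof -
  let ?D = "frechet_derivative u (at (x + t *\<^sub>R v))"
  have D: "(u has_derivative ?D) (at (x + t *\<^sub>R v))" using u_diff[OF assms] by (simp add: frechet_derivative_works)
  note lin = has_derivative_linear[OF D]
  have "v = v$1 *\<^sub>R axis 1 1 + v$2 *\<^sub>R axis 2 1" by (simp add: vec_eq_iff forall_2 axis_def)
  then have "?D v = ?D (v$1 *\<^sub>R axis 1 1 + v$2 *\<^sub>R axis 2 1)" by simp
  also have "\<dots> = v$1 * ?D (axis 1 1) + v$2 * ?D (axis 2 1)" by (simp add: linear_add[OF lin] linear_scale[OF lin])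
  also have "\<dots> = grad_bd (x + t *\<^sub>R v) \<bullet> v"
    using gx(2)[OF assms] gy(2)[OF assms] by (simp add: grad_bd_def partial_deriv_def inner_vec_def sum_2 axis_def)
  finally have "partial_deriv v u (x + t *\<^sub>R v) = grad_bd (x + t *\<^sub>R v) \<bullet> v" by (simp add: partial_deriv_def)
  then show ?thesis using partial_deriv_line[OF u_diff[OF assms]] by simp
qed

lemma outward_exterior:
  assumes p: "p \<in> frontier \<Omega>"
  obtains \<delta> where "\<delta> > 0" "\<And>t. 0 < t \<Longrightarrow> t < \<delta> \<Longrightarrow> p + t *\<^sub>R outer_normal \<Omega> p \<notin> closure \<Omega>"
    "norm (outer_normal \<Omega> p) = 1"
proof -
  obtain e n r L \<phi> \<phi>' where "boundary_chart \<Omega> p e n r L \<phi> \<phi>'"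
    using C11_boundary_chart[OF open_dom C11 p] by blast
  then interpret boundary_chart \<Omega> p e n r L \<phi> \<phi>' .
  have b: "graph 0 \<in> ball p r" using r by simp
  have N: "outer_normal \<Omega> p = nrm 0" using outer_normal_graph[OF b] by simp
  then have "\<forall>\<^sub>F t in at_right 0. p + t *\<^sub>R outer_normal \<Omega> p \<notin> closure \<Omega>"
    using graph_normal_sides(1)[OF b] by simp
  then obtain \<delta> where "\<delta> > 0" "\<And>t. 0 < t \<Longrightarrow> t < \<delta> \<Longrightarrow> p + t *\<^sub>R outer_normal \<Omega> p \<notin> closure \<Omega>"
    unfolding eventually_at_right_field by auto
  then show ?thesis using that N nrm_norm by metis
qed

lemma frontier_in_closure_exterior:
  assumes p: "p \<in> frontier \<Omega>" shows "p \<in> closure (- closure \<Omega>)"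
  unfolding closure_approachable
proof (intro allI impI)
  fix e :: real assume e: "e > 0"
  obtain \<delta> where d: "\<delta> > 0" "\<And>t. 0 < t \<Longrightarrow> t < \<delta> \<Longrightarrow> p + t *\<^sub>R outer_normal \<Omega> p \<notin> closure \<Omega>"
    "norm (outer_normal \<Omega> p) = 1" using outward_exterior[OF p] by blast
  define t where "t = min \<delta> e / 2"
  have "0 < t" "t < \<delta>" "t < e" using d e by (auto simp: t_def min_def)
  then show "\<exists>y\<in>- closure \<Omega>. dist y p < e"
    using d by (intro bexI[of _ "p + t *\<^sub>R outer_normal \<Omega> p"]) (auto simp: dist_norm)
qed

lemma normal_derivative:
  assumes p: "p \<in> frontier \<Omega>"
  shows "has_exterior_normal_derivative u \<Omega> p (grad_bd p \<bullet> outer_normal \<Omega> p)"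
proof -
  let ?N = "outer_normal \<Omega> p"
  obtain \<delta> where d: "\<delta> > 0" "\<And>t. 0 < t \<Longrightarrow> t < \<delta> \<Longrightarrow> p + t *\<^sub>R ?N \<notin> closure \<Omega>"
    using outward_exterior[OF p] by blast
  have inO: "p + t *\<^sub>R ?N \<in> - \<Omega>" if "0 \<le> t" "t < \<delta>" for t
  proof (cases "t = 0")
    case True
    then show ?thesis using p frontier_dom by simp
  next
    case False
    then have "p + t *\<^sub>R ?N \<notin> closure \<Omega>" using d(2)[of t] that by simp
    then show ?thesis using closure_subset by blast
  qed
  have cgv: "continuous_on {0..<\<delta>} (\<lambda>t. grad_bd (p + t *\<^sub>R ?N) \<bullet> ?N)"
    using inO by (intro continuous_intros continuous_on_compose2[OF grad_bd_cont]) auto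
  have "((\<lambda>t. u (p + t *\<^sub>R ?N)) has_real_derivative grad_bd p \<bullet> ?N) (at_right 0)"
  proof (rule right_derivative_limit[OF d(1)])
    show "continuous_on {0..<\<delta>} (\<lambda>t. u (p + t *\<^sub>R ?N))"
      using inO by (intro continuous_intros continuous_on_compose2[OF u_cont]) auto
    show "((\<lambda>t. u (p + t *\<^sub>R ?N)) has_real_derivative grad_bd (p + t *\<^sub>R ?N) \<bullet> ?N) (at t)" if "0 < t" "t < \<delta>" for t
      by (rule directional_derivative[OF d(2)[OF that]])
    have "((\<lambda>t. grad_bd (p + t *\<^sub>R ?N) \<bullet> ?N) \<longlongrightarrow> grad_bd p \<bullet> ?N) (at 0 within {0..<\<delta>})"
      using cgv[unfolded continuous_on_def, rule_format, of 0] d(1) by simp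
    then have "((\<lambda>t. grad_bd (p + t *\<^sub>R ?N) \<bullet> ?N) \<longlongrightarrow> grad_bd p \<bullet> ?N) (at 0 within {0..\<delta>/2})"
      by (rule tendsto_within_subset) (use d(1) in auto)
    then show "((\<lambda>t. grad_bd (p + t *\<^sub>R ?N) \<bullet> ?N) \<longlongrightarrow> grad_bd p \<bullet> ?N) (at_right 0)"
      using at_within_Icc_at_right[of 0 "\<delta>/2"] d(1) by simp
  qed
  then show ?thesis by (simp add: has_exterior_normal_derivative_def)
qed

definition exceptional where "exceptional = {x \<in> frontier \<Omega>. \<not> has_exterior_normal_derivative u \<Omega> x (\<Gamma> * curvature \<Omega> x + \<Gamma> - 1)}"

lemma exceptional_null: "hausdorff1 exceptional = 0" using neumann by (simp add: ae_on_curve_def exceptional_def)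

lemma exterior_normal_derivative_unique:
  assumes "has_exterior_normal_derivative u \<Omega> p d" "has_exterior_normal_derivative u \<Omega> p d'"
  shows "d = d'"
  using assms unfolding has_exterior_normal_derivative_def has_field_derivative_iff
  by (rule tendsto_unique[OF trivial_limit_at_right_real])

lemma neumann_grad: "p \<in> frontier \<Omega> \<Longrightarrow> p \<notin> exceptional \<Longrightarrow> grad_bd p \<bullet> outer_normal \<Omega> p = \<Gamma> * curvature \<Omega> p + \<Gamma> - 1"
  using exterior_normal_derivative_unique[OF normal_derivative] by (auto simp: exceptional_def)

lemma u_infty:
  obtains R M where "\<And>z. R \<le> norm z \<Longrightarrow> \<bar>u (c2v z) + ln (norm z)\<bar> \<le> M"
proof -
  obtain M where "\<forall>\<^sub>F x in at_infinity. norm (u x + ln (norm x)) \<le> M * norm (1::real)"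
    using landau_o.bigE[OF infty] by blast
  then obtain R where "\<And>x. R \<le> norm x \<Longrightarrow> \<bar>u x + ln (norm x)\<bar> \<le> M"
    unfolding eventually_at_infinity by auto
  then show ?thesis using that[of R M] by (metis norm_c2v)
qed

end

locale overdetermined_map = overdetermined \<Gamma> \<Omega> u + exterior_map "filled \<Omega>" a \<phi> \<psi>
  for \<Gamma> \<Omega> u a \<phi> \<psi>
begin

lemma green:
  assumes w: "w \<in> ball 0 1" "w \<noteq> 0"
  shows "u (c2v (F w)) = 1 + ln (norm w)" and "cgrad u (F w) = - w / \<kappa> w"
proof -
  obtain R M where RM: "\<And>z. R \<le> norm z \<Longrightarrow> \<bar>u (c2v z) + ln (norm z)\<bar> \<le> M" using u_infty by blast
  have ext: "c2v z \<notin> closure \<Omega>" if "z \<notin> A" for z using that notin_A split_exterior by blast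
  have hol: "cgrad u holomorphic_on - A" by (rule holomorphic_on_subset[OF cgrad_hol]) (use ext in auto)
  have cont: "continuous_on (closure (- A)) (\<lambda>z. u (c2v z))"
    using closure_exterior[of outer]
    by (intro continuous_on_compose2[OF u_cont] continuous_on_c2v continuous_on_id) (auto simp: closure_compl_A)
  have bd: "u (c2v z) = 1" if "z \<in> frontier A" for z using frontier_A(1)[OF that] bdry by blast
  show "u (c2v (F w)) = 1 + ln (norm w)" "cgrad u (F w) = - w / \<kappa> w"
    using exterior_green_function[OF hol cgrad_der[OF ext] cont bd RM w] by auto
qed

lemma u_lt_1: "x \<in> outer \<Longrightarrow> u x < 1"
proof -
  assume "x \<in> outer"
  then have nA: "v2c x \<notin> A" by (simp add: notin_A)
  have p: "\<psi> (v2c x) \<in> ball 0 1" "\<psi> (v2c x) \<noteq> 0" using AF[OF nA] by auto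
  have "u x = 1 + ln (norm (\<psi> (v2c x)))" using green(1)[OF p] F_psi[OF nA] by simp
  then show ?thesis using p by simp
qed

lemma u_le_1: "x \<in> closure outer \<Longrightarrow> u x \<le> 1"
  using u_lt_1[of x] frontier_piece[of outer x] bdry by force

text \<open>The barrier argument. On an exterior ball of radius \<open>R\<close> touching at \<open>p\<close>, the function \<open>u - 1\<close> is
  compared with a multiple of \<open>ln (\<bar>z - z0\<bar> / R)\<close> on the annulus between the radii \<open>R / 2\<close> and \<open>R\<close>; the
  strict inequality \<open>u < 1\<close> on the inner circle makes the multiple positive.\<close>
lemma hopf:
  assumes p: "p \<in> frontier \<Omega>" "p \<in> closure outer"
  shows "grad_bd p \<bullet> outer_normal \<Omega> p < 0"
proof -
  let ?N = "outer_normal \<Omega> p"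
  obtain e n r L \<phi> \<phi>' where "boundary_chart \<Omega> p e n r L \<phi> \<phi>'"
    using C11_boundary_chart[OF open_dom C11 p(1)] by blast
  then interpret ch: boundary_chart \<Omega> p e n r L \<phi> \<phi>' .
  have N: "?N = ch.nrm 0" using ch.outer_normal_graph[of 0] ch.r by simp
  have N1: "norm ?N = 1" using N ch.nrm_norm by simp
  obtain R where R: "R > 0" "ball (p + R *\<^sub>R ?N) R \<subseteq> - closure \<Omega>" using ch.exterior_ball N by metis
  obtain \<rho> where \<rho>: "\<rho> > 0" "ball p \<rho> - closure \<Omega> \<subseteq> outer" using exterior_near_boundary[of outer p] p by blast
  define y0 where "y0 = p + R *\<^sub>R ?N"
  \<comment> \<open>The ball lies in one piece of the exterior, and its points near \<open>p\<close> belong to \<open>outer\<close>.\<close>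
  have ballU0: "ball y0 R \<subseteq> outer"
  proof -
    define t where "t = min R \<rho> / 2"
    have t: "0 < t" "t < R" "t < \<rho>" using R \<rho> by (auto simp: t_def min_def)
    have in1: "p + t *\<^sub>R ?N \<in> ball y0 R"
    proof -
      have "y0 - (p + t *\<^sub>R ?N) = (R - t) *\<^sub>R ?N" by (simp add: y0_def algebra_simps)
      then show ?thesis using t N1 by (simp add: dist_norm)
    qed
    have "p + t *\<^sub>R ?N \<in> ball p \<rho>" using t N1 by (simp add: dist_norm)
    moreover have "p + t *\<^sub>R ?N \<notin> closure \<Omega>" using in1 R(2) unfolding y0_def by blast
    ultimately have "p + t *\<^sub>R ?N \<in> outer \<inter> ball y0 R" using in1 \<rho>(2) by blast
    moreover have "outer \<inter> ball y0 R = {} \<or> holes \<inter> ball y0 R = {}"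
      using connectedD[OF connected_ball open_outer open_holes] split_exterior R(2) unfolding y0_def by blast
    ultimately have "holes \<inter> ball y0 R = {}" by blast
    then show ?thesis using split_exterior R(2) unfolding y0_def by blast
  qed
  have cb: "cball y0 R \<subseteq> closure outer"
    using closure_mono[OF ballU0] R(1) by (simp add: closure_ball)
  define z0 where "z0 = v2c y0"
  have dz: "dist (c2v z) y0 = norm (z - z0)" for z
  proof -
    have "dist (c2v z) (c2v z0) = dist z z0" by (rule dist_c2v)
    then show ?thesis by (simp add: z0_def dist_norm)
  qed
  define h where "h z = u (c2v z)" for z
  have inU: "c2v z \<in> outer" if "norm (z - z0) < R" for z
    using ballU0 dz[of z] that by (auto simp: dist_commute)
  have inU': "c2v z \<in> closure outer" if "norm (z - z0) \<le> R" for z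
    using cb dz[of z] that by (auto simp: dist_commute)
  have conth: "continuous_on (cball z0 R) h"
    unfolding h_def
  proof (rule continuous_on_compose2[OF u_cont])
    show "continuous_on (cball z0 R) c2v" by (intro continuous_on_c2v continuous_on_id)
    show "c2v ` cball z0 R \<subseteq> - \<Omega>"
    proof (rule image_subsetI)
      fix z assume "z \<in> cball z0 R"
      then have "norm (z - z0) \<le> R" by (simp add: dist_norm norm_minus_commute)
      then have "c2v z \<in> closure outer" by (rule inU')
      then show "c2v z \<in> - \<Omega>" using closure_exterior[of outer] by blast
    qed
  qed
  have "compact (cball z0 (R/2))" by simp
  moreover have "continuous_on (cball z0 (R/2)) h" by (rule continuous_on_subset[OF conth]) (use R in auto)
  moreover have "cball z0 (R/2) \<noteq> {}" using R by simp
  ultimately obtain zm where zm: "zm \<in> cball z0 (R/2)" "\<And>z. z \<in> cball z0 (R/2) \<Longrightarrow> h z \<le> h zm"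
    using continuous_attains_sup by metis
  define m where "m = 1 - h zm"
  have "norm (zm - z0) < R" using zm(1) R by (simp add: dist_norm norm_minus_commute)
  then have m: "m > 0" using u_lt_1[OF inU] by (simp add: m_def h_def)
  define c where "c = m / ln 2"
  have c: "c > 0" using m by (simp add: c_def)
  define k where "k z = h z - 1 + c * (ln R - ln (norm (z - z0)))" for z
  define S where "S = ball z0 R - cball z0 (R/2)"
  have kle: "k z \<le> 0" if z: "z \<in> S" for z
  proof (rule harmonic_max_principle[where S = S and h = k and z = z and K = "\<lambda>z. cgrad u z - of_real c * (1 / (z - z0))"])
    have ext: "c2v z \<notin> closure \<Omega>" if "z \<in> S" for z
      using inU[of z] that split_exterior by (auto simp: S_def dist_norm norm_minus_commute)
    have nz: "z - z0 \<noteq> 0" if "z \<in> S" for z using that R by (auto simp: S_def)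
    show "open S" "bounded S" by (auto simp: S_def open_Diff)
    show "(\<lambda>z. cgrad u z - of_real c * (1 / (z - z0))) holomorphic_on S"
      using nz ext by (intro holomorphic_intros holomorphic_on_subset[OF cgrad_hol]) auto
    fix z assume z: "z \<in> S"
    have l: "((\<lambda>z. ln (norm (z - z0))) has_derivative (\<lambda>v. Re (1 / (z - z0) * v))) (at z)"
    proof -
      have "((\<lambda>z. z - z0) has_derivative (\<lambda>v. v - 0)) (at z)" by (intro derivative_intros)
      from has_derivative_compose[OF this ln_norm_derivative[OF nz[OF z]]] show ?thesis by simp
    qed
    have "(k has_derivative (\<lambda>v. Re (cgrad u z * v) - 0 + c * (0 - Re (1 / (z - z0) * v)))) (at z)"
      unfolding k_def h_def by (intro derivative_intros has_derivative_mult_right cgrad_der ext z l)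
    moreover have "(\<lambda>v. Re (cgrad u z * v) - 0 + c * (0 - Re (1 / (z - z0) * v))) =
       (\<lambda>v. Re ((cgrad u z - of_real c * (1 / (z - z0))) * v))"
    proof
      fix v
      have r: "Re (complex_of_real a * b) = a * Re b" for a b by simp
      have "Re (of_real c * (1 / (z - z0) * v)) = c * Re (1 / (z - z0) * v)" by (rule r)
      then show "Re (cgrad u z * v) - 0 + c * (0 - Re (1 / (z - z0) * v)) = Re ((cgrad u z - of_real c * (1 / (z - z0))) * v)"
        by (simp only: left_diff_distrib mult.assoc minus_complex.sel) simp
    qed
    ultimately show "(k has_derivative (\<lambda>v. Re ((cgrad u z - of_real c * (1 / (z - z0))) * v))) (at z)" by simp
  next
    fix \<epsilon> :: real assume ep: "\<epsilon> > 0"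
    have out: "k z \<le> 0" if "norm (z - z0) = R" for z
      using u_le_1[OF inU'[of z]] that by (simp add: k_def h_def)
    have inn: "k z \<le> 0" if "norm (z - z0) = R/2" for z
    proof -
      have "h z \<le> h zm" using that by (intro zm(2)) (simp add: dist_norm norm_minus_commute)
      moreover have "ln R - ln (R/2) = ln 2" using R by (simp add: ln_div)
      ultimately have "h z \<le> h zm" "k z = h z - 1 + c * ln 2" unfolding k_def that by simp_all
      moreover have "c * ln 2 = m" by (simp add: c_def)
      ultimately show ?thesis by (simp add: m_def)
    qed
    have "{z \<in> S. \<epsilon> \<le> k z} = (cball z0 R - ball z0 (R/2)) \<inter> k -` {\<epsilon>..}"
    proof (rule set_eqI)
      fix z
      consider "norm (z - z0) < R/2" | "norm (z - z0) = R/2" | "R/2 < norm (z - z0)" "norm (z - z0) < R"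
        | "norm (z - z0) = R" | "norm (z - z0) > R" by linarith
      then show "z \<in> {z \<in> S. \<epsilon> \<le> k z} \<longleftrightarrow> z \<in> (cball z0 R - ball z0 (R/2)) \<inter> k -` {\<epsilon>..}"
        by cases (use out[of z] inn[of z] ep R in \<open>auto simp: S_def dist_norm norm_minus_commute\<close>)
    qed
    moreover have "closed ((cball z0 R - ball z0 (R/2)) \<inter> k -` {\<epsilon>..})"
    proof (rule continuous_closed_preimage)
      show "continuous_on (cball z0 R - ball z0 (R/2)) k"
        unfolding k_def using R by (intro continuous_intros continuous_on_subset[OF conth]) auto
    qed (auto intro: closed_Diff)
    ultimately show "closed {z \<in> S. \<epsilon> \<le> k z}" by simp
  qed (use z in auto)
  have bound: "u (p + t *\<^sub>R ?N) - 1 \<le> - (c / R) * t" if t: "0 < t" "t < R/2" for t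
  proof -
    define z where "z = v2c (p + t *\<^sub>R ?N)"
    have "p + t *\<^sub>R ?N - y0 = (t - R) *\<^sub>R ?N" by (simp add: y0_def algebra_simps)
    then have nz: "norm (z - z0) = R - t"
      using dz[of z] t N1 by (simp add: z_def dist_norm)
    then have "z \<in> S" using t by (auto simp: S_def dist_norm norm_minus_commute)
    then have "k z \<le> 0" by (rule kle)
    then have 1: "u (p + t *\<^sub>R ?N) - 1 \<le> - c * (ln R - ln (R - t))" by (simp add: k_def h_def z_def[symmetric] nz) (simp add: z_def)
    have "ln ((R - t) / R) \<le> (R - t) / R - 1" using t R by (intro ln_le_minus_one) auto
    moreover have "ln ((R - t) / R) = ln (R - t) - ln R" using t R by (intro ln_divide_pos) auto
    moreover have "(R - t) / R - 1 = - (t / R)" using R by (simp add: field_simps)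
    ultimately have "ln (R - t) - ln R \<le> - (t / R)" by linarith
    then have "c * (t / R) \<le> c * (ln R - ln (R - t))" using c by (intro mult_left_mono) auto
    then show ?thesis using 1 by simp
  qed
  have "((\<lambda>t. (u (p + t *\<^sub>R ?N) - u (p + 0 *\<^sub>R ?N)) / (t - 0)) \<longlongrightarrow> grad_bd p \<bullet> ?N) (at_right 0)"
    using normal_derivative[OF p(1)] unfolding has_exterior_normal_derivative_def has_field_derivative_iff .
  moreover have "\<forall>\<^sub>F t in at_right 0. (u (p + t *\<^sub>R ?N) - u (p + 0 *\<^sub>R ?N)) / (t - 0) \<le> - (c / R)"
    using eventually_at_right_real[of 0 "R/2"] R(1)
  proof -
    have "\<forall>\<^sub>F t in at_right 0. t \<in> {0<..<R/2}" using R(1) by (intro eventually_at_right_real) auto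
    then show ?thesis
    proof eventually_elim
      case (elim t)
      have "u p = 1" using bdry p(1) by blast
      then show ?case using bound[of t] elim by (simp add: divide_le_eq)
    qed
  qed
  ultimately have "grad_bd p \<bullet> ?N \<le> - (c / R)" by (intro tendsto_upperbound) auto
  then show ?thesis using c R by (smt (verit) divide_pos_pos)
qed

lemma cgrad_bd_frontier_nz: "z \<in> frontier A \<Longrightarrow> cgrad_bd z \<noteq> 0"
proof
  assume z: "z \<in> frontier A" "cgrad_bd z = 0"
  have "grad_bd (c2v z) = 0" using z(2) v2c_grad_bd[of "c2v z"] by (metis c2v_v2c c2v_diff cancel_comm_monoid_add_class.diff_cancel complex_cnj_zero v2c_c2v)
  then show False using hopf[OF frontier_A[OF z(1)]] by simp
qed

text \<open>The hypotheses under which the conformal map extends to the circle.\<close>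
lemma cgrad_bd_boundary_hyps:
  "continuous_on (closure (- A)) cgrad_bd" "\<And>w. w \<in> ball 0 1 \<Longrightarrow> w \<noteq> 0 \<Longrightarrow> cgrad_bd (F w) = - w / \<kappa> w"
proof -
  show "continuous_on (closure (- A)) cgrad_bd"
    using closure_exterior[of outer] by (intro cgrad_bd_cont) (auto simp: closure_compl_A)
  show "cgrad_bd (F w) = - w / \<kappa> w" if w: "w \<in> ball 0 1" "w \<noteq> 0" for w
  proof -
    have "c2v (F w) \<notin> closure \<Omega>" using F_notin[OF w] notin_A split_exterior by blast
    then show ?thesis using cgrad_bd_eq green(2)[OF w] by simp
  qed
qed

end

section \<open>Absence of holes\<close>

text \<open>If the normal is constant along the curve, all slopes agree with \<open>\<phi>' 0\<close>.\<close>
lemma (in boundary_chart) straight_graph: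
  assumes \<epsilon>: "\<epsilon> > 0" "\<epsilon> \<le> r" and gr: "\<And>s. \<bar>s\<bar> < \<epsilon> \<Longrightarrow> graph s \<in> ball p r"
    and perp: "\<And>s. \<bar>s\<bar> < \<epsilon> \<Longrightarrow> tang s \<bullet> nrm 0 = 0"
    and s: "\<bar>s\<bar> < \<epsilon>"
  shows "graph s = p + s *\<^sub>R tang 0"
proof -
  have slope: "\<phi>' x = \<phi>' 0" if "\<bar>x\<bar> < \<epsilon>" for x
    using perp[OF that] q_pos(1)[of 0]
    by (simp add: tang_def nrm_def inner_left_distrib inner_diff_right ee nn ne en)
  have "\<exists>c. \<forall>x\<in>{-\<epsilon><..<\<epsilon>}. \<phi> x - \<phi>' 0 * x = c"
  proof (rule has_field_derivative_zero_constant)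
    fix x assume x: "x \<in> {-\<epsilon><..<\<epsilon>}"
    have "(\<phi> has_real_derivative \<phi>' 0) (at x)" using der[of x] slope[of x] x \<epsilon> by auto
    then have "((\<lambda>x. \<phi> x - \<phi>' 0 * x) has_real_derivative 0) (at x)"
      by (auto intro!: derivative_eq_intros)
    then show "((\<lambda>x. \<phi> x - \<phi>' 0 * x) has_real_derivative 0) (at x within {-\<epsilon><..<\<epsilon>})"
      by (rule has_field_derivative_at_within)
  qed simp
  then obtain c where c: "\<And>x. x \<in> {-\<epsilon><..<\<epsilon>} \<Longrightarrow> \<phi> x - \<phi>' 0 * x = c" by blast
  have "\<phi> s = \<phi>' 0 * s" using c[of s] c[of 0] s \<epsilon> phi0 by (auto simp: abs_less_iff)
  then show ?thesis by (simp add: graph_def pt_def tang_def scaleR_add_right mult.commute)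
qed

text \<open>By the parallelogram law, a ball around the origin contains no segment with midpoint on its
  boundary sphere.\<close>
lemma farthest_point_no_segment:
  fixes p w :: "'a::real_inner"
  assumes "norm (p + w) \<le> norm p" "norm (p - w) \<le> norm p"
  shows "w = 0"
proof -
  have "(norm (p + w))\<^sup>2 + (norm (p - w))\<^sup>2 = 2 * (norm p)\<^sup>2 + 2 * (norm w)\<^sup>2"
    by (simp add: power2_norm_eq_inner inner_left_distrib inner_right_distrib inner_diff_left inner_diff_right inner_commute)
  moreover have "(norm (p + w))\<^sup>2 \<le> (norm p)\<^sup>2" "(norm (p - w))\<^sup>2 \<le> (norm p)\<^sup>2"
    using assms by (auto intro: power_mono)
  ultimately have "(norm w)\<^sup>2 \<le> 0" by linarith
  then show ?thesis by simp
qed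

context overdetermined begin

lemma u_eq_1_on_holes:
  assumes x: "x \<in> holes" shows "u x = 1"
proof -
  define S where "S = v2c ` holes"
  have Sx: "z \<in> S \<longleftrightarrow> c2v z \<in> holes" for z by (simp add: S_def v2c_image)
  have ext: "c2v z \<notin> closure \<Omega>" if "z \<in> S" for z using that Sx split_exterior by blast
  have S: "open S" "bounded S"
    unfolding S_def using open_v2c[OF open_holes] bounded_linear_image[OF _ bounded_linear_v2c, of holes] bdd
    by (auto simp: holes_def bounded_inside bounded_closure)
  have bd: "u y = 1" if "y \<in> closure holes" "y \<notin> holes" for y using frontier_piece[of holes] bdry that by blast
  have le: "\<sigma> * (u (c2v z) - 1) \<le> 0" if z: "z \<in> S" for \<sigma> z
  proof (rule harmonic_max_principle[where S = S and h = "\<lambda>z. \<sigma> * (u (c2v z) - 1)" and K = "\<lambda>z. of_real \<sigma> * cgrad u z" and z = z])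
    show "(\<lambda>z. of_real \<sigma> * cgrad u z) holomorphic_on S"
      using ext by (intro holomorphic_intros holomorphic_on_subset[OF cgrad_hol]) auto
    fix z assume z: "z \<in> S"
    have r: "Re (complex_of_real x * y) = x * Re y" for x y by simp
    have "((\<lambda>z. \<sigma> * (u (c2v z) - 1)) has_derivative (\<lambda>v. \<sigma> * (Re (cgrad u z * v) - 0))) (at z)"
      by (intro derivative_intros has_derivative_mult_right cgrad_der ext z)
    moreover have "(\<lambda>v. \<sigma> * (Re (cgrad u z * v) - 0)) = (\<lambda>v. Re (of_real \<sigma> * cgrad u z * v))"
      unfolding mult.assoc by (simp only: r diff_0_right)
    ultimately show "((\<lambda>z. \<sigma> * (u (c2v z) - 1)) has_derivative (\<lambda>v. Re (of_real \<sigma> * cgrad u z * v))) (at z)" by simp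
  next
    fix \<epsilon> :: real assume ep: "\<epsilon> > 0"
    have "{z \<in> S. \<epsilon> \<le> \<sigma> * (u (c2v z) - 1)} = c2v -` closure holes \<inter> (\<lambda>z. \<sigma> * (u (c2v z) - 1)) -` {\<epsilon>..}"
      using Sx bd ep closure_subset by fastforce
    moreover have "closed (c2v -` closure holes \<inter> (\<lambda>z. \<sigma> * (u (c2v z) - 1)) -` {\<epsilon>..})"
    proof (rule continuous_closed_preimage)
      show "continuous_on (c2v -` closure holes) (\<lambda>z. \<sigma> * (u (c2v z) - 1))"
        using closure_exterior[of holes]
        by (intro continuous_intros continuous_on_compose2[OF u_cont] continuous_on_c2v continuous_on_id) auto
      show "closed (c2v -` closure holes)"
        by (intro closed_vimage continuous_on_c2v continuous_on_id closed_closure)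
    qed auto
    ultimately show "closed {z \<in> S. \<epsilon> \<le> \<sigma> * (u (c2v z) - 1)}" by simp
  qed (use S z in auto)
  have "v2c x \<in> S" using x by (simp add: Sx)
  then show ?thesis using le[of "v2c x" 1] le[of "v2c x" "-1"] by simp
qed

lemma grad_zero_on_holes:
  assumes "x \<in> closure holes" shows "grad_bd x = 0"
proof (rule continuous_constant_on_closure[of holes grad_bd])
  show "continuous_on (closure holes) grad_bd"
    by (rule continuous_on_subset[OF grad_bd_cont]) (use closure_exterior[of holes] in blast)
  fix y assume y: "y \<in> holes"
  then have ext: "y \<notin> closure \<Omega>" using split_exterior by blast
  have "(u has_derivative (\<lambda>v. 0)) (at y)"
    by (rule has_derivative_transform_within_open[OF has_derivative_const[of 1 "at y"] open_holes y]) (simp add: u_eq_1_on_holes)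
  then have "frechet_derivative u (at y) = (\<lambda>v. 0)" by (rule frechet_derivative_at[symmetric])
  then show "grad_bd y = 0" using ext by (simp add: grad_bd_def gx gy partial_deriv_def)
qed (rule assms)

text \<open>A point \<open>p\<close> of the closed holes farthest from the origin lies on the boundary. There the gradient
  vanishes, the Neumann condition with \<open>\<Gamma> = 1\<close> reduces to curvature zero, and the boundary near \<open>p\<close> is
  a straight segment with midpoint \<open>p\<close>.\<close>
lemma no_holes:
  assumes \<Gamma>: "\<Gamma> = 1" shows "holes = {}"
proof (rule ccontr)
  assume ne: "holes \<noteq> {}"
  have "compact (closure holes)" using bdd by (simp add: holes_def bounded_inside bounded_closure compact_closure)
  moreover have "closure holes \<noteq> {}" using ne by simp
  ultimately obtain p where p: "p \<in> closure holes" "\<And>x. x \<in> closure holes \<Longrightarrow> norm x \<le> norm p"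
    using continuous_attains_sup[of "closure holes" norm] continuous_on_norm_id by blast
  have "p \<notin> holes"
  proof
    assume "p \<in> holes"
    then obtain d where d: "d > 0" "ball p d \<subseteq> holes" using open_holes open_contains_ball by blast
    define w :: "real^2" where "w = (d/2) *\<^sub>R axis 1 1"
    have "norm w = d/2" using d by (simp add: w_def norm_axis_1)
    then have "p + w \<in> holes" "p - w \<in> holes" using d by (auto simp: dist_norm)
    then have "w = 0" using p(2) closure_subset by (intro farthest_point_no_segment[of p]) blast+
    then show False using \<open>norm w = d/2\<close> d by simp
  qed
  then have pf: "p \<in> frontier \<Omega>" using frontier_piece[of holes p] p(1) by blast
  obtain \<rho> where \<rho>: "\<rho> > 0" "ball p \<rho> - closure \<Omega> \<subseteq> holes" using exterior_near_boundary[of holes p] p(1) pf by blast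
  have near_holes: "x \<in> closure holes" if "x \<in> frontier \<Omega>" "x \<in> ball p \<rho>" for x
  proof -
    have "x \<in> closure (ball p \<rho> \<inter> - closure \<Omega>)"
      using open_Int_closure_subset[OF open_ball, of p \<rho> "- closure \<Omega>"] frontier_in_closure_exterior[OF that(1)] that(2) by blast
    moreover have "ball p \<rho> \<inter> - closure \<Omega> \<subseteq> holes" using \<rho>(2) by blast
    ultimately show ?thesis using closure_mono by blast
  qed
  obtain e n r L \<phi> \<phi>' where "boundary_chart \<Omega> p e n r L \<phi> \<phi>'"
    using C11_boundary_chart[OF open_dom C11 pf] by blast
  then interpret ch: boundary_chart \<Omega> p e n r L \<phi> \<phi>' .
  obtain \<epsilon>1 where e1: "\<epsilon>1 > 0" "\<epsilon>1 \<le> r" "\<And>s. \<bar>s\<bar> < \<epsilon>1 \<Longrightarrow> ch.graph s \<in> ball p r" using ch.graph_near by blast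
  obtain \<epsilon>2 where e2: "\<epsilon>2 > 0" "\<epsilon>2 \<le> r" "\<And>s. \<bar>s\<bar> < \<epsilon>2 \<Longrightarrow> \<bar>\<phi> s\<bar> < \<rho>/2"
    using ch.small_phi[of "\<rho>/2"] \<rho> by auto
  define \<epsilon> where "\<epsilon> = min \<epsilon>1 (min \<epsilon>2 (\<rho>/2))"
  have ep: "\<epsilon> > 0" "\<epsilon> \<le> r" using e1 e2 \<rho> by (auto simp: \<epsilon>_def)
  have gb: "ch.graph s \<in> ball p r" if "\<bar>s\<bar> < \<epsilon>" for s using e1(3) that by (simp add: \<epsilon>_def)
  have gf: "ch.graph s \<in> frontier \<Omega>" if "\<bar>s\<bar> < \<epsilon>" for s by (rule ch.graph_in_frontier[OF gb[OF that]])
  have graph_holes: "ch.graph s \<in> closure holes" if s: "\<bar>s\<bar> < \<epsilon>" for s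
  proof (rule near_holes[OF gf[OF s]])
    have "\<bar>s\<bar> < \<rho>/2" "\<bar>\<phi> s\<bar> < \<rho>/2" using s e2(3) by (auto simp: \<epsilon>_def)
    then show "ch.graph s \<in> ball p \<rho>" using ch.dist_pt[of s "\<phi> s"] by (simp add: ch.graph_def)
  qed
  define N where "N s = outer_normal \<Omega> (ch.graph s)" for s
  define J where "J = {-\<epsilon><..<\<epsilon>}"
  have J: "s \<in> J \<longleftrightarrow> \<bar>s\<bar> < \<epsilon>" for s by (auto simp: J_def)
  have oJ: "open J" by (simp add: J_def)
  have td: "(ch.graph has_vector_derivative ch.tang s) (at s)" if "s \<in> J" for s
    using ch.graph_deriv[of s] that ep by (auto simp: J_def)
  have gfJ: "ch.graph s \<in> frontier \<Omega>" if "s \<in> J" for s using gf that J by blast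
  note cb = curve_in_boundary[OF open_dom C11 oJ gfJ td ch.tang_nz exceptional_null, folded N_def]
  define Z where "Z = {t \<in> J. \<not> ((N has_vector_derivative (- curvature \<Omega> (ch.graph t)) *\<^sub>R ch.tang t) (at t) \<and> ch.graph t \<notin> exceptional)}"
  have Z: "negligible Z" using cb(3) by (simp add: Z_def)
  have dN: "(N has_vector_derivative 0) (at s)" if s: "s \<in> J" "s \<notin> Z" for s
  proof -
    have 1: "(N has_vector_derivative (- curvature \<Omega> (ch.graph s)) *\<^sub>R ch.tang s) (at s)" "ch.graph s \<notin> exceptional"
      using s by (auto simp: Z_def)
    have "grad_bd (ch.graph s) = 0" using graph_holes s(1) J grad_zero_on_holes by blast
    then have "curvature \<Omega> (ch.graph s) = 0" using neumann_grad[OF gfJ[OF s(1)] 1(2)] \<Gamma> by simp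
    then show ?thesis using 1(1) by simp
  qed
  have lipN: "lip_at N s" if "s \<in> J" for s using cb(2) that by blast
  have Nc: "N s = N 0" if s: "s \<in> J" for s
  proof (cases "s \<ge> 0")
    case True
    have sub: "{0..s} \<subseteq> J" using s True by (auto simp: J_def)
    have "N 0 = N s"
      by (rule lip_at_ae_zero_derivative_imp_const[OF True _ Z]) (use sub lipN dN in blast)+
    then show ?thesis by simp
  next
    case False
    have sub: "{s..0} \<subseteq> J" using s False by (auto simp: J_def)
    show ?thesis
      by (rule lip_at_ae_zero_derivative_imp_const[OF _ _ Z]) (use sub lipN dN False in \<open>auto\<close>)
  qed
  have N0: "N 0 = ch.nrm 0" using ch.outer_normal_graph[OF gb[of 0]] ep by (simp add: N_def)
  have line: "ch.graph s = p + s *\<^sub>R ch.tang 0" if "\<bar>s\<bar> < \<epsilon>" for s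
  proof (rule ch.straight_graph[OF ep gb _ that])
    fix s assume "\<bar>s\<bar> < \<epsilon>"
    then show "ch.tang s \<bullet> ch.nrm 0 = 0" using cb(1)[of s] Nc[of s] N0 J by simp
  qed
  have "p + (\<epsilon>/2) *\<^sub>R ch.tang 0 \<in> closure holes" "p - (\<epsilon>/2) *\<^sub>R ch.tang 0 \<in> closure holes"
    using graph_holes[of "\<epsilon>/2"] graph_holes[of "-\<epsilon>/2"] line[of "\<epsilon>/2"] line[of "-\<epsilon>/2"] ep by auto
  then have "(\<epsilon>/2) *\<^sub>R ch.tang 0 = 0" using p(2) by (intro farthest_point_no_segment[of p]) blast+
  then show False using ep ch.tang_nz by simp
qed

lemma exterior_map_exists:
  assumes x: "x \<in> \<Omega>" shows "\<exists>\<phi> \<psi>. exterior_map A (v2c x) \<phi> \<psi>"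
  by (rule exterior_uniformization[OF compact_A connected_A connected_compl_A dom_interior_A[OF x]])
     (intro exI, rule exterior_map.intro[OF compact_A]; assumption)

text \<open>Every boundary point of a graph domain is approached from outside the closure.\<close>
lemma interior_closure_dom: "interior (closure \<Omega>) = \<Omega>"
proof
  show "\<Omega> \<subseteq> interior (closure \<Omega>)" by (simp add: interior_maximal closure_subset open_dom)
  show "interior (closure \<Omega>) \<subseteq> \<Omega>"
  proof
    fix x assume x: "x \<in> interior (closure \<Omega>)"
    then have "x \<notin> closure (- closure \<Omega>)" by (simp add: closure_complement)
    then show "x \<in> \<Omega>" using frontier_in_closure_exterior[of x] x interior_subset by (auto simp: frontier_dom)
  qed
qed

end

section \<open>The domain is a disc\<close>

context overdetermined_map begin

lemma c2v_A: "c2v ` A = closure \<Omega> \<union> holes"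
proof -
  have "c2v ` A = - outer" by (simp add: filled_eq(1) image_image)
  then show ?thesis using split_exterior closure_subset by blast
qed

lemma area_hole: "pi + measure lebesgue holes \<le> pi * (norm cap)\<^sup>2"
proof -
  have holes: "holes \<in> lmeasurable" using open_holes bdd by (simp add: holes_def bounded_inside bounded_closure lmeasurable_open)
  have O: "\<Omega> \<in> lmeasurable" using open_dom bdd by (simp add: lmeasurable_open)
  have "\<Omega> \<inter> holes = {}" using split_exterior closure_subset by blast
  then have "measure lebesgue (\<Omega> \<union> holes) = pi + measure lebesgue holes" using measure_Un3[OF O holes] area by simp
  moreover have "measure lebesgue (\<Omega> \<union> holes) \<le> measure lebesgue (c2v ` A)"
  proof (rule measure_mono_fmeasurable)
    show "\<Omega> \<union> holes \<subseteq> c2v ` A" unfolding c2v_A using closure_subset by blast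
    show "\<Omega> \<union> holes \<in> sets lebesgue" using O holes by (intro sets.Un fmeasurableD)
    have "compact (c2v ` A)" by (intro compact_continuous_image continuous_on_c2v continuous_on_id compact_A)
    then show "c2v ` A \<in> lmeasurable" by (rule lmeasurable_compact)
  qed
  ultimately show ?thesis using cap_area by linarith
qed

text \<open>With \<open>k t = kh (cis t)\<close>, the curve \<open>p\<close> has derivative \<open>- \<i> k cis (- t)\<close>. Its normal \<open>n\<close> is
  orthogonal to it, and the sign given by the Hopf lemma yields \<open>n = P cis (- t)\<close> with \<open>P = k / \<bar>k\<bar>\<close>. The
  normal derivative of \<open>u\<close> is \<open>- 1 / \<bar>k\<bar>\<close>. Since \<open>n' = - H p'\<close> with the curvature \<open>H\<close>, the phase
  satisfies \<open>P' = \<i> (1 + H \<bar>k\<bar>) P\<close>, and eliminating \<open>H\<close> with the Neumann condition gives the phase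
  equation.\<close>
lemma boundary_phase:
  obtains kh where "continuous_on (cball 0 1) kh" "\<And>w. w \<in> ball 0 1 \<Longrightarrow> kh w = \<kappa> w"
    "\<And>w. w \<in> cball 0 1 \<Longrightarrow> kh w \<noteq> 0"
    "\<Gamma> = 1 \<Longrightarrow> \<forall>t\<ge>0. kh (cis t) / of_real (norm (kh (cis t))) = kh 1 / of_real (norm (kh 1))"
    "\<Gamma> \<noteq> 1 \<Longrightarrow> ((\<lambda>t. norm (kh (cis t))) has_integral 2 * pi) {0..2*pi}"
proof -
  obtain kh \<gamma> where kh: "continuous_on (cball 0 1) kh" "\<And>w. w \<in> ball 0 1 \<Longrightarrow> kh w = \<kappa> w"
    "\<And>w. w \<in> cball 0 1 \<Longrightarrow> kh w \<noteq> 0" and \<gamma>: "\<And>t. \<gamma> t \<in> frontier A"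
    "\<And>t. (\<gamma> has_vector_derivative (- \<i> * kh (cis t) * cis (- t))) (at t)"
    "\<And>t. cgrad_bd (\<gamma> t) = - cis t / kh (cis t)"
    using boundary_curve[OF cgrad_bd_boundary_hyps(1) cgrad_bd_frontier_nz cgrad_bd_boundary_hyps(2)] by blast
  define k where "k t = kh (cis t)" for t
  have knz: "k t \<noteq> 0" for t unfolding k_def by (rule kh(3)) simp
  define p where "p t = c2v (\<gamma> t)" for t
  define p' where "p' t = c2v (- \<i> * k t * cis (- t))" for t
  have pf: "p t \<in> frontier \<Omega>" "p t \<in> closure outer" for t using frontier_A[OF \<gamma>(1)] by (auto simp: p_def)
  have dp: "(p has_vector_derivative p' t) (at t)" for t
    using bounded_linear.has_vector_derivative[OF bounded_linear_c2v \<gamma>(2)[of t]]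
    unfolding p_def[abs_def] p'_def k_def .
  have p'nz: "p' t \<noteq> 0" for t
  proof -
    have "norm (p' t) = norm (k t)" by (simp add: p'_def norm_mult)
    then show ?thesis using knz[of t] by auto
  qed
  define n where "n t = v2c (outer_normal \<Omega> (p t))" for t
  note cb = curve_in_boundary[OF open_dom C11 open_UNIV pf(1) dp p'nz exceptional_null]
  have N1: "norm (n t) = 1" for t
    using outward_exterior[OF pf(1)[of t]] unfolding n_def norm_v2c by metis
  have gN: "grad_bd (p t) \<bullet> outer_normal \<Omega> (p t) = Re (- (cis t / k t) * n t)" for t
  proof -
    have "grad_bd (p t) = c2v (cnj (- cis t / k t))"
      using v2c_grad_bd[of "p t"] \<gamma>(3)[of t] by (metis c2v_v2c k_def p_def v2c_c2v)
    then have "grad_bd (p t) \<bullet> outer_normal \<Omega> (p t) = cnj (- cis t / k t) \<bullet> n t"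
      unfolding n_def using inner_c2v[of "cnj (- cis t / k t)" "v2c (outer_normal \<Omega> (p t))"] by simp
    also have "\<dots> = Re (- cis t / k t * n t)"
      by (simp only: inner_complex_def cnj.sel times_complex.sel)
    finally show ?thesis by simp
  qed
  define P where "P t = k t / of_real (norm (k t))" for t
  have nP: "n t = P t * cis (- t)" for t
  proof -
    \<comment> \<open>Orthogonality makes \<open>z\<close> real and the Hopf lemma makes it positive; its modulus is \<open>\<bar>k\<bar>\<close>.\<close>
    have "p' t \<bullet> outer_normal \<Omega> (p t) = 0" by (rule cb(1)) simp
    then have "(- \<i> * k t * cis (- t)) \<bullet> n t = 0"
      unfolding n_def p'_def using inner_c2v[of "- \<i> * k t * cis (- t)" "v2c (outer_normal \<Omega> (p t))"] by simp
    moreover define z where "z = cnj (k t * cis (- t)) * n t"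
    moreover have "(- \<i> * v) \<bullet> w = Im (cnj v * w) * (- 1)" for v w by (simp add: inner_complex_def)
    ultimately have Im0: "Im z = 0" by (simp only: mult.assoc)
    have nz: "norm z = norm (k t)" using N1 by (simp add: z_def norm_mult)
    have kk: "cis t * z = cnj (k t) * (cis t * cis t) * n t" by (simp add: z_def cis_cnj mult_ac)
    have e: "- (cis t / k t) * n t = - z / of_real ((norm (k t))\<^sup>2)"
    proof -
      have "of_real ((norm (k t))\<^sup>2) = k t * cnj (k t)" by (simp only: complex_norm_square)
      then show ?thesis using knz[of t] by (simp add: z_def cis_cnj)
    qed
    have "Re (- (cis t / k t) * n t) < 0" using hopf[OF pf] gN by metis
    then have "Re z > 0" unfolding e using knz[of t]
      by (simp add: zero_less_divide_iff flip: of_real_power)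
    then have "z = of_real (norm (k t))" using Im0 nz by (simp add: complex_eq_iff cmod_def)
    then have "k t * cis (- t) * z = k t * cis (- t) * of_real (norm (k t))" by simp
    moreover have "k t * cis (- t) * z = of_real ((norm (k t))\<^sup>2) * n t"
    proof -
      have "k t * cis (- t) * cnj (k t * cis (- t)) = of_real ((norm (k t * cis (- t)))\<^sup>2)"
        by (simp only: complex_norm_square)
      then show ?thesis unfolding z_def mult.assoc[symmetric] by (simp add: norm_mult)
    qed
    ultimately have "of_real ((norm (k t))\<^sup>2) * n t = k t * cis (- t) * of_real (norm (k t))" by metis
    then have "of_real (norm (k t)) * n t = k t * cis (- t)" using knz[of t] by (simp add: power2_eq_square mult_ac)
    then show ?thesis using knz[of t] by (simp add: P_def field_simps)
  qed
  have gval: "grad_bd (p t) \<bullet> outer_normal \<Omega> (p t) = - 1 / norm (k t)" for t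
  proof -
    have "- (cis t / k t) * n t = of_real (- 1 / norm (k t))"
      using knz[of t] by (simp add: nP P_def cis_mult flip: cis_divide)
    then show ?thesis unfolding gN by simp
  qed
  have Pn: "P t = n t * cis t" for t by (simp add: nP cis_mult mult.assoc)
  have dcis: "(cis has_vector_derivative \<i> * cis t) (at t)" for t
    using has_derivative_cis[OF has_derivative_ident[of "at t"]] by (simp add: has_vector_derivative_def)
  define H where "H t = curvature \<Omega> (p t)" for t
  define m where "m t = 1 + H t * norm (k t)" for t
  define Z where "Z = {t. \<not> (((\<lambda>t. outer_normal \<Omega> (p t)) has_vector_derivative (- curvature \<Omega> (p t)) *\<^sub>R p' t) (at t) \<and> p t \<notin> exceptional)}"
  have Z: "negligible Z" using cb(3) by (simp add: Z_def)
  have lipP: "lip_at P t" for t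
  proof -
    have "lip_at n t" unfolding n_def[abs_def] by (rule lip_at_1_lipschitz[OF cb(2)]) auto
    then show ?thesis unfolding Pn[abs_def] by (intro lip_at_mult lip_at_differentiable[OF dcis])
  qed
  have dP: "(P has_vector_derivative \<i> * of_real (m t) * P t) (at t)" and mt: "\<Gamma> * m t = (\<Gamma> - 1) * (1 - norm (k t))"
    if t: "t \<notin> Z" for t
  proof -
    have 1: "((\<lambda>t. outer_normal \<Omega> (p t)) has_vector_derivative (- H t) *\<^sub>R p' t) (at t)" "p t \<notin> exceptional"
      using t by (auto simp: Z_def H_def)
    have "(n has_vector_derivative v2c ((- H t) *\<^sub>R p' t)) (at t)"
      unfolding n_def[abs_def] by (rule bounded_linear.has_vector_derivative[OF bounded_linear_v2c 1(1)])
    moreover have "v2c ((- H t) *\<^sub>R p' t) = \<i> * of_real (H t) * k t * cis (- t)"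
      unfolding v2c_scaleR p'_def v2c_c2v by (simp add: scaleR_conv_of_real mult_ac)
    moreover have "k t = of_real (norm (k t)) * P t" using knz[of t] by (simp add: P_def)
    ultimately have dn: "(n has_vector_derivative \<i> * of_real (H t) * (of_real (norm (k t)) * P t) * cis (- t)) (at t)" by simp
    have "(P has_vector_derivative n t * (\<i> * cis t) + \<i> * of_real (H t) * (of_real (norm (k t)) * P t) * cis (- t) * cis t) (at t)"
      unfolding Pn[abs_def] by (rule has_vector_derivative_mult[OF dn[unfolded Pn[abs_def]] dcis])
    moreover have "n t * (\<i> * cis t) + \<i> * of_real (H t) * (of_real (norm (k t)) * P t) * cis (- t) * cis t = \<i> * of_real (m t) * P t"
    proof -
      have "y * cis (- t) * cis t = y" for y by (simp add: mult.assoc cis_mult)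
      moreover have "n t * (\<i> * cis t) = \<i> * P t" by (simp add: Pn mult_ac)
      ultimately show ?thesis by (simp add: m_def algebra_simps)
    qed
    ultimately show "(P has_vector_derivative \<i> * of_real (m t) * P t) (at t)" by simp
    have "- 1 / norm (k t) = \<Gamma> * H t + \<Gamma> - 1"
      using neumann_grad[OF pf(1) 1(2)] gval[of t] by (simp add: H_def)
    then have "- 1 = (\<Gamma> * H t + \<Gamma> - 1) * norm (k t)" using knz[of t] by (simp add: field_simps)
    then show "\<Gamma> * m t = (\<Gamma> - 1) * (1 - norm (k t))" by (simp add: m_def algebra_simps)
  qed
  have lip: "lip_at (\<lambda>t. kh (cis t) / complex_of_real (norm (kh (cis t)))) t" for t
    using lipP unfolding P_def[abs_def] k_def .
  have der: "((\<lambda>t. kh (cis t) / complex_of_real (norm (kh (cis t)))) has_vector_derivative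
      \<i> * of_real (m t) * (kh (cis t) / complex_of_real (norm (kh (cis t))))) (at t)" if "t \<notin> Z" for t
    using dP[OF that] unfolding P_def[abs_def] k_def .
  have me: "\<Gamma> * m t = (\<Gamma> - 1) * (1 - norm (kh (cis t)))" if "t \<notin> Z" for t
    using mt[OF that] by (simp add: k_def)
  show ?thesis
  proof (rule that[OF kh])
    show "\<forall>t\<ge>0. kh (cis t) / of_real (norm (kh (cis t))) = kh 1 / of_real (norm (kh 1))" if "\<Gamma> = 1"
      using phase_equation(1)[OF kh(1,3) lip Z der me] that by blast
    show "((\<lambda>t. norm (kh (cis t))) has_integral 2 * pi) {0..2*pi}" if "\<Gamma> \<noteq> 1"
      using phase_equation(2)[OF kh(1,3) lip Z der me] that by blast
  qed
qed

text \<open>In both cases some nonzero \<open>c\<close> makes \<open>cnj c * kh\<close> real on the circle: for \<open>\<Gamma> = 1\<close> the constant phase,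
  and otherwise \<open>cap\<close>, by the equality case of the mean value inequality.\<close>
lemma kap_constant:
  shows "w \<in> ball 0 1 \<Longrightarrow> \<kappa> w = cap" and "\<Gamma> \<noteq> 1 \<Longrightarrow> norm cap = 1"
proof -
  obtain kh where kh: "continuous_on (cball 0 1) kh" "\<And>w. w \<in> ball 0 1 \<Longrightarrow> kh w = \<kappa> w"
    "\<And>w. w \<in> cball 0 1 \<Longrightarrow> kh w \<noteq> 0"
    and ph1: "\<Gamma> = 1 \<Longrightarrow> \<forall>t\<ge>0. kh (cis t) / of_real (norm (kh (cis t))) = kh 1 / of_real (norm (kh 1))"
    and ph2: "\<Gamma> \<noteq> 1 \<Longrightarrow> ((\<lambda>t. norm (kh (cis t))) has_integral 2 * pi) {0..2*pi}"
    using boundary_phase by blast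
  have ge: "norm (\<kappa> 0) \<ge> 1"
  proof -
    have "pi * 1 \<le> pi * (norm cap)\<^sup>2" using area_hole measure_nonneg[of lebesgue holes] by linarith
    then have "1 \<le> (norm cap)\<^sup>2" by simp
    then show ?thesis using kap_0 power2_le_imp_le[of 1 "norm cap"] by simp
  qed
  have rig: "norm cap = 1 \<and> (\<forall>w. norm w = 1 \<longrightarrow> Im (cnj cap * kh w) = 0)" if \<Gamma>: "\<Gamma> \<noteq> 1"
    using mean_modulus_rigidity[OF kap_hol kh(1,2) ph2[OF \<Gamma>] ge] kap_0 by simp
  then show "\<Gamma> \<noteq> 1 \<Longrightarrow> norm cap = 1" by blast
  have "\<exists>c. c \<noteq> 0 \<and> (\<forall>w. norm w = 1 \<longrightarrow> Im (cnj c * kh w) = 0)"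
  proof (cases "\<Gamma> = 1")
    case False then show ?thesis using rig cap_nz by blast
  next
    case True
    define c where "c = kh 1 / of_real (norm (kh 1))"
    have "Im (cnj c * kh w) = 0" if w: "norm w = 1" for w
    proof -
      obtain t where t: "t \<in> {0..2*pi}" "w = cis t" using w by (rule unit_is_cis)
      have "kh w / of_real (norm (kh w)) = c" using ph1[OF True] t by (simp add: c_def)
      moreover have "kh w \<noteq> 0" using kh(3) w by simp
      ultimately have "kh w = c * of_real (norm (kh w))" by (metis nonzero_eq_divide_eq norm_eq_zero of_real_eq_0_iff)
      then have "cnj c * kh w = of_real ((norm c)\<^sup>2 * norm (kh w))"
        by (metis complex_norm_square mult.assoc mult.commute of_real_mult)
      then show ?thesis by (metis Im_complex_of_real)
    qed
    moreover have "c \<noteq> 0" using kh(3)[of 1] by (simp add: c_def)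
    ultimately show ?thesis by blast
  qed
  then obtain c where c: "c \<noteq> 0" "\<And>w. norm w = 1 \<Longrightarrow> Im (cnj c * kh w) = 0" by blast
  assume w: "w \<in> ball 0 1"
  have "cnj c * \<kappa> w = cnj c * \<kappa> 0"
    by (rule real_boundary_values_imp_constant[where fh = "\<lambda>w. cnj c * kh w" and f = "\<lambda>w. cnj c * \<kappa> w"])
       (use w c kh in \<open>auto intro!: holomorphic_intros continuous_intros kap_hol\<close>)
  then show "\<kappa> w = cap" using c(1) kap_0 by simp
qed

lemma holes_empty: "holes = {}"
proof (cases "\<Gamma> = 1")
  case True then show ?thesis by (rule no_holes)
next
  case False
  then have "measure lebesgue holes \<le> 0" using area_hole kap_constant(2) by simp
  moreover have "holes \<in> lmeasurable" using open_holes bdd by (simp add: holes_def bounded_inside bounded_closure lmeasurable_open)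
  ultimately have "negligible holes" using measure_nonneg[of lebesgue holes] by (simp add: negligible_iff_measure)
  then show ?thesis using open_not_negligible[OF open_holes] by blast
qed

text \<open>The closure of \<open>\<Omega>\<close> is a closed disc, \<open>\<Omega>\<close> is the interior of its closure, and the area fixes the
  radius.\<close>
lemma dom_is_unit_ball: "\<Omega> = ball (c2v (a + B 0)) 1" and cap_unit: "norm cap = 1"
proof -
  let ?x = "c2v (a + B 0)"
  have "closure \<Omega> = c2v ` cball (a + B 0) (norm cap)"
    using c2v_A holes_empty constant_kap_imp_disc(1)[OF kap_constant(1)] by simp
  also have "\<dots> = cball ?x (norm cap)"
  proof (intro equalityI subsetI)
    fix y assume "y \<in> cball ?x (norm cap)"
    then have "dist (c2v (a + B 0)) (c2v (v2c y)) \<le> norm cap" by simp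
    then have "v2c y \<in> cball (a + B 0) (norm cap)" unfolding dist_c2v by simp
    then show "y \<in> c2v ` cball (a + B 0) (norm cap)" by (metis c2v_v2c imageI)
  qed auto
  finally have O: "\<Omega> = ball ?x (norm cap)" using interior_closure_dom by simp
  have "measure lebesgue \<Omega> = pi * (norm cap)\<^sup>2"
    unfolding O by (simp add: content_ball unit_ball_vol_2)
  then have "(norm cap)\<^sup>2 = 1" using area by simp
  then show c: "norm cap = 1" using norm_ge_zero[of cap] by (auto simp: power2_eq_1_iff)
  show "\<Omega> = ball ?x 1" using O c by simp
qed

lemma u_explicit:
  assumes x: "x \<notin> \<Omega>" shows "u x = 1 - ln (norm (x - c2v (a + B 0)))"
proof -
  let ?x = "c2v (a + B 0)"
  have cl: "closure \<Omega> = cball ?x 1" and fr: "frontier \<Omega> = sphere ?x 1"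
    by (simp_all add: dom_is_unit_ball)
  show ?thesis
  proof (cases "x \<in> closure \<Omega>")
    case True
    then have xf: "x \<in> frontier \<Omega>" using x by (simp add: frontier_dom)
    then have "norm (x - ?x) = 1" unfolding fr by (simp add: dist_norm norm_minus_commute)
    then show ?thesis using bdry xf by simp
  next
    case False
    then have "x \<in> outer" using split_exterior holes_empty by blast
    then have nA: "v2c x \<notin> A" by (simp add: notin_A)
    have w: "\<psi> (v2c x) \<in> ball 0 1" "\<psi> (v2c x) \<noteq> 0" using AF[OF nA] by auto
    have Fw: "F (\<psi> (v2c x)) = v2c x" by (rule F_psi[OF nA])
    have "v2c x = a + B 0 + cap / \<psi> (v2c x)"
      using constant_kap_imp_disc(2)[OF kap_constant(1) w] Fw by simp
    then have "v2c (x - ?x) = cap / \<psi> (v2c x)" unfolding v2c_diff v2c_c2v by (metis add_diff_cancel_left')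
    then have "norm (v2c (x - ?x)) = norm (cap / \<psi> (v2c x))" by (rule arg_cong)
    then have "norm (x - ?x) = 1 / norm (\<psi> (v2c x))" by (simp add: norm_divide cap_unit)
    moreover have "u x = 1 + ln (norm (\<psi> (v2c x)))" using green(1)[OF w] Fw by simp
    ultimately show ?thesis using w by (simp add: ln_div)
  qed
qed

end

theorem theorem5p1:
  fixes \<Gamma> :: real and \<Omega> :: "(real^2) set" and u :: "real^2 \<Rightarrow> real"
  assumes "is_domain \<Omega>" and "bounded \<Omega>" and "measure lebesgue \<Omega> = pi"
    and "C11_boundary \<Omega>"
    and "C2_on (- closure \<Omega>) u" and "C1_up_to_boundary (- \<Omega>) u"
    and "\<forall>x\<in>- closure \<Omega>. - laplacian u x = 0"
    and "\<forall>x\<in>frontier \<Omega>. u x = 1"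
    and "ae_on_curve (frontier \<Omega>)
           (\<lambda>x. has_exterior_normal_derivative u \<Omega> x (\<Gamma> * curvature \<Omega> x + \<Gamma> - 1))"
    and "(\<lambda>x. u x + ln (norm x)) \<in> O[at_infinity](\<lambda>_. 1)"
  shows "\<exists>x0. \<Omega> = ball x0 1 \<and>
           (\<forall>x\<in>- \<Omega>. u x = 1 - ln (norm (x - x0))) \<and>
           frontier \<Omega> = frontier (ball x0 1)"
proof -
  interpret overdetermined \<Gamma> \<Omega> u by (rule overdetermined.intro; fact assms)
  obtain x where "x \<in> \<Omega>" using dom_ne by blast
  then obtain \<phi> \<psi> where "exterior_map A (v2c x) \<phi> \<psi>" using exterior_map_exists by blast
  then interpret exterior_map A "v2c x" \<phi> \<psi> .
  interpret overdetermined_map \<Gamma> \<Omega> u "v2c x" \<phi> \<psi> ..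
  show ?thesis using dom_is_unit_ball u_explicit by (intro exI[of _ "c2v (v2c x + B 0)"]) auto
qed

end
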